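(* Let $\mu_0,\mu_1$ be such that for every connected, undirected graph (with finitely or countably infinitely many vertices) there exists a random variable $A$ such that, for the process on that graph, almost surely $A_u=A$ for all vertices $u$. Let $G=(V,E)$ be an infinite, connected, undirected graph with bounded degrees. Then $p(G)=1$.
   Context: Model. Let $\mu_0\neq\mu_1$ be mutually absolutely continuous probability measures on a measurable space $(\Omega,\mathcal{O})$. $V$ is a countable (finite or infinite) set of agents. The state of the world $S\in\{0,1\}$ and private signals $W_u\in\Omega$ ($u\in V$) have joint law $\frac12\delta_0\mu_0^V+\frac12\delta_1\mu_1^V$: $S$ is uniform on $\{0,1\}$ and, conditioned on $S$, the $W_u$ are i.i.d. with law $\mu_S$. The social network $G=(V,E)$ is a simple (no loops or parallel edges), strongly connected directed graph; it is undirected if $(u,v)\in E$ implies $(v,u)\in E$. $N(u)=\{v:(u,v)\in E\}$. For $t=1,2,\dots$ the information $\mathcal{F}_u(t)$ and action $A_u(t)\in\{0,1\}$ of agent $u$ are defined jointly by $\mathcal{F}_u(t)=\sigma(W_u,\{A_v(t'):v\in N(u),t'<t\})$ and $A_u(t)=0$ if $\mathbb{P}[S=1|\mathcal{F}_u(t)]<1/2$, $A_u(t)=1$ if $\mathbb{P}[S=1|\mathcal{F}_u(t)]>1/2$; if this probability equals $1/2$ then $A_u(t)\in\{0,1\}$ is given by a tie-breaking rule ($A_u(t)$ is $\mathcal{F}_u(t)$-measurable). The same model, with the same $\mu_0,\mu_1$ and the same (otherwise arbitrary) tie-breaking rule, is applied to different graphs. "Same rule" means: let $B_t(G,u)$ be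 the subgraph induced on vertices at directed distance at most $t$ from $u$, rooted at $u$; if $h:B_t(G,u)\to B_t(G',u')$ is a rooted graph isomorphism and $u,u'$ both face a tie at time $t$ with equal private signals and with $A_v(t')=A_{h(v)}(t')$ for all $v\in N(u)$, $t'<t$, then $u$ and $u'$ take the same action at time $t$. Let $\mathcal{F}_u$ be the $\sigma$-algebra generated by $\bigcup_t\mathcal{F}_u(t)$ and $X_u=\mathbb{P}[S=1|\mathcal{F}_u]$. The optimal action set of $u$ is $A_u=\{0\}$ if $X_u<1/2$, $A_u=\{1\}$ if $X_u>1/2$, $A_u=\{0,1\}$ if $X_u=1/2$. $p(G)=\lim_{t\to\infty}\mathbb{P}[A_u(t)=S]$ for the process on $G$; this limit exists and does not depend on $u$. *)

theory Defs
  imports "HOL-Probability.Probability" "Graph_Theory.Digraph_Component"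
begin

text \<open>
  Conventions. The values 0, 1 of the state and of the actions are \<^term>\<open>False\<close>,
  \<^term>\<open>True\<close>, and the two signal laws form a family \<open>\<mu>\<close> indexed by the state.
  An arc \<open>(u, v)\<close> means that \<open>u\<close> observes \<open>v\<close>. Periods are \<open>t = 1, 2, \<dots>\<close>; nothing is
  assumed about, or derived from, the value of an action at \<open>t = 0\<close> or at a non-vertex.
\<close>

definition signal_laws :: "(bool \<Rightarrow> 'o measure) \<Rightarrow> bool" where
  "signal_laws \<mu> \<longleftrightarrow>
     prob_space (\<mu> False) \<and> prob_space (\<mu> True) \<and>
     sets (\<mu> False) = sets (\<mu> True) \<and>
     absolutely_continuous (\<mu> False) (\<mu> True) \<and>
     absolutely_continuous (\<mu> True) (\<mu> False) \<and>
     \<mu> False \<noteq> \<mu> True"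

text \<open>Pair digraphs have no parallel arcs, so only loops have to be excluded.\<close>

definition social_network :: "'v pair_pre_digraph \<Rightarrow> bool" where
  "social_network G \<longleftrightarrow>
     countable (pverts G) \<and> pair_loopfree_digraph G \<and> strongly_connected (with_proj G)"

text \<open>For symmetric digraphs, connected and strongly connected mean the same.\<close>

definition undirected_network :: "'v pair_pre_digraph \<Rightarrow> bool" where
  "undirected_network G \<longleftrightarrow> social_network G \<and> symmetric (with_proj G)"

definition nbrs :: "'v pair_pre_digraph \<Rightarrow> 'v \<Rightarrow> 'v set" where
  "nbrs G u = {v. (u, v) \<in> parcs G}"

definition bounded_degrees :: "'v pair_pre_digraph \<Rightarrow> bool" where
  "bounded_degrees G \<longleftrightarrow> (\<exists>d. \<forall>u\<in>pverts G. finite (nbrs G u) \<and> card (nbrs G u) \<le> d)"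

text \<open>An outcome is a pair of the state of the world and the family of private signals.\<close>

type_synonym ('v, 'o) outcome = "bool \<times> ('v \<Rightarrow> 'o)"

definition world :: "(bool \<Rightarrow> 'o measure) \<Rightarrow> 'v set \<Rightarrow> ('v, 'o) outcome measure" where
  "world \<mu> V = measure_pmf (bernoulli_pmf (1/2)) \<bind>
     (\<lambda>s. return (count_space UNIV) s \<Otimes>\<^sub>M PiM V (\<lambda>_. \<mu> s))"

text \<open>An action process on one network: agent, period, outcome.\<close>

type_synonym ('v, 'o) actions = "'v \<Rightarrow> nat \<Rightarrow> ('v, 'o) outcome \<Rightarrow> bool"

definition info ::
  "(bool \<Rightarrow> 'o measure) \<Rightarrow> 'v pair_pre_digraph \<Rightarrow> ('v, 'o) actions \<Rightarrow> 'v \<Rightarrow> nat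
     \<Rightarrow> ('v, 'o) outcome measure" where
  "info \<mu> G A u t = (let \<Omega> = space (world \<mu> (pverts G)) in
     sigma \<Omega> ({(\<lambda>\<omega>. snd \<omega> u) -` B \<inter> \<Omega> | B. B \<in> sets (\<mu> True)} \<union>
              {{\<omega>\<in>\<Omega>. A v t' \<omega>} | v t'. v \<in> nbrs G u \<and> 1 \<le> t' \<and> t' < t}))"

definition limit_info ::
  "(bool \<Rightarrow> 'o measure) \<Rightarrow> 'v pair_pre_digraph \<Rightarrow> ('v, 'o) actions \<Rightarrow> 'v
     \<Rightarrow> ('v, 'o) outcome measure" where
  "limit_info \<mu> G A u =
     sigma (space (world \<mu> (pverts G))) (\<Union>t\<in>{1..}. sets (info \<mu> G A u t))"

text \<open>The conditional probability that the state is 1, given the sub-sigma-algebra \<open>F\<close>.\<close>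

definition posterior ::
  "(bool \<Rightarrow> 'o measure) \<Rightarrow> 'v pair_pre_digraph \<Rightarrow> ('v, 'o) outcome measure
     \<Rightarrow> ('v, 'o) outcome \<Rightarrow> real" where
  "posterior \<mu> G F = real_cond_exp (world \<mu> (pverts G)) F
     (indicator {\<omega> \<in> space (world \<mu> (pverts G)). fst \<omega>})"

abbreviation belief ::
  "(bool \<Rightarrow> 'o measure) \<Rightarrow> 'v pair_pre_digraph \<Rightarrow> ('v, 'o) actions \<Rightarrow> 'v \<Rightarrow> nat
     \<Rightarrow> ('v, 'o) outcome \<Rightarrow> real" where
  "belief \<mu> G A u t \<equiv> posterior \<mu> G (info \<mu> G A u t)"

text \<open>
  The joint definition of information and actions. In a tie the only requirement on a single
  network is that the action is measurable with respect to the agent's information.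
\<close>

definition learning_process ::
  "(bool \<Rightarrow> 'o measure) \<Rightarrow> 'v pair_pre_digraph \<Rightarrow> ('v, 'o) actions \<Rightarrow> bool" where
  "learning_process \<mu> G A \<longleftrightarrow>
     (\<forall>u\<in>pverts G. \<forall>t\<ge>1.
        A u t \<in> info \<mu> G A u t \<rightarrow>\<^sub>M count_space UNIV \<and>
        (\<forall>\<omega> \<in> space (world \<mu> (pverts G)).
           (belief \<mu> G A u t \<omega> < 1/2 \<longrightarrow> \<not> A u t \<omega>) \<and>
           (belief \<mu> G A u t \<omega> > 1/2 \<longrightarrow> A u t \<omega>)))"

definition ball_verts :: "'v pair_pre_digraph \<Rightarrow> nat \<Rightarrow> 'v \<Rightarrow> 'v set" where
  "ball_verts G t u = {v. \<exists>k\<le>t. (u, v) \<in> parcs G ^^ k}"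

text \<open>\<open>h\<close> is a rooted isomorphism between the induced balls of radius \<open>t\<close>.\<close>

definition ball_iso ::
  "nat \<Rightarrow> 'v pair_pre_digraph \<Rightarrow> 'v \<Rightarrow> 'v pair_pre_digraph \<Rightarrow> 'v \<Rightarrow> ('v \<Rightarrow> 'v) \<Rightarrow> bool" where
  "ball_iso t G u G' u' h \<longleftrightarrow>
     bij_betw h (ball_verts G t u) (ball_verts G' t u') \<and> h u = u' \<and>
     (\<forall>v\<in>ball_verts G t u. \<forall>w\<in>ball_verts G t u.
        (v, w) \<in> parcs G \<longleftrightarrow> (h v, h w) \<in> parcs G')"

text \<open>
  The same tie-breaking rule is used on all networks. \<open>act G\<close> is the action process on \<open>G\<close>;
  the processes on \<open>G\<close> and \<open>G'\<close> have different sample spaces, hence the two outcomes.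
\<close>

definition same_tie_breaking ::
  "(bool \<Rightarrow> 'o measure) \<Rightarrow> ('v pair_pre_digraph \<Rightarrow> ('v, 'o) actions) \<Rightarrow> bool" where
  "same_tie_breaking \<mu> act \<longleftrightarrow>
     (\<forall>G G' u u' t h.
        social_network G \<and> social_network G' \<and> u \<in> pverts G \<and> u' \<in> pverts G' \<and> 1 \<le> t \<and>
        ball_iso t G u G' u' h \<longrightarrow>
        (\<forall>\<omega> \<in> space (world \<mu> (pverts G)). \<forall>\<omega>' \<in> space (world \<mu> (pverts G')).
           belief \<mu> G (act G) u t \<omega> = 1/2 \<and> belief \<mu> G' (act G') u' t \<omega>' = 1/2 \<and>
           snd \<omega> u = snd \<omega>' u' \<and>
           (\<forall>v\<in>nbrs G u. \<forall>t'. 1 \<le> t' \<and> t' < t \<longrightarrow> act G v t' \<omega> = act G' (h v) t' \<omega>') \<longrightarrow>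
           act G u t \<omega> = act G' u' t \<omega>'))"

text \<open>
  The model, applied to all networks with vertices in the type \<open>'v\<close>. If \<open>'v\<close> is infinite,
  every countable graph has an isomorphic copy among them.
\<close>

definition learning_model ::
  "(bool \<Rightarrow> 'o measure) \<Rightarrow> ('v pair_pre_digraph \<Rightarrow> ('v, 'o) actions) \<Rightarrow> bool" where
  "learning_model \<mu> act \<longleftrightarrow>
     (\<forall>G. social_network G \<longrightarrow> learning_process \<mu> G (act G)) \<and> same_tie_breaking \<mu> act"

definition optimal_actions ::
  "(bool \<Rightarrow> 'o measure) \<Rightarrow> 'v pair_pre_digraph \<Rightarrow> ('v, 'o) actions \<Rightarrow> 'v
     \<Rightarrow> ('v, 'o) outcome \<Rightarrow> bool set" where
  "optimal_actions \<mu> G A u \<omega> = (let X = posterior \<mu> G (limit_info \<mu> G A u) \<omega> in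
     if X < 1/2 then {False} else if X > 1/2 then {True} else {False, True})"

definition agents_agree ::
  "(bool \<Rightarrow> 'o measure) \<Rightarrow> 'v pair_pre_digraph \<Rightarrow> ('v, 'o) actions \<Rightarrow> bool" where
  "agents_agree \<mu> G A \<longleftrightarrow>
     (\<exists>Z \<in> world \<mu> (pverts G) \<rightarrow>\<^sub>M count_space UNIV.
        AE \<omega> in world \<mu> (pverts G). \<forall>u\<in>pverts G. optimal_actions \<mu> G A u \<omega> = Z \<omega>)"

text \<open>\<open>p(G) = p\<close>: for every agent the probability of acting correctly converges to \<open>p\<close>.\<close>

definition has_learning_prob ::
  "(bool \<Rightarrow> 'o measure) \<Rightarrow> 'v pair_pre_digraph \<Rightarrow> ('v, 'o) actions \<Rightarrow> real \<Rightarrow> bool" where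
  "has_learning_prob \<mu> G A p \<longleftrightarrow>
     (\<forall>u\<in>pverts G.
        (\<lambda>t. measure (world \<mu> (pverts G))
               {\<omega> \<in> space (world \<mu> (pverts G)). A u t \<omega> = fst \<omega>}) \<longlonglongrightarrow> p)"

end

theory Submission
  imports Defs
begin

text \<open>
  Rescale the state to \<open>\<plusminus>1\<close> and beliefs to \<open>[-1, 1]\<close>, so that the limiting probability of acting
  correctly is \<open>(1 + E\<bar>x\<^sub>u\<bar>) / 2\<close> for the limiting belief \<open>x\<^sub>u\<close> of any agent \<open>u\<close>. What an agent knows
  at time \<open>t\<close> depends only on its ball of radius \<open>t\<close>, hence \<open>m = E\<bar>x\<^sub>u\<bar>\<close> is lower semicontinuous under
  local limits of rooted networks. As infinite networks of degree at most \<open>d\<close> are compact for these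
  limits, \<open>m\<close> has a minimiser \<open>H\<close>. Let \<open>H'\<close> be a limit of \<open>H\<close> rooted at vertices that go to infinity;
  it is a minimiser, too.

  The common action \<open>a\<close> in \<open>H\<close> is, given the state, asymptotically uncorrelated with what distant
  agents know at a fixed time (Bessel's inequality), so a distant agent may combine \<open>a\<close> with its own
  belief. Since \<open>a\<close> is optimal for that agent, this gives \<open>E max(\<bar>x\<bar>, \<kappa> x + m) \<le> m\<close> for every limiting
  belief \<open>x\<close> in \<open>H'\<close>, where \<open>\<kappa>\<close> and \<open>m\<close> describe the law of \<open>a\<close> given the state. By minimality
  \<open>E\<bar>x\<bar> = m = E(\<kappa> x + m)\<close>, so \<open>\<bar>x\<bar> = \<kappa> x + m\<close> almost surely, and \<open>x\<close> is determined by its sign, the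
  common action in \<open>H'\<close>. Thus all agents of \<open>H'\<close> have the same limiting belief. It has to account for
  every private signal, while it is asymptotically uncorrelated, given the state, with the signals of
  distant agents; this forces it to be the state, so \<open>m = 1\<close>.
\<close>

section \<open>Conditional expectations and almost sure equality\<close>

text \<open>Two limits are taken because the decorrelation of distant agents carries an error that
  vanishes only along a sequence: no single agent of \<open>H\<close> need satisfy the inequality.
  Up to any fixed time, an agent of \<open>H'\<close> is in law a copy of arbitrarily distant agents
  of \<open>H\<close>, so there the error is gone. The term \<kappa> x + m is the value of following
  \<open>a\<close> at belief x: if \<open>a\<close> has mean \<kappa> + m in state 1 and \<kappa> -
  m in state 0, it equals (1 + x)/2 (\<kappa> + m) - (1 - x)/2 (\<kappa> - m). Semicontinuity alone
  would yield E|x| \<le> m in \<open>H'\<close>; minimality supplies the reverse bound, which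
  collapses the inequality to an equation. Agreement enters twice: in \<open>H\<close> it makes
  \<open>a\<close> known to distant agents, in \<open>H'\<close> it turns equal signs into equal
  beliefs. The technical obstacle is that posteriors are determined only up to null sets, while ties
  are decided by their pointwise values and the resulting actions generate later information.
  Networks are therefore compared on a common sample space, with sigma-algebras identified modulo
  null events.\<close>

definition null_ext :: "'a measure \<Rightarrow> 'a measure \<Rightarrow> 'a measure" where
  "null_ext M F = sigma (space M) {A \<in> sets M. \<exists>B\<in>sets F. AE x in M. x \<in> A \<longleftrightarrow> x \<in> B}"

lemma space_null_ext [simp]: "space (null_ext M F) = space M"
  unfolding null_ext_def by (rule space_measure_of) (auto dest: sets.sets_into_space)

text \<open>Only sets measured by \<open>M\<close> are added, so \<open>null_ext M F\<close> is
  again a subalgebra of \<open>M\<close> and \<open>real_cond_exp\<close> applies to it without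
  completing \<open>M\<close>.\<close>

lemma sets_null_ext:
  assumes "subalgebra M F"
  shows "sets (null_ext M F) = {A \<in> sets M. \<exists>B\<in>sets F. AE x in M. x \<in> A \<longleftrightarrow> x \<in> B}"
    (is "_ = ?E")
proof -
  have sp: "space F = space M" using assms by (simp add: subalgebra_def)
  have "sigma_algebra (space M) ?E"
    unfolding sigma_algebra_iff2
  proof (intro conjI ballI allI impI)
    show "?E \<subseteq> Pow (space M)" by (auto dest: sets.sets_into_space)
    show "{} \<in> ?E" by (auto intro!: bexI[of _ "{}"])
  next
    fix A assume "A \<in> ?E"
    then obtain B where B: "A \<in> sets M" "B \<in> sets F" "AE x in M. x \<in> A \<longleftrightarrow> x \<in> B" by auto
    have "space M - B \<in> sets F" using B sp by (metis sets.compl_sets)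
    moreover have "AE x in M. x \<in> space M - A \<longleftrightarrow> x \<in> space M - B" using B(3) by auto
    ultimately show "space M - A \<in> ?E" using B(1) by blast
  next
    fix A :: "nat \<Rightarrow> 'a set" assume A: "range A \<subseteq> ?E"
    then have "\<forall>i. \<exists>B\<in>sets F. AE x in M. x \<in> A i \<longleftrightarrow> x \<in> B" by auto
    then obtain B where B: "\<And>i. B i \<in> sets F" "\<And>i. AE x in M. x \<in> A i \<longleftrightarrow> x \<in> B i" by metis
    have "AE x in M. \<forall>i. x \<in> A i \<longleftrightarrow> x \<in> B i" using B(2) by (simp add: AE_all_countable)
    then have "AE x in M. x \<in> \<Union>(range A) \<longleftrightarrow> x \<in> \<Union>(range B)" by eventually_elim auto
    moreover have "\<Union>(range B) \<in> sets F" using B(1) by auto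
    moreover have "\<Union>(range A) \<in> sets M" using A by auto
    ultimately show "\<Union>(range A) \<in> ?E" by blast
  qed
  then show ?thesis
    unfolding null_ext_def by (rule sigma_algebra.sets_measure_of_eq)
qed

lemma subalgebra_null_ext: "subalgebra M F \<Longrightarrow> subalgebra M (null_ext M F)"
  by (auto simp: subalgebra_def[of M "null_ext M F"] sets_null_ext)

lemma sets_subset_null_ext: "subalgebra M F \<Longrightarrow> sets F \<subseteq> sets (null_ext M F)"
  by (auto simp: sets_null_ext subalgebra_def)

lemma (in prob_space) sigma_finite_subalgebraI: "subalgebra M F \<Longrightarrow> sigma_finite_subalgebra M F"
  by (intro finite_measure_subalgebra_is_sigma_finite finite_measure_subalgebra.intro
      finite_measure_subalgebra_axioms.intro) (simp_all add: finite_measure_axioms)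

lemma (in prob_space) real_cond_exp_null_ext:
  assumes F: "subalgebra M F" and f: "integrable M f"
  shows "AE x in M. real_cond_exp M (null_ext M F) f x = real_cond_exp M F f x"
proof -
  interpret F: sigma_finite_subalgebra M F using F by (rule sigma_finite_subalgebraI)
  interpret N: sigma_finite_subalgebra M "null_ext M F"
    using F by (intro sigma_finite_subalgebraI subalgebra_null_ext)
  have sub: "subalgebra (null_ext M F) F"
    using sets_subset_null_ext[OF F] F by (simp add: subalgebra_def)
  show ?thesis
  proof (rule N.real_cond_exp_charact)
    fix A assume "A \<in> sets (null_ext M F)"
    then obtain B where A: "A \<in> sets M" and B: "B \<in> sets F" "AE x in M. x \<in> A \<longleftrightarrow> x \<in> B"
      using sets_null_ext[OF F] by auto
    have BM: "B \<in> sets M" using B(1) F by (auto simp: subalgebra_def)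
    have eq: "set_lebesgue_integral M A h = set_lebesgue_integral M B h"
      if [measurable]: "h \<in> borel_measurable M" for h :: "'a \<Rightarrow> real"
      unfolding set_lebesgue_integral_def
    proof (rule integral_cong_AE)
      show "AE x in M. indicator A x *\<^sub>R h x = indicator B x *\<^sub>R h x"
        using B(2) by eventually_elim (auto simp: indicator_def)
    qed (use A BM in measurable)
    show "set_lebesgue_integral M A f = set_lebesgue_integral M A (real_cond_exp M F f)"
      using F.real_cond_exp_intA[OF f B(1)] eq[of f] eq[of "real_cond_exp M F f"] f by simp
  qed (use f F.real_cond_exp_int(1) measurable_from_subalg[OF sub borel_measurable_cond_exp] in auto)
qed

lemma null_ext_le_null_ext:
  assumes F: "subalgebra M F" and G: "subalgebra M G"
    and le: "\<And>A. A \<in> sets F \<Longrightarrow> \<exists>B\<in>sets G. AE x in M. x \<in> A \<longleftrightarrow> x \<in> B"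
  shows "sets (null_ext M F) \<subseteq> sets (null_ext M G)"
proof
  fix A assume "A \<in> sets (null_ext M F)"
  then obtain B where A: "A \<in> sets M" and B: "B \<in> sets F" "AE x in M. x \<in> A \<longleftrightarrow> x \<in> B"
    using sets_null_ext[OF F] by auto
  obtain C where C: "C \<in> sets G" "AE x in M. x \<in> B \<longleftrightarrow> x \<in> C" using le[OF B(1)] by auto
  have "AE x in M. x \<in> A \<longleftrightarrow> x \<in> C" using B(2) C(2) by eventually_elim auto
  then show "A \<in> sets (null_ext M G)" using A C(1) sets_null_ext[OF G] by auto
qed

text \<open>The sets that agree almost surely with a set of the other sigma-algebra form a
  sigma-algebra, so matching generators suffices. Both sides have the same null extension, and
  passing to it does not change conditional expectations. The generators in question will be events
  of actions that agree only almost surely.\<close>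

lemma (in prob_space) real_cond_exp_sigma_cong_AE:
  assumes E1: "E1 \<subseteq> sets M" and E2: "E2 \<subseteq> sets M"
    and 12: "\<And>A. A \<in> E1 \<Longrightarrow> \<exists>B\<in>E2. AE x in M. x \<in> A \<longleftrightarrow> x \<in> B"
    and 21: "\<And>A. A \<in> E2 \<Longrightarrow> \<exists>B\<in>E1. AE x in M. x \<in> A \<longleftrightarrow> x \<in> B"
    and f: "integrable M f"
  shows "AE x in M. real_cond_exp M (sigma (space M) E1) f x = real_cond_exp M (sigma (space M) E2) f x"
proof -
  have sub: "subalgebra M (sigma (space M) E)" and
    sets: "sets (sigma (space M) E) = sigma_sets (space M) E" if "E \<subseteq> sets M" for E
    using that sets.sets_into_space[of _ M] sets.sigma_sets_subset[OF that]
    by (auto simp: subalgebra_def sets_measure_of_conv space_measure_of_conv)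
  have le: "sets (null_ext M (sigma (space M) D)) \<subseteq> sets (null_ext M (sigma (space M) E))"
    if D: "D \<subseteq> sets M" and E: "E \<subseteq> sets M"
      and *: "\<And>A. A \<in> D \<Longrightarrow> \<exists>B\<in>E. AE x in M. x \<in> A \<longleftrightarrow> x \<in> B" for D E
  proof (rule null_ext_le_null_ext[OF sub[OF D] sub[OF E]])
    have "D \<subseteq> sets (null_ext M (sigma (space M) E))"
      using D * sets[OF E] by (fastforce simp: sets_null_ext[OF sub[OF E]])
    then have "sigma_sets (space M) D \<subseteq> sets (null_ext M (sigma (space M) E))"
      using sets.sigma_sets_subset[of D "null_ext M (sigma (space M) E)"] by simp
    then show "\<exists>B\<in>sets (sigma (space M) E). AE x in M. x \<in> A \<longleftrightarrow> x \<in> B"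
      if "A \<in> sets (sigma (space M) D)" for A
      using that sets[OF D] by (auto simp: sets_null_ext[OF sub[OF E]])
  qed
  have "sets (null_ext M (sigma (space M) E1)) = sets (null_ext M (sigma (space M) E2))"
    using le[OF E1 E2 12] le[OF E2 E1 21] by auto
  then have "null_ext M (sigma (space M) E1) = null_ext M (sigma (space M) E2)"
    unfolding sets_null_ext[OF sub[OF E1]] sets_null_ext[OF sub[OF E2]]
    by (simp only: null_ext_def)
  then show ?thesis
    using real_cond_exp_null_ext[OF sub[OF E1] f] real_cond_exp_null_ext[OF sub[OF E2] f]
    by auto
qed

text \<open>A change of variables: the sets of the pulled-back sigma-algebra are exactly the
  preimages, and integrals over them equal integrals over the original sets. It carries the beliefs
  of each network to the common sample space.\<close>

lemma (in prob_space) real_cond_exp_comp: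
  assumes [measurable]: "\<theta> \<in> M \<rightarrow>\<^sub>M N" and distr: "distr M N \<theta> = N"
    and F: "subalgebra N F" and f: "integrable N f"
  shows "AE x in M. real_cond_exp M (vimage_algebra (space M) \<theta> F) (\<lambda>x. f (\<theta> x)) x
    = real_cond_exp N F f (\<theta> x)"
proof -
  interpret N: prob_space N using prob_space_distr[of \<theta> N] distr by simp
  interpret F: sigma_finite_subalgebra N F using F by (rule N.sigma_finite_subalgebraI)
  have spF: "space F = space N" and setsF: "sets F \<subseteq> sets N" using F by (auto simp: subalgebra_def)
  have \<theta>: "\<theta> \<in> space M \<rightarrow> space F" using measurable_space[OF assms(1)] spF by auto
  have sub: "subalgebra M (vimage_algebra (space M) \<theta> F)"
    using measurable_sets[OF assms(1)] setsF \<theta> by (auto simp: subalgebra_def sets_vimage_algebra2)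
  interpret V: sigma_finite_subalgebra M "vimage_algebra (space M) \<theta> F"
    using sub by (rule sigma_finite_subalgebraI)
  have int: "integrable M (\<lambda>x. h (\<theta> x))" if "integrable N h" for h :: "_ \<Rightarrow> real"
    using that integrable_distr[OF assms(1), of h] distr by simp
  show ?thesis
  proof (rule V.real_cond_exp_charact)
    fix A assume "A \<in> sets (vimage_algebra (space M) \<theta> F)"
    then obtain B where B: "B \<in> sets F" "A = \<theta> -` B \<inter> space M"
      using \<theta> by (auto simp: sets_vimage_algebra2)
    have [measurable]: "B \<in> sets N" using B setsF by auto
    have eq: "set_lebesgue_integral M A (\<lambda>x. h (\<theta> x)) = set_lebesgue_integral N B h"
      if [measurable]: "h \<in> borel_measurable N" for h :: "_ \<Rightarrow> real"
    proof -
      have "set_lebesgue_integral N B h = (\<integral>x. indicator B x *\<^sub>R h x \<partial>distr M N \<theta>)"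
        unfolding distr set_lebesgue_integral_def ..
      also have "\<dots> = (\<integral>x. indicator B (\<theta> x) *\<^sub>R h (\<theta> x) \<partial>M)" by (rule integral_distr) auto
      also have "\<dots> = set_lebesgue_integral M A (\<lambda>x. h (\<theta> x))"
        unfolding set_lebesgue_integral_def by (rule Bochner_Integration.integral_cong) (auto simp: B(2) indicator_def)
      finally show ?thesis ..
    qed
    show "set_lebesgue_integral M A (\<lambda>x. f (\<theta> x))
      = set_lebesgue_integral M A (\<lambda>x. real_cond_exp N F f (\<theta> x))"
      using eq[of f] eq[of "real_cond_exp N F f"] F.real_cond_exp_intA[OF f B(1)] f by simp
  next
    show "(\<lambda>x. real_cond_exp N F f (\<theta> x)) \<in> borel_measurable (vimage_algebra (space M) \<theta> F)"
      by (rule measurable_compose[OF measurable_vimage_algebra1[OF \<theta>]]) simp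
  qed (use int f F.real_cond_exp_int(1) in auto)
qed

lemma (in prob_space) real_cond_exp_contraction:
  assumes F: "subalgebra M F" and f: "integrable M f" and g: "integrable M g"
  shows "(\<integral>x. \<bar>real_cond_exp M F f x - real_cond_exp M F g x\<bar> \<partial>M) \<le> (\<integral>x. \<bar>f x - g x\<bar> \<partial>M)"
proof -
  interpret F: sigma_finite_subalgebra M F using F by (rule sigma_finite_subalgebraI)
  let ?h = "\<lambda>x. \<bar>f x - g x\<bar>"
  have h: "integrable M ?h" "integrable M (\<lambda>x. f x - g x)" using f g by auto
  have "AE x in M. real_cond_exp M F (\<lambda>x. f x - g x) x \<le> real_cond_exp M F ?h x"
    by (rule F.real_cond_exp_mono) (use h in auto)
  moreover have "AE x in M. real_cond_exp M F (\<lambda>x. (-1) * ?h x) x \<le> real_cond_exp M F (\<lambda>x. f x - g x) x"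
    by (rule F.real_cond_exp_mono) (use h in auto)
  moreover have "AE x in M. real_cond_exp M F (\<lambda>x. (-1) * ?h x) x = (-1) * real_cond_exp M F ?h x"
    using h by (intro F.real_cond_exp_cmult)
  moreover have "AE x in M. real_cond_exp M F (\<lambda>x. f x - g x) x = real_cond_exp M F f x - real_cond_exp M F g x"
    using f g by (rule F.real_cond_exp_diff)
  ultimately have le: "AE x in M. \<bar>real_cond_exp M F f x - real_cond_exp M F g x\<bar> \<le> real_cond_exp M F ?h x"
    by eventually_elim auto
  have "(\<integral>x. \<bar>real_cond_exp M F f x - real_cond_exp M F g x\<bar> \<partial>M) \<le> (\<integral>x. real_cond_exp M F ?h x \<partial>M)"
    using le f g h F.real_cond_exp_int(1) by (intro integral_mono_AE) auto
  also have "\<dots> = (\<integral>x. ?h x \<partial>M)" using h F.real_cond_exp_int(2) by auto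
  finally show ?thesis .
qed

section \<open>Levy's upward theorem in mean\<close>

text \<open>Naming the class of targets \<open>g\<close> turns Levy's theorem into a monotone class
  argument: the class is linear, closed in mean, and contains the indicators of a generating
  pi-system. Convergence in mean suffices later because the values compared are expectations of
  Lipschitz functions of beliefs.\<close>

definition levy_close :: "'a measure \<Rightarrow> (nat \<Rightarrow> 'a measure) \<Rightarrow> ('a \<Rightarrow> real) \<Rightarrow> bool" where
  "levy_close M F g \<longleftrightarrow>
     integrable M g \<and> (\<lambda>t. \<integral>x. \<bar>real_cond_exp M (F t) g x - g x\<bar> \<partial>M) \<longlonglongrightarrow> 0"

text \<open>Conditional expectations contract in mean, so replacing \<open>g\<close> by
  \<open>h\<close> costs the distance twice. Three errors of \<open>r/4\<close> leave room for the
  strict inequality.\<close>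

lemma (in prob_space) levy_close_approx:
  assumes F: "\<And>t. subalgebra M (F t)" and g: "integrable M g"
    and h: "\<And>e. e > 0 \<Longrightarrow> \<exists>h. levy_close M F h \<and> (\<integral>x. \<bar>g x - h x\<bar> \<partial>M) \<le> e"
  shows "levy_close M F g"
  unfolding levy_close_def
proof (intro conjI g LIMSEQ_I)
  fix r :: real assume "r > 0"
  obtain h where h: "levy_close M F h" "(\<integral>x. \<bar>g x - h x\<bar> \<partial>M) \<le> r/4"
    using h[of "r/4"] \<open>r > 0\<close> by auto
  have ih: "integrable M h" using h(1) by (simp add: levy_close_def)
  have "(\<lambda>t. \<integral>x. \<bar>real_cond_exp M (F t) h x - h x\<bar> \<partial>M) \<longlonglongrightarrow> 0"
    using h(1) by (simp add: levy_close_def)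
  from LIMSEQ_D[OF this, of "r/4"] \<open>r > 0\<close> obtain N where
    N: "\<And>t. t \<ge> N \<Longrightarrow> norm ((\<integral>x. \<bar>real_cond_exp M (F t) h x - h x\<bar> \<partial>M) - 0) < r/4"
    by auto
  show "\<exists>no. \<forall>t\<ge>no. norm ((\<integral>x. \<bar>real_cond_exp M (F t) g x - g x\<bar> \<partial>M) - 0) < r"
  proof (intro exI allI impI)
    fix t assume t: "t \<ge> N"
    interpret F: sigma_finite_subalgebra M "F t" using F by (rule sigma_finite_subalgebraI)
    let ?c = "real_cond_exp M (F t)"
    have i: "integrable M (?c g)" "integrable M (?c h)" using g ih F.real_cond_exp_int(1) by auto
    have "(\<integral>x. \<bar>?c g x - g x\<bar> \<partial>M) \<le> (\<integral>x. \<bar>?c g x - ?c h x\<bar> + \<bar>?c h x - h x\<bar> + \<bar>g x - h x\<bar> \<partial>M)"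
      by (rule integral_mono) (use i g ih in auto)
    also have "\<dots> = (\<integral>x. \<bar>?c g x - ?c h x\<bar> \<partial>M) + (\<integral>x. \<bar>?c h x - h x\<bar> \<partial>M) + (\<integral>x. \<bar>g x - h x\<bar> \<partial>M)"
      using i g ih by simp
    also have "\<dots> \<le> r/4 + r/4 + r/4"
      using N[OF t] h(2) real_cond_exp_contraction[OF F g ih, of t] by simp
    finally show "norm ((\<integral>x. \<bar>?c g x - g x\<bar> \<partial>M) - 0) < r"
      using \<open>r > 0\<close> by simp
  qed
qed

lemma (in prob_space) levy_close_limit:
  assumes F: "\<And>t. subalgebra M (F t)" and s: "\<And>i. levy_close M F (s i)"
    and lim: "\<And>x. x \<in> space M \<Longrightarrow> (\<lambda>i. s i x) \<longlonglongrightarrow> g x"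
    and w: "integrable M w" "\<And>i x. x \<in> space M \<Longrightarrow> \<bar>s i x\<bar> \<le> w x"
  shows "levy_close M F g"
proof -
  have si: "\<And>i. integrable M (s i)" using s by (simp add: levy_close_def)
  then have sm: "\<And>i. s i \<in> borel_measurable M" by auto
  have gm: "g \<in> borel_measurable M"
    using borel_measurable_LIMSEQ_real[OF lim sm] by simp
  have gi: "integrable M g"
    by (rule integrable_dominated_convergence[where s = s and w = w]) (use w lim sm gm in auto)
  have "(\<lambda>i. \<integral>x. \<bar>g x - s i x\<bar> \<partial>M) \<longlonglongrightarrow> (\<integral>x. 0 \<partial>M)"
  proof (rule integral_dominated_convergence[where w = "\<lambda>x. \<bar>g x\<bar> + w x"])
    show "AE x in M. (\<lambda>i. \<bar>g x - s i x\<bar>) \<longlonglongrightarrow> 0"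
    proof (rule AE_I2)
      fix x assume "x \<in> space M"
      from tendsto_rabs[OF tendsto_diff[OF tendsto_const lim[OF this], of "g x"]]
      show "(\<lambda>i. \<bar>g x - s i x\<bar>) \<longlonglongrightarrow> 0" by simp
    qed
    show "AE x in M. norm \<bar>g x - s i x\<bar> \<le> \<bar>g x\<bar> + w x" for i
      using w(2)[of _ i] by (intro AE_I2) (fastforce simp: abs_le_iff)
  qed (use w gi gm sm in auto)
  then have lim0: "(\<lambda>i. \<integral>x. \<bar>g x - s i x\<bar> \<partial>M) \<longlonglongrightarrow> 0" by simp
  show ?thesis
  proof (rule levy_close_approx[OF F gi])
    fix e :: real assume "e > 0"
    with lim0 have "eventually (\<lambda>i. (\<integral>x. \<bar>g x - s i x\<bar> \<partial>M) < e) sequentially"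
      by (rule order_tendstoD)
    then obtain i where "(\<integral>x. \<bar>g x - s i x\<bar> \<partial>M) < e" by (auto simp: eventually_sequentially)
    then show "\<exists>h. levy_close M F h \<and> (\<integral>x. \<bar>g x - h x\<bar> \<partial>M) \<le> e"
      using s by (intro exI[of _ "s i"]) auto
  qed
qed

lemma (in prob_space) levy_close_add:
  assumes F: "\<And>t. subalgebra M (F t)" and g: "levy_close M F g" and h: "levy_close M F h"
  shows "levy_close M F (\<lambda>x. g x + h x)"
  unfolding levy_close_def
proof
  have i: "integrable M g" "integrable M h" using g h by (auto simp: levy_close_def)
  then show "integrable M (\<lambda>x. g x + h x)" by auto
  show "(\<lambda>t. \<integral>x. \<bar>real_cond_exp M (F t) (\<lambda>x. g x + h x) x - (g x + h x)\<bar> \<partial>M) \<longlonglongrightarrow> 0"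
  proof (rule tendsto_sandwich[where f = "\<lambda>_. 0" and h = "\<lambda>t. (\<integral>x. \<bar>real_cond_exp M (F t) g x - g x\<bar> \<partial>M) + (\<integral>x. \<bar>real_cond_exp M (F t) h x - h x\<bar> \<partial>M)"])
    have "(\<lambda>t. (\<integral>x. \<bar>real_cond_exp M (F t) g x - g x\<bar> \<partial>M) + (\<integral>x. \<bar>real_cond_exp M (F t) h x - h x\<bar> \<partial>M)) \<longlonglongrightarrow> 0 + 0"
      using g h unfolding levy_close_def by (intro tendsto_add) auto
    then show "(\<lambda>t. (\<integral>x. \<bar>real_cond_exp M (F t) g x - g x\<bar> \<partial>M) + (\<integral>x. \<bar>real_cond_exp M (F t) h x - h x\<bar> \<partial>M)) \<longlonglongrightarrow> 0"
      by simp
    show "\<forall>\<^sub>F t in sequentially. (\<integral>x. \<bar>real_cond_exp M (F t) (\<lambda>x. g x + h x) x - (g x + h x)\<bar> \<partial>M)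
      \<le> (\<integral>x. \<bar>real_cond_exp M (F t) g x - g x\<bar> \<partial>M) + (\<integral>x. \<bar>real_cond_exp M (F t) h x - h x\<bar> \<partial>M)"
    proof (intro always_eventually allI)
      fix t
      interpret F: sigma_finite_subalgebra M "F t" using F by (rule sigma_finite_subalgebraI)
      let ?c = "real_cond_exp M (F t)"
      have i': "integrable M (?c g)" "integrable M (?c h)" "integrable M (?c (\<lambda>x. g x + h x))"
        using i F.real_cond_exp_int(1) by auto
      have "(\<integral>x. \<bar>?c (\<lambda>x. g x + h x) x - (g x + h x)\<bar> \<partial>M) \<le> (\<integral>x. \<bar>?c g x - g x\<bar> + \<bar>?c h x - h x\<bar> \<partial>M)"
      proof (rule integral_mono_AE)
        show "AE x in M. \<bar>?c (\<lambda>x. g x + h x) x - (g x + h x)\<bar> \<le> \<bar>?c g x - g x\<bar> + \<bar>?c h x - h x\<bar>"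
          using F.real_cond_exp_add[OF i] by eventually_elim auto
      qed (use i i' in auto)
      then show "(\<integral>x. \<bar>?c (\<lambda>x. g x + h x) x - (g x + h x)\<bar> \<partial>M)
        \<le> (\<integral>x. \<bar>?c g x - g x\<bar> \<partial>M) + (\<integral>x. \<bar>?c h x - h x\<bar> \<partial>M)"
        using i i' by simp
    qed
  qed auto
qed

lemma (in prob_space) levy_close_cmult:
  assumes F: "\<And>t. subalgebra M (F t)" and g: "levy_close M F g"
  shows "levy_close M F (\<lambda>x. c * g x)"
  unfolding levy_close_def
proof
  have i: "integrable M g" using g by (auto simp: levy_close_def)
  then show "integrable M (\<lambda>x. c * g x)" by auto
  have "(\<integral>x. \<bar>real_cond_exp M (F t) (\<lambda>x. c * g x) x - c * g x\<bar> \<partial>M)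
      = \<bar>c\<bar> * (\<integral>x. \<bar>real_cond_exp M (F t) g x - g x\<bar> \<partial>M)" for t
  proof -
    interpret F: sigma_finite_subalgebra M "F t" using F by (rule sigma_finite_subalgebraI)
    have "(\<integral>x. \<bar>real_cond_exp M (F t) (\<lambda>x. c * g x) x - c * g x\<bar> \<partial>M)
      = (\<integral>x. \<bar>c\<bar> * \<bar>real_cond_exp M (F t) g x - g x\<bar> \<partial>M)"
    proof (rule integral_cong_AE)
      show "AE x in M. \<bar>real_cond_exp M (F t) (\<lambda>x. c * g x) x - c * g x\<bar>
        = \<bar>c\<bar> * \<bar>real_cond_exp M (F t) g x - g x\<bar>"
        using F.real_cond_exp_cmult[OF i, of c]
        by eventually_elim (simp add: abs_mult[symmetric] right_diff_distrib)
    qed (use i in auto)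
    then show ?thesis by simp
  qed
  moreover have "(\<lambda>t. \<bar>c\<bar> * (\<integral>x. \<bar>real_cond_exp M (F t) g x - g x\<bar> \<partial>M)) \<longlonglongrightarrow> \<bar>c\<bar> * 0"
    using g unfolding levy_close_def by (intro tendsto_mult) auto
  ultimately show "(\<lambda>t. \<integral>x. \<bar>real_cond_exp M (F t) (\<lambda>x. c * g x) x - c * g x\<bar> \<partial>M) \<longlonglongrightarrow> 0"
    by simp
qed

lemma (in prob_space) levy_close_measurable:
  assumes F: "\<And>t. subalgebra M (F t)" and mono: "\<And>s t. s \<le> t \<Longrightarrow> sets (F s) \<subseteq> sets (F t)"
    and g: "g \<in> borel_measurable (F s)" "integrable M g"
  shows "levy_close M F g"
  unfolding levy_close_def
proof (intro conjI g(2) tendsto_eventually)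
  show "\<forall>\<^sub>F t in sequentially. (\<integral>x. \<bar>real_cond_exp M (F t) g x - g x\<bar> \<partial>M) = 0"
    using eventually_ge_at_top[of s]
  proof eventually_elim
    fix t assume t: "s \<le> t"
    interpret F: sigma_finite_subalgebra M "F t" using F by (rule sigma_finite_subalgebraI)
    have "subalgebra (F t) (F s)" using F[of s] F[of t] mono[OF t] by (simp add: subalgebra_def)
    then have "g \<in> borel_measurable (F t)" using g(1) by (rule measurable_from_subalg)
    then have "AE x in M. real_cond_exp M (F t) g x = g x" by (intro F.real_cond_exp_F_meas g(2))
    then have "AE x in M. \<bar>real_cond_exp M (F t) g x - g x\<bar> = 0" by eventually_elim simp
    then show "(\<integral>x. \<bar>real_cond_exp M (F t) g x - g x\<bar> \<partial>M) = 0"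
      by (rule integral_eq_zero_AE)
  qed
qed

text \<open>A pi-lambda argument. Monotonicity in \<open>t\<close> makes the union of the
  sigma-algebras closed under intersections; complements follow by linearity, disjoint unions from
  partial sums dominated by 1.\<close>

lemma (in prob_space) levy_close_indicator:
  assumes F: "\<And>t. subalgebra M (F t)" and mono: "\<And>s t. s \<le> t \<Longrightarrow> sets (F s) \<subseteq> sets (F t)"
    and A: "A \<in> sigma_sets (space M) (\<Union>t. sets (F t))"
  shows "levy_close M F (indicator A)"
proof -
  let ?G = "\<Union>t. sets (F t)"
  have GM: "?G \<subseteq> sets M" using F by (auto simp: subalgebra_def)
  have sM: "sigma_sets (space M) ?G \<subseteq> sets M" using sets.sigma_sets_subset[OF GM] .
  have "Int_stable ?G"
  proof (rule Int_stableI)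
    fix A B assume "A \<in> ?G" "B \<in> ?G"
    then obtain s t where "A \<in> sets (F s)" "B \<in> sets (F t)" by auto
    then have "A \<in> sets (F (max s t))" "B \<in> sets (F (max s t))"
      using mono[of s "max s t"] mono[of t "max s t"] by auto
    then show "A \<inter> B \<in> ?G" by blast
  qed
  moreover have "?G \<subseteq> Pow (space M)" using GM sets.sets_into_space by blast
  moreover note A
  ultimately show ?thesis
  proof (induction rule: sigma_sets_induct_disjoint)
    case (basic A)
    then obtain t where t: "A \<in> sets (F t)" by auto
    then have "A \<in> sets M" using GM by auto
    then show ?case using t
      by (intro levy_close_measurable[OF F mono, where s = t])
        (auto simp: integrable_indicator_iff less_top[symmetric])
  next
    case empty
    show ?case by (simp add: levy_close_measurable[OF F mono, where s = 0] indicator_def)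
  next
    case (compl A)
    have [measurable]: "A \<in> sets M" using compl sM by auto
    have sp: "space M \<in> sets (F 0)" using F[of 0] sets.top[of "F 0"] by (simp add: subalgebra_def)
    have "levy_close M F (\<lambda>x. indicator (space M) x + (-1) * indicator A x)"
      by (intro levy_close_add[OF F] levy_close_cmult[OF F] compl levy_close_measurable[OF F mono, where s = 0])
        (use sp in \<open>auto intro!: borel_measurable_indicator simp: integrable_indicator_iff less_top[symmetric]\<close>)
    \<comment> \<open>A constant sequence: convergence is asked for only on \<open>space M\<close>,
      which replaces the combination by the indicator that equals it there.\<close>
    then show ?case
    proof (rule levy_close_limit[OF F, where s = "\<lambda>_ x. indicator (space M) x + (-1) * indicator A x" and w = "\<lambda>_. 1"])
    qed (auto simp: indicator_def)
  next
    case (union A)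
    have sums: "(\<lambda>i. indicator (A i) x :: real) sums indicator (\<Union>(range A)) x" for x
      using union(1) by (intro indicator_sums) (auto simp: disjoint_family_on_def)
    have cl: "levy_close M F (\<lambda>x. \<Sum>i<n. indicator (A i) x)" for n
    proof (induction n)
      case 0
      show ?case by (simp add: levy_close_measurable[OF F mono, where s = 0])
    next
      case (Suc n)
      then show ?case using levy_close_add[OF F Suc union(3)[of n]] by simp
    qed
    show ?case
    proof (rule levy_close_limit[OF F cl, where w = "\<lambda>_. 1"])
      show "(\<lambda>n. \<Sum>i<n. indicator (A i) x :: real) \<longlonglongrightarrow> indicator (\<Union>(range A)) x" for x
        using sums[of x] by (simp add: sums_def)
      show "\<bar>\<Sum>i<n. indicator (A i) x :: real\<bar> \<le> 1" for n x
      proof -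
        have "(\<Sum>i<n. indicator (A i) x :: real) \<le> (\<Sum>i. indicator (A i) x)"
          using sums[of x] by (intro sum_le_suminf) (auto simp: sums_iff)
        also have "\<dots> \<le> 1" unfolding sums_unique[OF sums[of x], symmetric] by (simp add: indicator_def)
        finally show ?thesis by (simp add: sum_nonneg)
      qed
    qed auto
  qed
qed

lemma (in prob_space) levy_upward_mean:
  assumes F: "\<And>t. subalgebra M (F t)" and mono: "\<And>s t. s \<le> t \<Longrightarrow> sets (F s) \<subseteq> sets (F t)"
    and sp: "space G = space M" and sG: "sets G = sigma_sets (space M) (\<Union>t. sets (F t))"
    and f: "integrable M f"
  shows "(\<lambda>t. \<integral>x. \<bar>real_cond_exp M (F t) f x - real_cond_exp M G f x\<bar> \<partial>M) \<longlonglongrightarrow> 0"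
proof -
  have "(\<Union>t. sets (F t)) \<subseteq> sets M" using F by (auto simp: subalgebra_def)
  then have G: "subalgebra M G" using sp sG sets.sigma_sets_subset by (simp add: subalgebra_def)
  interpret G: sigma_finite_subalgebra M G using G by (rule sigma_finite_subalgebraI)
  have le: "sets (F t) \<subseteq> sets G" for t unfolding sG by (auto intro: sigma_sets.Basic)
  have subG: "subalgebra G (F t)" for t using le F sp by (simp add: subalgebra_def)
  have gen: "levy_close M F g" if "integrable (restr_to_subalg M G) g" for g
    using that
  proof (induction rule: integrable_induct)
    case (base A c)
    then have "A \<in> sigma_sets (space M) (\<Union>t. sets (F t))" using sets_restr_to_subalg[OF G] sG by simp
    from levy_close_cmult[OF F levy_close_indicator[OF F mono this], of c] show ?case
      by (simp add: mult.commute)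
  next
    case (add f g)
    then show ?case using levy_close_add[OF F] by auto
  next
    case (lim f s)
    have "integrable M f" using integrable_from_subalg[OF G lim(4)] .
    then show ?case
      by (intro levy_close_limit[OF F lim(5), where w = "\<lambda>x. 2 * \<bar>f x\<bar>"])
        (use lim(2,3) space_restr_to_subalg[of M G] in auto)
  qed
  \<comment> \<open>For arbitrary \<open>f\<close> the class is applied to the conditional
    expectation given \<open>G\<close>; by the tower property, it and \<open>f\<close> have the same
    conditional expectation given \<open>F t\<close>.\<close>
  let ?g = "real_cond_exp M G f"
  have "integrable M ?g" using f G.real_cond_exp_int(1) by auto
  then have "integrable (restr_to_subalg M G) ?g"
    using G by (intro integrable_in_subalg) auto
  then have "levy_close M F ?g" by (rule gen)
  then have "(\<lambda>t. \<integral>x. \<bar>real_cond_exp M (F t) ?g x - ?g x\<bar> \<partial>M) \<longlonglongrightarrow> 0" by (simp add: levy_close_def)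
  moreover have "(\<integral>x. \<bar>real_cond_exp M (F t) ?g x - ?g x\<bar> \<partial>M)
      = (\<integral>x. \<bar>real_cond_exp M (F t) f x - ?g x\<bar> \<partial>M)" for t
  proof (rule integral_cong_AE)
    interpret F: sigma_finite_subalgebra M "F t" using F by (rule sigma_finite_subalgebraI)
    show "AE x in M. \<bar>real_cond_exp M (F t) ?g x - ?g x\<bar> = \<bar>real_cond_exp M (F t) f x - ?g x\<bar>"
      using F.real_cond_exp_nested_subalg[OF G subG f] by eventually_elim simp
  qed auto
  ultimately show ?thesis by simp
qed

section \<open>Bessel's inequality\<close>

text \<open>The centred variables \<open>e n\<close> are pairwise orthogonal and the covariances
  \<open>c n\<close> are the inner products of \<open>a\<close> with them. Bessel's inequality makes
  the squares of the \<open>c n\<close> summable, so a fixed bounded \<open>a\<close> cannot stay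
  correlated with infinitely many of them.\<close>

lemma (in prob_space) covariance_uncorrelated_tendsto_0:
  fixes h :: "nat \<Rightarrow> 'a \<Rightarrow> real"
  assumes a [measurable]: "a \<in> borel_measurable M" "\<And>x. x \<in> space M \<Longrightarrow> \<bar>a x\<bar> \<le> 1"
    and h [measurable]: "\<And>n. h n \<in> borel_measurable M" "\<And>n x. x \<in> space M \<Longrightarrow> \<bar>h n x\<bar> \<le> 1"
    and unc: "\<And>i j. i \<noteq> j \<Longrightarrow> expectation (\<lambda>x. h i x * h j x) = expectation (h i) * expectation (h j)"
  shows "(\<lambda>n. expectation (\<lambda>x. a x * h n x) - expectation a * expectation (h n)) \<longlonglongrightarrow> 0"
proof -
  define e where "e n x = h n x - expectation (h n)" for n x
  define c where "c n = expectation (\<lambda>x. a x * e n x)" for n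
  define R where "R N x = a x - (\<Sum>n<N. c n * e n x)" for N x
  have [measurable]: "e n \<in> borel_measurable M" "R n \<in> borel_measurable M" for n
    unfolding e_def R_def by measurable
  have intb: "integrable M f" if "f \<in> borel_measurable M" "\<And>x. x \<in> space M \<Longrightarrow> \<bar>f x\<bar> \<le> B" for f :: "'a \<Rightarrow> real" and B
    using that by (intro integrable_const_bound[OF AE_I2]) auto
  have ih: "integrable M (h n)" for n using h by (intro intb[of _ 1]) auto
  have ia: "integrable M a" using a by (intro intb[of _ 1]) auto
  have Eh: "\<bar>expectation (h n)\<bar> \<le> 1" for n
    using ih[of n] h(2)[of _ n] by (intro order.trans[OF integral_abs_bound] integral_le_const AE_I2) auto
  have eb: "\<bar>e n x\<bar> \<le> 2" if "x \<in> space M" for n x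
    unfolding e_def using Eh[of n] h(2)[OF that, of n] by linarith
  have ie: "integrable M (e n)" for n by (rule intb[OF _ eb]) auto
  have aeb: "\<bar>a x * e n x\<bar> \<le> 2" if "x \<in> space M" for n x
    using mult_mono[OF a(2)[OF that] eb[OF that, of n]] by (simp add: abs_mult)
  have iae: "integrable M (\<lambda>x. a x * e n x)" for n by (rule intb[OF _ aeb]) auto
  have eeb: "\<bar>e i x * e j x\<bar> \<le> 4" if "x \<in> space M" for i j x
    using mult_mono[OF eb[OF that, of i] eb[OF that, of j]] by (simp add: abs_mult)
  have iee: "integrable M (\<lambda>x. e i x * e j x)" for i j by (rule intb[OF _ eeb]) auto
  have ihh: "integrable M (\<lambda>x. h i x * h j x)" for i j
    using mult_mono[OF h(2)[of _ i] h(2)[of _ j]] by (intro intb[of _ 1]) (auto simp: abs_mult)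
  have Ee: "expectation (e n) = 0" for n
    unfolding e_def using ih by (simp add: prob_space)
  have Eee: "expectation (\<lambda>x. e i x * e j x) = expectation (\<lambda>x. h i x * h j x) - expectation (h i) * expectation (h j)" for i j
  proof -
    have "e i x * e j x = h i x * h j x - expectation (h j) * h i x - expectation (h i) * h j x
        + expectation (h i) * expectation (h j)" for x
      unfolding e_def by (simp add: algebra_simps)
    then have "expectation (\<lambda>x. e i x * e j x) = expectation (\<lambda>x. h i x * h j x - expectation (h j) * h i x
        - expectation (h i) * h j x + expectation (h i) * expectation (h j))" by simp
    also have "\<dots> = expectation (\<lambda>x. h i x * h j x) - expectation (h i) * expectation (h j)"
      using ih ihh by (simp add: prob_space)
    finally show ?thesis .
  qed
  have orth: "expectation (\<lambda>x. e i x * e j x) = 0" if "i \<noteq> j" for i j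
    using unc[OF that] Eee by simp
  have e2: "expectation (\<lambda>x. e n x * e n x) \<le> 1" for n
  proof -
    have "h n x * h n x \<le> 1" if "x \<in> space M" for x
      using h(2)[OF that, of n] by (metis abs_square_le_1 power2_eq_square)
    then have "expectation (\<lambda>x. h n x * h n x) \<le> 1"
      using ihh by (intro integral_le_const AE_I2) auto
    moreover have "expectation (h n) * expectation (h n) \<ge> 0" by simp
    ultimately show ?thesis using Eee[of n n] by linarith
  qed
  have Rb: "\<exists>B. \<forall>x\<in>space M. \<bar>R N x\<bar> \<le> B" for N
  proof (rule exI[of _ "1 + (\<Sum>n<N. \<bar>c n\<bar> * 2)"], rule ballI)
    fix x assume x: "x \<in> space M"
    have "\<bar>\<Sum>n<N. c n * e n x\<bar> \<le> (\<Sum>n<N. \<bar>c n\<bar> * 2)"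
      by (rule order.trans[OF sum_abs], rule sum_mono) (use eb[OF x] in \<open>simp add: abs_mult mult_left_mono\<close>)
    then show "\<bar>R N x\<bar> \<le> 1 + (\<Sum>n<N. \<bar>c n\<bar> * 2)"
      using a(2)[OF x] unfolding R_def by linarith
  qed
  have iRR: "integrable M (\<lambda>x. R N x * R N x)" for N
  proof -
    obtain B where "\<And>x. x \<in> space M \<Longrightarrow> \<bar>R N x\<bar> \<le> B" using Rb by blast
    then have "\<bar>R N x * R N x\<bar> \<le> B * B" if "x \<in> space M" for x
      using that unfolding abs_mult by (meson abs_ge_zero mult_mono order_trans)
    then show ?thesis by (intro intb[of _ "B * B"]) auto
  qed
  have iRe: "integrable M (\<lambda>x. R N x * e n x)" for N n
  proof -
    obtain B where "\<And>x. x \<in> space M \<Longrightarrow> \<bar>R N x\<bar> \<le> B" using Rb by blast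
    then have "\<bar>R N x * e n x\<bar> \<le> B * 2" if "x \<in> space M" for x
      using that eb unfolding abs_mult by (meson abs_ge_zero mult_mono order_trans)
    then show ?thesis by (intro intb[of _ "B * 2"]) auto
  qed
  have ERe: "expectation (\<lambda>x. R N x * e N x) = c N" for N
  proof -
    have "(\<lambda>x. R N x * e N x) = (\<lambda>x. a x * e N x - (\<Sum>n<N. c n * (e n x * e N x)))"
      unfolding R_def by (simp add: left_diff_distrib sum_distrib_right mult.assoc)
    then have "expectation (\<lambda>x. R N x * e N x) = expectation (\<lambda>x. a x * e N x - (\<Sum>n<N. c n * (e n x * e N x)))"
      by simp
    also have "\<dots> = c N - (\<Sum>n<N. c n * expectation (\<lambda>x. e n x * e N x))"
      using iae iee by (simp add: c_def)
    also have "(\<Sum>n<N. c n * expectation (\<lambda>x. e n x * e N x)) = 0"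
      using orth by (intro sum.neutral) auto
    finally show ?thesis by simp
  qed
  \<comment> \<open>The \<open>e n\<close> have norm at most 1 but are not normalised: subtracting
    \<open>c N * e N\<close> changes the squared norm by at most -2 c^2 + c^2 = -c^2.\<close>
  have bes: "expectation (\<lambda>x. R N x * R N x) \<le> 1 - (\<Sum>n<N. (c n)\<^sup>2)" for N
  proof (induction N)
    case 0
    have "a x * a x \<le> 1" if "x \<in> space M" for x
      using a(2)[OF that] by (metis abs_square_le_1 power2_eq_square)
    then have "expectation (\<lambda>x. a x * a x) \<le> 1"
      using iRR[of 0] by (intro integral_le_const AE_I2) (auto simp: R_def)
    then show ?case by (simp add: R_def)
  next
    case (Suc N)
    have "R (Suc N) x * R (Suc N) x = R N x * R N x - 2 * c N * (R N x * e N x) + (c N)\<^sup>2 * (e N x * e N x)" for x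
      unfolding R_def by (simp add: algebra_simps power2_eq_square)
    then have "expectation (\<lambda>x. R (Suc N) x * R (Suc N) x)
       = expectation (\<lambda>x. R N x * R N x - 2 * c N * (R N x * e N x) + (c N)\<^sup>2 * (e N x * e N x))" by simp
    also have "\<dots> = expectation (\<lambda>x. R N x * R N x) - 2 * c N * c N + (c N)\<^sup>2 * expectation (\<lambda>x. e N x * e N x)"
      using iRR[of N] iRe[of N N] iee[of N N] ERe[of N] by simp
    also have "\<dots> \<le> (1 - (\<Sum>n<N. (c n)\<^sup>2)) - 2 * c N * c N + (c N)\<^sup>2 * 1"
      using Suc mult_left_mono[OF e2[of N], of "(c N)\<^sup>2"] by (intro add_mono diff_mono) auto
    also have "\<dots> = 1 - (\<Sum>n<Suc N. (c n)\<^sup>2)" by (simp add: power2_eq_square)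
    finally show ?case .
  qed
  have "summable (\<lambda>n. (c n)\<^sup>2)"
  proof (rule summableI_nonneg_bounded[where x = 1])
    fix N
    have "0 \<le> expectation (\<lambda>x. R N x * R N x)" by (rule integral_nonneg_AE) auto
    then show "(\<Sum>n<N. (c n)\<^sup>2) \<le> 1" using bes[of N] by linarith
  qed auto
  then have "(\<lambda>n. (c n)\<^sup>2) \<longlonglongrightarrow> 0" by (rule summable_LIMSEQ_zero)
  from tendsto_real_sqrt[OF this] have "c \<longlonglongrightarrow> 0"
    by (simp add: tendsto_rabs_zero_iff)
  moreover have "c = (\<lambda>n. expectation (\<lambda>x. a x * h n x) - expectation a * expectation (h n))"
  proof
    fix n
    have "a x * e n x = a x * h n x - expectation (h n) * a x" for x
      unfolding e_def by (simp add: algebra_simps)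
    moreover have "integrable M (\<lambda>x. a x * h n x)"
      using mult_mono[OF a(2) h(2)[of _ n]] by (intro intb[of _ 1]) (auto simp: abs_mult)
    ultimately show "c n = expectation (\<lambda>x. a x * h n x) - expectation a * expectation (h n)"
      unfolding c_def using ia by simp
  qed
  ultimately show ?thesis by simp
qed

section \<open>Networks, balls and ball isomorphisms\<close>

lemma undirected_network_arcs:
  assumes "undirected_network G" "(u, v) \<in> parcs G"
  shows "u \<in> pverts G" "v \<in> pverts G" "u \<noteq> v" "(v, u) \<in> parcs G"
proof -
  interpret pair_loopfree_digraph G
    using assms(1) by (simp add: undirected_network_def social_network_def)
  show "u \<in> pverts G" "v \<in> pverts G" "u \<noteq> v"
    using assms(2) in_arcsD1 in_arcsD2 pair_no_loops[of "(u, v)"] by auto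
  show "(v, u) \<in> parcs G"
    using assms by (auto simp: undirected_network_def symmetric_def sym_def)
qed

lemma undirected_network_connected:
  assumes "undirected_network G" "u \<in> pverts G" "v \<in> pverts G"
  shows "(u, v) \<in> (parcs G)\<^sup>*"
proof -
  have "u \<rightarrow>\<^sup>*\<^bsub>with_proj G\<^esub> v"
    using assms by (simp add: undirected_network_def social_network_def strongly_connected_def)
  then show ?thesis by (auto dest: reachable_rtranclI)
qed

lemma undirected_network_countable: "undirected_network G \<Longrightarrow> countable (pverts G)"
  by (simp add: undirected_network_def social_network_def)

lemma undirected_network_nonempty: "undirected_network G \<Longrightarrow> pverts G \<noteq> {}"
  by (simp add: undirected_network_def social_network_def strongly_connected_def)

text \<open>Symmetry of the arcs reduces strong connectedness to reachability from one root, which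
  is what a network built from walks out of its root provides.\<close>

lemma undirected_networkI:
  assumes "countable (pverts G)" "r \<in> pverts G"
    and arcs: "\<And>u v. (u, v) \<in> parcs G \<Longrightarrow> u \<in> pverts G \<and> v \<in> pverts G \<and> u \<noteq> v \<and> (v, u) \<in> parcs G"
    and conn: "\<And>v. v \<in> pverts G \<Longrightarrow> (r, v) \<in> (parcs G)\<^sup>*"
  shows "undirected_network G"
proof -
  have lf: "pair_loopfree_digraph G"
    by unfold_locales (use arcs in \<open>auto simp: prod_eq_iff\<close>)
  then interpret pair_loopfree_digraph G .
  have sym: "symmetric (with_proj G)" using arcs by (auto simp: symmetric_def sym_def)
  have reach: "r \<rightarrow>\<^sup>*\<^bsub>with_proj G\<^esub> v" if "v \<in> pverts G" for v
    using conn[OF that]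
  proof (induction rule: rtrancl_induct)
    case base
    then show ?case using assms(2) by (auto intro: reachable_refl)
  next
    case (step y z)
    then show ?case by (intro reachable_adj_trans[OF step(3)]) auto
  qed
  then have "strongly_connected (with_proj G)"
    unfolding strongly_connected_def
    using assms(2) symmetric_reachable[OF sym reach] by (auto intro: reachable_trans)
  then show ?thesis
    using assms(1) lf sym by (simp add: undirected_network_def social_network_def)
qed

section \<open>Balls and distant vertices\<close>

lemma ball_verts_0 [simp]: "ball_verts G 0 u = {u}"
  by (auto simp: ball_verts_def)

lemma ball_verts_refl [simp]: "u \<in> ball_verts G t u"
  by (auto simp: ball_verts_def intro!: exI[of _ 0])

lemma ball_verts_mono: "s \<le> t \<Longrightarrow> ball_verts G s u \<subseteq> ball_verts G t u"
  unfolding ball_verts_def using le_trans by blast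

lemma ball_verts_trans:
  assumes "v \<in> ball_verts G s u" "w \<in> ball_verts G t v"
  shows "w \<in> ball_verts G (s + t) u"
proof -
  obtain i j where "i \<le> s" "(u, v) \<in> parcs G ^^ i" "j \<le> t" "(v, w) \<in> parcs G ^^ j"
    using assms by (auto simp: ball_verts_def)
  then have "(u, w) \<in> parcs G ^^ (i + j)" "i + j \<le> s + t"
    by (auto simp: relpow_add)
  then show ?thesis by (auto simp: ball_verts_def)
qed

lemma ball_verts_Suc: "ball_verts G (Suc t) u = ball_verts G t u \<union> (\<Union>v\<in>ball_verts G t u. nbrs G v)"
proof (intro equalityI subsetI)
  fix w assume "w \<in> ball_verts G (Suc t) u"
  then obtain k where k: "k \<le> Suc t" "(u, w) \<in> parcs G ^^ k" by (auto simp: ball_verts_def)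
  show "w \<in> ball_verts G t u \<union> (\<Union>v\<in>ball_verts G t u. nbrs G v)"
  proof (cases "k \<le> t")
    case True
    then show ?thesis using k by (auto simp: ball_verts_def)
  next
    case False
    then have "k = Suc t" using k by simp
    then obtain v where "(u, v) \<in> parcs G ^^ t" "(v, w) \<in> parcs G" using k by auto
    then show ?thesis by (auto simp: ball_verts_def nbrs_def)
  qed
next
  fix w assume "w \<in> ball_verts G t u \<union> (\<Union>v\<in>ball_verts G t u. nbrs G v)"
  then show "w \<in> ball_verts G (Suc t) u"
  proof
    assume "w \<in> (\<Union>v\<in>ball_verts G t u. nbrs G v)"
    then obtain v k where "k \<le> t" "(u, v) \<in> parcs G ^^ k" "(v, w) \<in> parcs G"
      by (auto simp: ball_verts_def nbrs_def)
    then have "Suc k \<le> Suc t" "(u, w) \<in> parcs G ^^ Suc k" by auto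
    then show ?thesis unfolding ball_verts_def by blast
  qed (use ball_verts_mono[of t "Suc t" G u] in auto)
qed

lemma nbrs_subset_ball_verts: "v \<in> nbrs G u \<Longrightarrow> v \<in> ball_verts G 1 u"
  using ball_verts_Suc[of G 0 u] by simp

lemma ball_verts_subset_pverts:
  assumes "undirected_network G" "u \<in> pverts G"
  shows "ball_verts G t u \<subseteq> pverts G"
proof (induction t)
  case (Suc t)
  then show ?case
    using undirected_network_arcs(2)[OF assms(1)] by (auto simp: ball_verts_Suc nbrs_def)
qed (use assms in auto)

lemma ball_verts_sym:
  assumes "undirected_network G" "v \<in> ball_verts G t u"
  shows "u \<in> ball_verts G t v"
proof -
  obtain k where k: "k \<le> t" "(u, v) \<in> parcs G ^^ k" using assms(2) by (auto simp: ball_verts_def)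
  have conv: "(parcs G)\<inverse> = parcs G" using undirected_network_arcs(4)[OF assms(1)] by auto
  have "(w, u) \<in> parcs G ^^ j" if "(u, w) \<in> parcs G ^^ j" for w j
    using that
  proof (induction j arbitrary: w)
    case (Suc j)
    then obtain z where "(u, z) \<in> parcs G ^^ j" "(w, z) \<in> parcs G" using conv by auto
    then show ?case using Suc.IH by (blast intro: relpow_Suc_I2)
  qed simp
  then have "(v, u) \<in> parcs G ^^ k" using k(2) by blast
  then show ?thesis using k by (auto simp: ball_verts_def)
qed

lemma ball_verts_exhaust:
  assumes "undirected_network G" "u \<in> pverts G" "v \<in> pverts G"
  obtains t where "v \<in> ball_verts G t u"
  using undirected_network_connected[OF assms] by (auto simp: ball_verts_def rtrancl_power)

text \<open>The bound \<open>d\<close> is fixed because compactness holds for each uniform degree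
  bound. Infinitude passes to the limits as well, so each of them again has arbitrarily distant
  agents.\<close>

definition bounded_network :: "nat \<Rightarrow> 'v pair_pre_digraph \<Rightarrow> bool" where
  "bounded_network d G \<longleftrightarrow> undirected_network G \<and> infinite (pverts G) \<and>
     (\<forall>u\<in>pverts G. finite (nbrs G u) \<and> card (nbrs G u) \<le> d)"

lemma bounded_network_undirected: "bounded_network d G \<Longrightarrow> undirected_network G"
  by (simp add: bounded_network_def)

lemma finite_ball_verts:
  assumes "bounded_network d G" "u \<in> pverts G"
  shows "finite (ball_verts G t u)"
proof (induction t)
  case (Suc t)
  then show ?case
    using assms ball_verts_subset_pverts[of G u t]
    by (auto simp: ball_verts_Suc bounded_network_def)
qed auto

text \<open>The radius grows with the index, so for every fixed radius the balls around a tail of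
  the sequence are pairwise disjoint.\<close>

lemma bounded_network_far_apart:
  assumes G: "bounded_network d G"
  obtains v :: "nat \<Rightarrow> 'v" where "\<And>n. v n \<in> pverts G"
    "\<And>m n. m < n \<Longrightarrow> ball_verts G n (v m) \<inter> ball_verts G n (v n) = {}"
proof -
  have un: "undirected_network G" using G by (rule bounded_network_undirected)
  let ?P = "\<lambda>f n r. r \<in> pverts G \<and> (\<forall>m<n. ball_verts G n (f m) \<inter> ball_verts G n r = {})"
  have "\<exists>f::nat \<Rightarrow> 'v. \<forall>n. ?P f n (f n)"
  proof (rule dependent_wellorder_choice)
    fix n and f :: "nat \<Rightarrow> 'v" assume f: "\<And>m. m < n \<Longrightarrow> ?P f m (f m)"
    \<comment> \<open>Twice the radius: since arcs are symmetric, a common vertex of the two balls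
      of radius \<open>n\<close> would put \<open>r\<close> within distance \<open>n + n\<close> of
      \<open>f m\<close>.\<close>
    have "finite (\<Union>m<n. ball_verts G (n + n) (f m))"
      using f finite_ball_verts[OF G] by auto
    moreover have "infinite (pverts G)" using G by (simp add: bounded_network_def)
    ultimately obtain r where r: "r \<in> pverts G" "r \<notin> (\<Union>m<n. ball_verts G (n + n) (f m))"
      by (meson finite_subset subsetI)
    have "ball_verts G n (f m) \<inter> ball_verts G n r = {}" if "m < n" for m
    proof (rule ccontr)
      assume "ball_verts G n (f m) \<inter> ball_verts G n r \<noteq> {}"
      then obtain z where "z \<in> ball_verts G n (f m)" "z \<in> ball_verts G n r" by auto
      then have "r \<in> ball_verts G (n + n) (f m)"
        using ball_verts_trans ball_verts_sym[OF un] by metis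
      then show False using r that by auto
    qed
    then show "\<exists>r. ?P f n r" using r by auto
  qed auto
  then show ?thesis using that by blast
qed

section \<open>Isomorphisms of rooted balls\<close>

lemma ball_iso_root: "ball_iso t G u G' u' h \<Longrightarrow> h u = u'"
  by (simp add: ball_iso_def)

lemma ball_iso_inv:
  assumes "ball_iso t G u G' u' h"
  shows "ball_iso t G' u' G u (inv_into (ball_verts G t u) h)"
proof -
  let ?B = "ball_verts G t u" and ?B' = "ball_verts G' t u'"
  have bij: "bij_betw h ?B ?B'" and hu: "h u = u'"
    and arcs: "\<And>v w. v \<in> ?B \<Longrightarrow> w \<in> ?B \<Longrightarrow> (v, w) \<in> parcs G \<longleftrightarrow> (h v, h w) \<in> parcs G'"
    using assms by (auto simp: ball_iso_def)
  have g: "bij_betw (inv_into ?B h) ?B' ?B" using bij by (rule bij_betw_inv_into)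
  have "inv_into ?B h u' = u"
    using bij_betw_inv_into_left[OF bij, of u] hu by simp
  moreover have "(v, w) \<in> parcs G' \<longleftrightarrow> (inv_into ?B h v, inv_into ?B h w) \<in> parcs G"
    if "v \<in> ?B'" "w \<in> ?B'" for v w
    using arcs[OF bij_betw_apply[OF g that(1)] bij_betw_apply[OF g that(2)]]
      bij_betw_inv_into_right[OF bij that(1)] bij_betw_inv_into_right[OF bij that(2)] by simp
  ultimately show ?thesis unfolding ball_iso_def using g by blast
qed

text \<open>The isomorphism controls arcs only inside the ball of radius \<open>T\<close>; the
  budget \<open>r + k \<le> T\<close> keeps every vertex of the walk there.\<close>

lemma ball_iso_relpow:
  assumes iso: "ball_iso T G u G' u' h"
    and v: "v \<in> ball_verts G r u" "r + k \<le> T" and "(v, w) \<in> parcs G ^^ k"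
  shows "(h v, h w) \<in> parcs G' ^^ k"
  using assms(4) v(2)
proof (induction k arbitrary: w)
  case 0
  then show ?case by auto
next
  case (Suc k)
  obtain z where z: "(v, z) \<in> parcs G ^^ k" "(z, w) \<in> parcs G" using Suc.prems(1) by auto
  have "z \<in> ball_verts G k v" "w \<in> ball_verts G (Suc k) v"
    unfolding ball_verts_def using z(1) Suc.prems(1) by blast+
  then have "z \<in> ball_verts G (r + k) u" "w \<in> ball_verts G (r + Suc k) u"
    using ball_verts_trans[OF v(1)] by blast+
  moreover have "r + k \<le> T" "r + Suc k \<le> T" using Suc.prems(2) by auto
  ultimately have "z \<in> ball_verts G T u" "w \<in> ball_verts G T u"
    by (meson ball_verts_mono subsetD)+
  then have "(h z, h w) \<in> parcs G'" using iso z(2) by (simp add: ball_iso_def)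
  then show ?case using Suc.IH[OF z(1)] Suc.prems(2) by auto
qed

text \<open>Walks are preserved in both directions, the second one by the inverse isomorphism. The
  trade of distance \<open>r\<close> against radius \<open>k\<close> matches the flow of
  information: a vertex at distance \<open>r\<close> can affect the root by time \<open>T\<close>
  only through its actions up to time \<open>T - r\<close>.\<close>

lemma ball_iso_sub:
  assumes iso: "ball_iso T G u G' u' h"
    and v: "v \<in> ball_verts G r u" "r + k \<le> T"
  shows "ball_iso k G v G' (h v) h"
proof -
  have bij: "bij_betw h (ball_verts G T u) (ball_verts G' T u')"
    using iso by (simp add: ball_iso_def)
  have rT: "r \<le> T" "0 + r \<le> T" using v by auto
  have sub: "ball_verts G k v \<subseteq> ball_verts G T u"
    using ball_verts_trans[OF v(1)] ball_verts_mono[OF v(2), of G u] by blast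
  let ?g = "inv_into (ball_verts G T u) h"
  have iso': "ball_iso T G' u' G u ?g" using iso by (rule ball_iso_inv)
  have vT: "v \<in> ball_verts G T u" using v(1) ball_verts_mono[OF rT(1), of G u] by blast
  obtain j where j: "j \<le> r" "(u, v) \<in> parcs G ^^ j" using v(1) by (auto simp: ball_verts_def)
  have "(h u, h v) \<in> parcs G' ^^ j"
    by (rule ball_iso_relpow[OF iso ball_verts_refl, of 0]) (use j rT in auto)
  then have hv: "h v \<in> ball_verts G' r u'"
    using j ball_iso_root[OF iso] by (auto simp: ball_verts_def)
  have "h ` ball_verts G k v = ball_verts G' k (h v)"
  proof (intro equalityI subsetI)
    fix w' assume "w' \<in> h ` ball_verts G k v"
    then obtain w i where "w' = h w" "i \<le> k" "(v, w) \<in> parcs G ^^ i" by (auto simp: ball_verts_def)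
    then show "w' \<in> ball_verts G' k (h v)"
      using ball_iso_relpow[OF iso v(1), of i w] v(2) by (auto simp: ball_verts_def)
  next
    fix w' assume w': "w' \<in> ball_verts G' k (h v)"
    then obtain i where i: "i \<le> k" "(h v, w') \<in> parcs G' ^^ i" by (auto simp: ball_verts_def)
    have "(?g (h v), ?g w') \<in> parcs G ^^ i"
      using ball_iso_relpow[OF iso' hv, of i w'] i v(2) by auto
    then have "?g w' \<in> ball_verts G k v"
      using bij_betw_inv_into_left[OF bij vT] i(1) by (auto simp: ball_verts_def)
    moreover have "w' \<in> ball_verts G' T u'"
      using ball_verts_trans[OF hv w'] ball_verts_mono[OF v(2), of G' u'] by blast
    then have "h (?g w') = w'" by (rule bij_betw_inv_into_right[OF bij])
    ultimately show "w' \<in> h ` ball_verts G k v" by (metis imageI)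
  qed
  moreover have "inj_on h (ball_verts G k v)"
    using bij sub by (auto simp: bij_betw_def intro: inj_on_subset)
  moreover have "(a, b) \<in> parcs G \<longleftrightarrow> (h a, h b) \<in> parcs G'"
    if "a \<in> ball_verts G k v" "b \<in> ball_verts G k v" for a b
    using iso subsetD[OF sub that(1)] subsetD[OF sub that(2)] by (simp add: ball_iso_def)
  ultimately show ?thesis by (simp add: ball_iso_def bij_betw_def)
qed

lemma ball_iso_nbrs:
  assumes "ball_iso T G u G' u' h" "1 \<le> T"
  shows "nbrs G' u' = h ` nbrs G u"
proof -
  have iso: "ball_iso 1 G u G' u' h"
    using ball_iso_sub[OF assms(1), of u 0 1] assms ball_iso_root[OF assms(1)] by simp
  then have im: "h ` ball_verts G 1 u = ball_verts G' 1 u'"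
    by (simp add: ball_iso_def bij_betw_def)
  show ?thesis
  proof (intro equalityI subsetI)
    fix w' assume w': "w' \<in> nbrs G' u'"
    then obtain w where w: "w \<in> ball_verts G 1 u" "w' = h w"
      using im nbrs_subset_ball_verts by (metis imageE)
    then have "(u, w) \<in> parcs G"
      using iso w' ball_verts_refl unfolding ball_iso_def nbrs_def by (metis mem_Collect_eq)
    then show "w' \<in> h ` nbrs G u" using w by (auto simp: nbrs_def)
  next
    fix w' assume "w' \<in> h ` nbrs G u"
    then obtain w where w: "w \<in> nbrs G u" "w' = h w" by auto
    then have "w \<in> ball_verts G 1 u" by (auto dest: nbrs_subset_ball_verts)
    then show "w' \<in> nbrs G' u'"
      using iso w ball_verts_refl unfolding ball_iso_def nbrs_def by (metis mem_Collect_eq)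
  qed
qed

section \<open>Local limits of rooted networks\<close>

abbreviation words :: "nat \<Rightarrow> nat list set" where
  "words d \<equiv> {w. set w \<subseteq> {..<d}}"

abbreviation short_words :: "nat \<Rightarrow> nat \<Rightarrow> nat list set" where
  "short_words d k \<equiv> {w. set w \<subseteq> {..<d} \<and> length w \<le> k}"

lemma finite_short_words [simp]: "finite (short_words d k)"
  by (rule finite_lists_length_le) simp

text \<open>A word prescribes a walk from the root: its letters select the successive neighbours,
  where a letter may also stand for not moving.\<close>

definition word_cover :: "nat \<Rightarrow> 'v pair_pre_digraph \<Rightarrow> (nat list \<Rightarrow> 'v) \<Rightarrow> bool" where
  "word_cover d G e \<longleftrightarrow>
     (\<forall>w\<in>words d. \<forall>i<d. e (w @ [i]) = e w \<or> (e w, e (w @ [i])) \<in> parcs G) \<and>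
     (\<forall>w\<in>words d. \<forall>z. (e w, z) \<in> parcs G \<longrightarrow> (\<exists>i<d. z = e (w @ [i])))"

lemma word_cover_arc:
  "word_cover d G e \<Longrightarrow> w \<in> words d \<Longrightarrow> (e w, z) \<in> parcs G \<Longrightarrow> \<exists>i<d. z = e (w @ [i])"
  unfolding word_cover_def by blast

lemma word_cover_ball_verts:
  assumes "word_cover d G e"
  shows "ball_verts G k (e []) = e ` short_words d k"
proof (induction k)
  case 0
  have "short_words d 0 = {[]}" by auto
  then show ?case by simp
next
  case (Suc k)
  show ?case
  proof (intro equalityI subsetI)
    fix z assume "z \<in> ball_verts G (Suc k) (e [])"
    then consider "z \<in> e ` short_words d k" | w where "w \<in> short_words d k" "(e w, z) \<in> parcs G"
      by (auto simp: ball_verts_Suc Suc nbrs_def)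
    then show "z \<in> e ` short_words d (Suc k)"
    proof cases
      case 1
      then show ?thesis by auto
    next
      case 2
      then have "w \<in> words d" by auto
      then obtain i where "i < d" "z = e (w @ [i])"
        using word_cover_arc[OF assms _ 2(2)] by blast
      then show ?thesis using 2 by (intro image_eqI[of _ _ "w @ [i]"]) auto
    qed
  next
    fix z assume "z \<in> e ` short_words d (Suc k)"
    then obtain w where w: "z = e w" "set w \<subseteq> {..<d}" "length w \<le> Suc k" by auto
    show "z \<in> ball_verts G (Suc k) (e [])"
    proof (cases w rule: rev_cases)
      case Nil
      then show ?thesis using w by simp
    next
      case (snoc w' i)
      then have w': "w' \<in> short_words d k" "i < d" using w by auto
      then have "e w' \<in> ball_verts G k (e [])" using Suc by auto
      moreover have "e (w' @ [i]) = e w' \<or> (e w', e (w' @ [i])) \<in> parcs G"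
        using assms w' by (auto simp: word_cover_def)
      ultimately show ?thesis using w snoc by (auto simp: ball_verts_Suc nbrs_def)
    qed
  qed
qed

lemma ex_word_cover:
  assumes G: "bounded_network d G" and u: "u \<in> pverts G"
  obtains e where "word_cover d G e" "e [] = u" "e ` words d = pverts G"
proof -
  have un: "undirected_network G" using G by (rule bounded_network_undirected)
  have "\<exists>l :: nat \<Rightarrow> 'a. nbrs G v \<subseteq> l ` {..<d} \<and> range l \<subseteq> insert v (nbrs G v)" if "v \<in> pverts G" for v
  proof -
    have fin: "finite (nbrs G v)" "card (nbrs G v) \<le> d" using G that by (auto simp: bounded_network_def)
    obtain b where b: "bij_betw b {0..<card (nbrs G v)} (nbrs G v)"
      using ex_bij_betw_nat_finite[OF fin(1)] by auto
    \<comment> \<open>Letters beyond the number of neighbours stand for not moving, so one alphabet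
      of \<open>d\<close> letters serves every vertex.\<close>
    let ?l = "\<lambda>i. if i < card (nbrs G v) then b i else v"
    have "nbrs G v \<subseteq> ?l ` {..<d}"
    proof
      fix z assume "z \<in> nbrs G v"
      then have "z \<in> b ` {0..<card (nbrs G v)}" using bij_betw_imp_surj_on[OF b] by simp
      then obtain i where "i < card (nbrs G v)" "z = b i" by auto
      then show "z \<in> ?l ` {..<d}" using fin(2) by (intro image_eqI[of _ _ i]) auto
    qed
    moreover have "range ?l \<subseteq> insert v (nbrs G v)" using b by (auto simp: bij_betw_def)
    ultimately show ?thesis by blast
  qed
  then obtain l where l: "\<And>v. v \<in> pverts G \<Longrightarrow> nbrs G v \<subseteq> l v ` {..<d} \<and> range (l v) \<subseteq> insert v (nbrs G v)"
    by metis
  define e where "e = foldl l u"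
  have e_snoc: "e (w @ [i]) = l (e w) i" for w i by (simp add: e_def)
  have ev: "e w \<in> pverts G" for w
  proof (induction w rule: rev_induct)
    case (snoc i w)
    have "l (e w) i \<in> insert (e w) (nbrs G (e w))" using l[OF snoc] by blast
    then show ?case using snoc undirected_network_arcs(2)[OF un] by (auto simp: e_snoc nbrs_def)
  qed (simp add: e_def u)
  have cover: "word_cover d G e"
    unfolding word_cover_def e_snoc
  proof (intro conjI ballI allI impI)
    fix w i show "l (e w) i = e w \<or> (e w, l (e w) i) \<in> parcs G"
      using l[OF ev[of w]] by (auto simp: nbrs_def)
  next
    fix w z assume "(e w, z) \<in> parcs G"
    then have "z \<in> nbrs G (e w)" by (simp add: nbrs_def)
    then show "\<exists>i<d. z = l (e w) i" using l[OF ev[of w]] by auto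
  qed
  have root: "e [] = u" by (simp add: e_def)
  have "pverts G \<subseteq> e ` words d"
  proof
    fix v assume "v \<in> pverts G"
    then obtain t where "v \<in> ball_verts G t u" using ball_verts_exhaust[OF un u] by blast
    then show "v \<in> e ` words d" using word_cover_ball_verts[OF cover, of t] root by auto
  qed
  then show ?thesis using that[OF cover root] ev by auto
qed

text \<open>Sequential compactness of a countable product of two-point spaces, by a diagonal
  sequence along which every coordinate is eventually constant.\<close>

lemma binary_convergent_subsequence:
  fixes R :: "nat \<Rightarrow> 'a :: countable \<Rightarrow> bool"
  obtains \<sigma> L where "strict_mono (\<sigma> :: nat \<Rightarrow> nat)"
    "\<And>p. eventually (\<lambda>n. R (\<sigma> n) p = L p) sequentially"
proof -
  define P where "P n r \<longleftrightarrow> (\<exists>b. \<forall>i. R (r i) (from_nat n) = b)" for n and r :: "nat \<Rightarrow> nat"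
  interpret subseqs P
  proof
    fix n and s :: "nat \<Rightarrow> nat" assume "strict_mono s"
    have "UNIV = {i. R (s i) (from_nat n) = True} \<union> {i. R (s i) (from_nat n) = False}" by auto
    then have "infinite {i. R (s i) (from_nat n) = True} \<or> infinite {i. R (s i) (from_nat n) = False}"
      by (metis finite_Un infinite_UNIV_nat)
    then obtain b where b: "infinite {i. R (s i) (from_nat n) = b}" by blast
    then show "\<exists>r. strict_mono r \<and> P n (s \<circ> r)"
      using strict_mono_enumerate[OF b] enumerate_in_set[OF b]
      by (intro exI[of _ "enumerate {i. R (s i) (from_nat n) = b}"]) (auto simp: P_def)
  qed
  have hold: "P k (diagseq \<circ> (+) (Suc k))" for k
  proof (rule diagseq_holds)
    fix r s n assume "P n s"
    then show "P n (s \<circ> r)" by (auto simp: P_def)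
  qed
  have "\<exists>b. eventually (\<lambda>n. R (diagseq n) p = b) sequentially" for p
  proof -
    obtain b where b: "\<And>i. R (diagseq (Suc (to_nat p) + i)) p = b"
      using hold[of "to_nat p"] by (auto simp: P_def)
    have "R (diagseq n) p = b" if "n \<ge> Suc (to_nat p)" for n
      using b[of "n - Suc (to_nat p)"] that by simp
    then show ?thesis by (auto simp: eventually_sequentially)
  qed
  then obtain L where "\<And>p. eventually (\<lambda>n. R (diagseq n) p = L p) sequentially" by metis
  then show ?thesis using that subseq_diagseq by blast
qed

text \<open>All networks are pulled back to the words over \<open>d\<close> letters. Which words
  name the same vertex and which name adjacent ones is a countable family of bits, so a subsequence
  converges bit by bit; \<open>H\<close> is the quotient described by the limiting bits. Any
  finitely many of these are the bits of an actual network, from which the local properties of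
  \<open>H\<close> are read off.\<close>

lemma bounded_network_local_limit:
  fixes G :: "nat \<Rightarrow> 'v pair_pre_digraph"
  assumes G: "\<And>n. bounded_network d (G n)" and u: "\<And>n. u n \<in> pverts (G n)"
  obtains H x \<sigma> where "bounded_network d H" "x \<in> pverts H" "strict_mono (\<sigma> :: nat \<Rightarrow> nat)"
    "\<And>T. eventually (\<lambda>n. \<exists>h. ball_iso T H x (G (\<sigma> n)) (u (\<sigma> n)) h) sequentially"
proof -
  have un: "undirected_network (G n)" for n using G by (rule bounded_network_undirected)
  have "\<exists>e. word_cover d (G n) e \<and> e [] = u n \<and> e ` words d = pverts (G n)" for n
    using ex_word_cover[OF G u] by metis
  then obtain e where cov: "\<And>n. word_cover d (G n) (e n)" and root: "\<And>n. e n [] = u n"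
    and surj: "\<And>n. e n ` words d = pverts (G n)" by metis
  \<comment> \<open>The Boolean tag chooses between the two kinds of bits: coincidence and adjacency
    of the vertices named by two words.\<close>
  define R where "R n = (\<lambda>(b, w, w'). if b then e n w = e n w' else (e n w, e n w') \<in> parcs (G n))" for n
  obtain \<sigma> L where \<sigma>: "strict_mono (\<sigma> :: nat \<Rightarrow> nat)"
    and L: "\<And>p. eventually (\<lambda>n. R (\<sigma> n) p = L p) sequentially"
    using binary_convergent_subsequence[of R] by blast
  define E A where "E w w' = L (True, w, w')" and "A w w' = L (False, w, w')" for w w'
  \<comment> \<open>Goodness for \<open>k\<close> says that network \<open>\<sigma> n\<close>
    already shows the limiting bits on all words of length at most \<open>k\<close>. Since good
    \<open>n\<close> exist for every \<open>k\<close>, a claim about finitely many words can be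
    checked in one network.\<close>
  define good where "good k n \<longleftrightarrow> (\<forall>w\<in>short_words d k. \<forall>w'\<in>short_words d k.
     (E w w' \<longleftrightarrow> e (\<sigma> n) w = e (\<sigma> n) w') \<and> (A w w' \<longleftrightarrow> (e (\<sigma> n) w, e (\<sigma> n) w') \<in> parcs (G (\<sigma> n))))" for k n
  have ev_good: "eventually (good k) sequentially" for k
    unfolding good_def
  proof (intro eventually_ball_finite ballI finite_short_words)
    fix w w'
    show "eventually (\<lambda>n. (E w w' \<longleftrightarrow> e (\<sigma> n) w = e (\<sigma> n) w') \<and>
        (A w w' \<longleftrightarrow> (e (\<sigma> n) w, e (\<sigma> n) w') \<in> parcs (G (\<sigma> n)))) sequentially"
      using L[of "(True, w, w')"] L[of "(False, w, w')"]
      by eventually_elim (auto simp: R_def E_def A_def)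
  qed
  then have ex_good: "\<exists>n. good k n" for k by (auto simp: eventually_sequentially)
  have goodE: "E w w' \<longleftrightarrow> e (\<sigma> n) w = e (\<sigma> n) w'"
    and goodA: "A w w' \<longleftrightarrow> (e (\<sigma> n) w, e (\<sigma> n) w') \<in> parcs (G (\<sigma> n))"
    if "good k n" "set w \<subseteq> {..<d}" "set w' \<subseteq> {..<d}" "length w \<le> k" "length w' \<le> k" for k n w w'
    using that by (auto simp: good_def)
  have good3: "\<exists>n. good (Suc (length w1 + length w2 + length w3)) n" for w1 w2 w3 :: "nat list"
    by (rule ex_good)
  have E_sym: "E w w' \<Longrightarrow> E w' w" if "w \<in> words d" "w' \<in> words d" for w w'
  proof -
    obtain n where n: "good (Suc (length w + length w' + length w)) n" using good3 by blast
    show "E w w' \<Longrightarrow> E w' w"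
      using that goodE[OF n, of w w'] goodE[OF n, of w' w] by auto
  qed
  have E_trans: "E w1 w2 \<Longrightarrow> E w2 w3 \<Longrightarrow> E w1 w3" if "w1 \<in> words d" "w2 \<in> words d" "w3 \<in> words d" for w1 w2 w3
  proof -
    obtain n where n: "good (Suc (length w1 + length w2 + length w3)) n" using good3 by blast
    show "E w1 w2 \<Longrightarrow> E w2 w3 \<Longrightarrow> E w1 w3"
      using that goodE[OF n, of w1 w2] goodE[OF n, of w2 w3] goodE[OF n, of w1 w3] by auto
  qed
  have E_refl: "E w w" if "w \<in> words d" for w
  proof -
    obtain n where n: "good (Suc (length w + length w + length w)) n" using good3 by blast
    show ?thesis using that goodE[OF n, of w w] by auto
  qed
  have A_cong: "A w1 w3 \<longleftrightarrow> A w2 w4" if "w1 \<in> words d" "w2 \<in> words d" "w3 \<in> words d" "w4 \<in> words d" "E w1 w2" "E w3 w4" for w1 w2 w3 w4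
  proof -
    obtain n where n: "good (length w1 + length w2 + length w3 + length w4) n" using ex_good by blast
    show ?thesis
      using that goodE[OF n, of w1 w2] goodE[OF n, of w3 w4] goodA[OF n, of w1 w3] goodA[OF n, of w2 w4] by auto
  qed
  \<comment> \<open>The limit has to live on the same vertex type: its vertices are encoded
    representatives of the classes of \<open>E\<close>, and the presence of an infinite network
    guarantees room for them.\<close>
  have "infinite (UNIV :: 'v set)" using G[of 0] finite_subset[OF subset_UNIV, of "pverts (G 0)"] by (auto simp: bounded_network_def)
  then obtain \<iota> :: "nat \<Rightarrow> 'v" where \<iota>: "inj \<iota>" using infinite_countable_subset by blast
  define \<rho> where "\<rho> w = \<iota> (to_nat (SOME w'. w' \<in> words d \<and> E w w'))" for w
  have \<rho>: "\<rho> w = \<rho> w' \<longleftrightarrow> E w w'" if w: "w \<in> words d" "w' \<in> words d" for w w'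
  proof
    assume "\<rho> w = \<rho> w'"
    then have eq: "(SOME z. z \<in> words d \<and> E w z) = (SOME z. z \<in> words d \<and> E w' z)"
      unfolding \<rho>_def using \<iota> by (simp add: inj_eq)
    define z z' where "z = (SOME z. z \<in> words d \<and> E w z)" and "z' = (SOME z. z \<in> words d \<and> E w' z)"
    have "z \<in> words d \<and> E w z"
      unfolding z_def by (rule someI[of _ w]) (use E_refl[OF w(1)] w(1) in blast)
    moreover have "z' \<in> words d \<and> E w' z'"
      unfolding z'_def by (rule someI[of _ w']) (use E_refl[OF w(2)] w(2) in blast)
    moreover have "z = z'" using eq by (simp only: z_def z'_def)
    ultimately show "E w w'" using E_trans[OF w(1) _ w(2), of z] E_sym[OF w(2), of z] by blast
  next
    assume "E w w'"
    then have "z \<in> words d \<and> E w z \<longleftrightarrow> z \<in> words d \<and> E w' z" for z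
      using E_trans[OF w, of z] E_trans[OF w(2) w(1), of z] E_sym[OF w] by blast
    then show "\<rho> w = \<rho> w'" unfolding \<rho>_def by simp
  qed
  define H where "H = \<lparr>pverts = \<rho> ` words d, parcs = {(\<rho> w, \<rho> w') | w w'. w \<in> words d \<and> w' \<in> words d \<and> A w w'}\<rparr>"
  have vH: "pverts H = \<rho> ` words d" by (simp add: H_def)
  have aH: "(\<rho> w, \<rho> w') \<in> parcs H \<longleftrightarrow> A w w'" if "w \<in> words d" "w' \<in> words d" for w w'
  proof
    assume "(\<rho> w, \<rho> w') \<in> parcs H"
    then obtain z z' where z: "\<rho> w = \<rho> z" "\<rho> w' = \<rho> z'" "z \<in> words d" "z' \<in> words d" "A z z'"
      unfolding H_def by auto
    then have "E w z" "E w' z'" using that \<rho> by auto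
    then show "A w w'" using A_cong[of w z w' z'] that z by simp
  qed (use that in \<open>auto simp: H_def\<close>)
  have aHD: "\<exists>w w'. a = \<rho> w \<and> b = \<rho> w' \<and> w \<in> words d \<and> w' \<in> words d \<and> A w w'" if "(a, b) \<in> parcs H" for a b
    using that by (auto simp: H_def)
  have covH: "word_cover d H \<rho>"
    unfolding word_cover_def
  proof (intro conjI ballI allI impI)
    fix w i assume w: "w \<in> words d" "i < d"
    obtain n where n: "good (Suc (length w)) n" using ex_good by blast
    have w': "w @ [i] \<in> words d" using w by auto
    have "e (\<sigma> n) (w @ [i]) = e (\<sigma> n) w \<or> (e (\<sigma> n) w, e (\<sigma> n) (w @ [i])) \<in> parcs (G (\<sigma> n))"
      using cov w by (auto simp: word_cover_def)
    then have "E (w @ [i]) w \<or> A w (w @ [i])"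
      using goodE[OF n, of "w @ [i]" w] goodA[OF n, of w "w @ [i]"] w by auto
    then show "\<rho> (w @ [i]) = \<rho> w \<or> (\<rho> w, \<rho> (w @ [i])) \<in> parcs H"
      using \<rho>[OF w' w(1)] aH[OF w(1) w'] by auto
  next
    fix w z assume w: "w \<in> words d" "(\<rho> w, z) \<in> parcs H"
    then obtain w' where w': "w' \<in> words d" "z = \<rho> w'" "A w w'" using aHD aH by metis
    obtain n where n: "good (Suc (length w + length w')) n" using ex_good by blast
    have "(e (\<sigma> n) w, e (\<sigma> n) w') \<in> parcs (G (\<sigma> n))" using goodA[OF n, of w w'] w w' by auto
    then obtain i where i: "i < d" "e (\<sigma> n) w' = e (\<sigma> n) (w @ [i])"
      using word_cover_arc[OF cov w(1)] by blast
    then have "E w' (w @ [i])" using goodE[OF n, of w' "w @ [i]"] w w' by auto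
    then have "\<rho> w' = \<rho> (w @ [i])" using \<rho>[of w' "w @ [i]"] w w' i by auto
    then show "\<exists>i<d. z = \<rho> (w @ [i])" using i w' by auto
  qed
  have ballH: "ball_verts H k (\<rho> []) = \<rho> ` short_words d k" for k
    by (rule word_cover_ball_verts[OF covH])
  have unH: "undirected_network H"
  proof (rule undirected_networkI)
    show "countable (pverts H)" unfolding vH by (rule countable_image) (rule countableI_type)
    show "\<rho> [] \<in> pverts H" unfolding vH by (intro imageI) auto
  next
    fix a b assume "(a, b) \<in> parcs H"
    then obtain w w' where w: "a = \<rho> w" "b = \<rho> w'" "w \<in> words d" "w' \<in> words d" "A w w'" using aHD by blast
    obtain n where n: "good (length w + length w') n" using ex_good by blast
    have "(e (\<sigma> n) w, e (\<sigma> n) w') \<in> parcs (G (\<sigma> n))" using goodA[OF n, of w w'] w by auto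
    then have "A w' w" "\<not> E w w'"
      using goodA[OF n, of w' w] goodE[OF n, of w w'] w undirected_network_arcs(3,4)[OF un] by auto
    then show "a \<in> pverts H \<and> b \<in> pverts H \<and> a \<noteq> b \<and> (b, a) \<in> parcs H"
      using w \<rho> aH vH by auto
  next
    fix v assume "v \<in> pverts H"
    then obtain w where "v = \<rho> w" "w \<in> words d" using vH by auto
    then have "v \<in> ball_verts H (length w) (\<rho> [])" using ballH by auto
    then show "(\<rho> [], v) \<in> (parcs H)\<^sup>*" by (auto simp: ball_verts_def intro: relpow_imp_rtrancl)
  qed
  \<comment> \<open>If words of length at most \<open>k\<close> named all of \<open>H\<close>, then
    in a network good for \<open>k + 1\<close> one more letter would lead to no new vertex. Its
    balls would stop growing, against its infinitude.\<close>
  have "infinite (pverts H)"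
  proof
    assume "finite (pverts H)"
    then obtain F where F: "finite F" "F \<subseteq> words d" "\<rho> ` words d = \<rho> ` F"
      unfolding vH by (meson finite_subset_image order_refl)
    define k where "k = Max (insert 0 (length ` F))"
    have Fk: "length w \<le> k" if "w \<in> F" for w using F that unfolding k_def by (intro Max_ge) auto
    obtain n where n: "good (Suc k) n" using ex_good by blast
    have step: "e (\<sigma> n) w \<in> e (\<sigma> n) ` short_words d k" if "w \<in> short_words d (Suc k)" for w
    proof -
      have "\<rho> w \<in> \<rho> ` F" unfolding F(3)[symmetric] using that by simp
      then obtain w' where w': "w' \<in> F" "\<rho> w = \<rho> w'" by (rule imageE)
      then have "E w w'" using \<rho>[of w w'] that F(2) by auto
      then have "e (\<sigma> n) w = e (\<sigma> n) w'"
        using goodE[OF n, of w w'] that F(2) w' Fk[OF w'(1)] by auto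
      then show ?thesis using w' F(2) Fk by auto
    qed
    have "ball_verts (G (\<sigma> n)) (k + j) (u (\<sigma> n)) \<subseteq> e (\<sigma> n) ` short_words d k" for j
    proof (induction j)
      case 0
      then show ?case using word_cover_ball_verts[OF cov[of "\<sigma> n"], of k] root by simp
    next
      case (Suc j)
      have "nbrs (G (\<sigma> n)) v \<subseteq> e (\<sigma> n) ` short_words d k" if v: "v \<in> e (\<sigma> n) ` short_words d k" for v
      proof
        fix z assume "z \<in> nbrs (G (\<sigma> n)) v"
        moreover obtain w where w: "v = e (\<sigma> n) w" "w \<in> short_words d k" using v by (rule imageE)
        moreover have "w \<in> words d" using w by simp
        ultimately obtain i where i: "i < d" "z = e (\<sigma> n) (w @ [i])"
          using word_cover_arc[OF cov, of w "\<sigma> n" z] by (auto simp: nbrs_def)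
        have "w @ [i] \<in> short_words d (Suc k)" using i w by auto
        then show "z \<in> e (\<sigma> n) ` short_words d k" using step i by blast
      qed
      then show ?case using Suc unfolding add_Suc_right ball_verts_Suc by blast
    qed
    then have sub: "ball_verts (G (\<sigma> n)) j (u (\<sigma> n)) \<subseteq> e (\<sigma> n) ` short_words d k" for j
      using ball_verts_mono[OF le_add2, of "G (\<sigma> n)" j "u (\<sigma> n)" k] by blast
    have "pverts (G (\<sigma> n)) \<subseteq> e (\<sigma> n) ` short_words d k"
    proof
      fix v assume "v \<in> pverts (G (\<sigma> n))"
      then obtain t where "v \<in> ball_verts (G (\<sigma> n)) t (u (\<sigma> n))" using ball_verts_exhaust[OF un u] by blast
      then show "v \<in> e (\<sigma> n) ` short_words d k" using sub by blast
    qed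
    then have "finite (pverts (G (\<sigma> n)))" by (rule finite_subset) simp
    then show False using G by (simp add: bounded_network_def)
  qed
  moreover have "finite (nbrs H v) \<and> card (nbrs H v) \<le> d" if v: "v \<in> pverts H" for v
  proof -
    obtain w where w: "v = \<rho> w" "w \<in> words d" using v unfolding vH by (rule imageE)
    have sub: "nbrs H v \<subseteq> (\<lambda>i. \<rho> (w @ [i])) ` {..<d}"
      using word_cover_arc[OF covH w(2)] w(1) by (force simp: nbrs_def)
    then have "card (nbrs H v) \<le> card ((\<lambda>i. \<rho> (w @ [i])) ` {..<d})" by (intro card_mono) auto
    also have "\<dots> \<le> d" using card_image_le[of "{..<d}"] by (metis card_lessThan finite_lessThan)
    finally show ?thesis using sub finite_subset by blast
  qed
  ultimately have H: "bounded_network d H" using unH by (simp add: bounded_network_def)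
  show ?thesis
  proof (rule that[OF H _ \<sigma>])
    show "\<rho> [] \<in> pverts H" unfolding vH by (intro imageI) auto
    fix T
    show "eventually (\<lambda>n. \<exists>h. ball_iso T H (\<rho> []) (G (\<sigma> n)) (u (\<sigma> n)) h) sequentially"
      using ev_good[of T]
    proof eventually_elim
      fix n assume n: "good T n"
      \<comment> \<open>Any short word naming \<open>v\<close> may be chosen: for good
        \<open>n\<close>, two names of one vertex of \<open>H\<close> lead to the same vertex of the
        network.\<close>
      define h where "h v = e (\<sigma> n) (SOME w. w \<in> short_words d T \<and> \<rho> w = v)" for v
      have h: "h (\<rho> w) = e (\<sigma> n) w" if w: "w \<in> short_words d T" for w
      proof -
        let ?z = "SOME z. z \<in> short_words d T \<and> \<rho> z = \<rho> w"
        have z: "?z \<in> short_words d T \<and> \<rho> ?z = \<rho> w"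
          using w by (intro someI[of "\<lambda>z. z \<in> short_words d T \<and> \<rho> z = \<rho> w" w]) auto
        then have "E ?z w" using \<rho>[of ?z w] w by auto
        then show ?thesis unfolding h_def using goodE[OF n, of ?z w] z w by auto
      qed
      have ballG: "ball_verts (G (\<sigma> n)) T (u (\<sigma> n)) = e (\<sigma> n) ` short_words d T"
        using word_cover_ball_verts[OF cov[of "\<sigma> n"], of T] root by simp
      have inj: "inj_on h (\<rho> ` short_words d T)"
      proof (rule inj_onI)
        fix a b assume "a \<in> \<rho> ` short_words d T" "b \<in> \<rho> ` short_words d T" and eq: "h a = h b"
        then obtain w w' where w: "a = \<rho> w" "b = \<rho> w'" "w \<in> short_words d T" "w' \<in> short_words d T" by auto
        then have "E w w'" using goodE[OF n, of w w'] h eq by auto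
        then show "a = b" using \<rho>[of w w'] w by auto
      qed
      have im: "h ` \<rho> ` short_words d T = e (\<sigma> n) ` short_words d T"
        unfolding image_image by (rule image_cong) (use h in auto)
      have "h (\<rho> []) = u (\<sigma> n)" using h[of "[]"] root by auto
      moreover have "(a, b) \<in> parcs H \<longleftrightarrow> (h a, h b) \<in> parcs (G (\<sigma> n))"
        if ab: "a \<in> \<rho> ` short_words d T" "b \<in> \<rho> ` short_words d T" for a b
      proof -
        obtain w w' where w: "a = \<rho> w" "b = \<rho> w'" "w \<in> short_words d T" "w' \<in> short_words d T"
          using ab by auto
        then show ?thesis using goodA[OF n, of w w'] aH[of w w'] h by auto
      qed
      ultimately have "ball_iso T H (\<rho> []) (G (\<sigma> n)) (u (\<sigma> n)) h"
        unfolding ball_iso_def ballH ballG bij_betw_def using inj im by blast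
      then show "\<exists>h. ball_iso T H (\<rho> []) (G (\<sigma> n)) (u (\<sigma> n)) h" by blast
    qed
  qed
qed

section \<open>The sample space\<close>

abbreviation signals :: "(bool \<Rightarrow> 'o measure) \<Rightarrow> 'v set \<Rightarrow> bool \<Rightarrow> ('v \<Rightarrow> 'o) measure" where
  "signals \<mu> V s \<equiv> PiM V (\<lambda>_. \<mu> s)"

lemma signal_laws_prob_space: "signal_laws \<mu> \<Longrightarrow> prob_space (\<mu> s)"
  by (cases s) (auto simp: signal_laws_def)

lemma signal_laws_sets: "signal_laws \<mu> \<Longrightarrow> sets (\<mu> s) = sets (\<mu> s')"
  by (cases s; cases s') (auto simp: signal_laws_def)

lemma sets_signals: "signal_laws \<mu> \<Longrightarrow> sets (signals \<mu> V s) = sets (signals \<mu> V s')"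
  by (intro sets_PiM_cong signal_laws_sets refl)

lemma prob_space_signals: "signal_laws \<mu> \<Longrightarrow> prob_space (signals \<mu> V s)"
  by (intro prob_space_PiM signal_laws_prob_space)

lemma world_kernel:
  fixes V :: "'v set"
  assumes \<mu>: "signal_laws \<mu>"
  shows "prob_space (return (count_space UNIV) s \<Otimes>\<^sub>M signals \<mu> V s)"
    and "sets (return (count_space UNIV) s \<Otimes>\<^sub>M signals \<mu> V s)
      = sets (count_space (UNIV :: bool set) \<Otimes>\<^sub>M signals \<mu> V s')"
    and "(\<lambda>s. return (count_space UNIV) s \<Otimes>\<^sub>M signals \<mu> V s)
      \<in> measure_pmf p \<rightarrow>\<^sub>M subprob_algebra (count_space (UNIV :: bool set) \<Otimes>\<^sub>M signals \<mu> V s')"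
proof -
  show prob: "prob_space (return (count_space UNIV) s \<Otimes>\<^sub>M signals \<mu> V s)" for s
  proof -
    interpret A: prob_space "return (count_space (UNIV :: bool set)) s" by (rule prob_space_return) simp
    interpret B: prob_space "signals \<mu> V s" using \<mu> by (rule prob_space_signals)
    interpret P: pair_prob_space "return (count_space UNIV) s" "signals \<mu> V s" ..
    show ?thesis by (rule P.prob_space_axioms)
  qed
  show sets: "sets (return (count_space UNIV) s \<Otimes>\<^sub>M signals \<mu> V s)
      = sets (count_space (UNIV :: bool set) \<Otimes>\<^sub>M signals \<mu> V s')" for s
    using sets_signals[OF \<mu>] by (intro sets_pair_measure_cong) auto
  show "(\<lambda>s. return (count_space UNIV) s \<Otimes>\<^sub>M signals \<mu> V s)
      \<in> measure_pmf p \<rightarrow>\<^sub>M subprob_algebra (count_space (UNIV :: bool set) \<Otimes>\<^sub>M signals \<mu> V s')"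
    using sets prob by (auto simp: space_subprob_algebra intro: prob_space_imp_subprob_space)
qed

lemma sets_world:
  "signal_laws \<mu> \<Longrightarrow> sets (world \<mu> V) = sets (count_space UNIV \<Otimes>\<^sub>M signals \<mu> V s)"
  unfolding world_def by (rule sets_bind[OF world_kernel(2)]) auto

lemma space_world:
  assumes "signal_laws \<mu>"
  shows "space (world \<mu> V) = UNIV \<times> space (signals \<mu> V s)"
  using sets_eq_imp_space_eq[OF sets_world[OF assms]] by (simp add: space_pair_measure)

lemma prob_space_world: "signal_laws \<mu> \<Longrightarrow> prob_space (world \<mu> V)"
  unfolding world_def
  by (rule measure_pmf.prob_space_bind[OF _ world_kernel(3)]) (auto intro!: AE_I2 world_kernel(1))

lemma measurable_world: "signal_laws \<mu> \<Longrightarrow>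
    measurable (world \<mu> V) N = measurable (count_space UNIV \<Otimes>\<^sub>M signals \<mu> V s) N"
  by (intro measurable_cong_sets sets_world refl)

lemma measurable_world_state:
  assumes "signal_laws \<mu>"
  shows "fst \<in> world \<mu> V \<rightarrow>\<^sub>M count_space UNIV"
  unfolding measurable_world[OF assms, of V _ True] by (rule measurable_fst)

lemma measurable_world_signal:
  "signal_laws \<mu> \<Longrightarrow> u \<in> V \<Longrightarrow> (\<lambda>\<omega>. snd \<omega> u) \<in> world \<mu> V \<rightarrow>\<^sub>M \<mu> s"
  by (simp add: measurable_world[where s = s])

lemma measurable_Pair_world:
  assumes "signal_laws \<mu>"
  shows "Pair s \<in> signals \<mu> V s \<rightarrow>\<^sub>M world \<mu> V"
  using measurable_cong_sets[OF refl sets_world[OF assms, of V s], of "signals \<mu> V s"] by simp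

lemma integral_world:
  fixes f :: "('v, 'o) outcome \<Rightarrow> real"
  assumes \<mu>: "signal_laws \<mu>" and f: "f \<in> borel_measurable (world \<mu> V)"
    and B: "\<And>\<omega>. \<omega> \<in> space (world \<mu> V) \<Longrightarrow> \<bar>f \<omega>\<bar> \<le> B"
  shows "(\<integral>\<omega>. f \<omega> \<partial>world \<mu> V)
    = ((\<integral>w. f (True, w) \<partial>signals \<mu> V True) + (\<integral>w. f (False, w) \<partial>signals \<mu> V False)) / 2"
proof -
  let ?K = "\<lambda>s. return (count_space UNIV) s \<Otimes>\<^sub>M signals \<mu> V s"
  let ?N = "count_space UNIV \<Otimes>\<^sub>M signals \<mu> V True"
  have fN: "f \<in> borel_measurable ?N" using f measurable_world[OF \<mu>] by auto
  have spN: "space ?N = space (world \<mu> V)"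
    using sets_eq_imp_space_eq[OF sets_world[OF \<mu>, of V True]] by simp
  have K: "(\<integral>\<omega>. f \<omega> \<partial>?K s) = (\<integral>w. f (s, w) \<partial>signals \<mu> V s)" for s
  proof -
    interpret A: prob_space "return (count_space (UNIV :: bool set)) s" by (rule prob_space_return) simp
    interpret B: prob_space "signals \<mu> V s" using \<mu> by (rule prob_space_signals)
    interpret P: pair_prob_space "return (count_space UNIV) s" "signals \<mu> V s" ..
    have fK: "f \<in> borel_measurable (?K s)"
      using fN measurable_cong_sets[OF world_kernel(2)[OF \<mu>] refl] by blast
    have spK: "space (?K s) = space (world \<mu> V)"
      using sets_eq_imp_space_eq[OF world_kernel(2)[OF \<mu>, of s V True]] spN by simp
    have "integrable (?K s) f"
      using fK B spK by (intro P.integrable_const_bound[of _ B]) auto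
    then have "(\<integral>\<omega>. f \<omega> \<partial>?K s) = (\<integral>s'. (\<integral>w. f (s', w) \<partial>signals \<mu> V s) \<partial>return (count_space UNIV) s)"
      by (simp add: P.integral_fst')
    also have "\<dots> = (\<integral>w. f (s, w) \<partial>signals \<mu> V s)"
      by (rule integral_return) auto
    finally show ?thesis .
  qed
  have "(\<integral>\<omega>. f \<omega> \<partial>world \<mu> V) = (\<integral>s. (\<integral>\<omega>. f \<omega> \<partial>?K s) \<partial>measure_pmf (bernoulli_pmf (1/2)))"
    unfolding world_def
  proof (rule integral_bind[OF fN])
    show "AE s in measure_pmf (bernoulli_pmf (1/2)). emeasure (?K s) (space (?K s)) \<le> ennreal 1"
      by (intro AE_I2, subst prob_space.emeasure_space_1[OF world_kernel(1)[OF \<mu>]]) simp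
    show "\<bar>f x\<bar> \<le> B" if "x \<in> space ?N" for x using B that spN by simp
  qed (use world_kernel(3)[OF \<mu>] in \<open>auto simp: measure_pmf.finite_measure_axioms\<close>)
  then show ?thesis by (simp add: K)
qed

text \<open>Outcomes are transported against \<open>e\<close>: vertex \<open>v\<close> reads the
  signal stored at \<open>e v\<close>. Injective relabellings preserve the law, which allows several
  networks to be realised on one family of signals. The restriction to \<open>V\<close> makes the
  image an element of the product space.\<close>

definition reindex :: "('v \<Rightarrow> 'i) \<Rightarrow> 'v set \<Rightarrow> ('i, 'o) outcome \<Rightarrow> ('v, 'o) outcome" where
  "reindex e V \<omega> = (fst \<omega>, \<lambda>v\<in>V. snd \<omega> (e v))"

lemma fst_reindex [simp]: "fst (reindex e V \<omega>) = fst \<omega>"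
  by (simp add: reindex_def)

lemma snd_reindex [simp]: "v \<in> V \<Longrightarrow> snd (reindex e V \<omega>) v = snd \<omega> (e v)"
  by (simp add: reindex_def)

lemma measurable_reindex:
  assumes \<mu>: "signal_laws \<mu>" and e: "e ` V \<subseteq> I"
  shows "reindex e V \<in> world \<mu> I \<rightarrow>\<^sub>M world \<mu> V"
proof -
  have "(\<lambda>\<omega>. \<lambda>v\<in>V. snd \<omega> (e v)) \<in> count_space UNIV \<Otimes>\<^sub>M signals \<mu> I True \<rightarrow>\<^sub>M signals \<mu> V True"
    using e by (intro measurable_restrict) auto
  then have "reindex e V \<in> count_space UNIV \<Otimes>\<^sub>M signals \<mu> I True \<rightarrow>\<^sub>M count_space UNIV \<Otimes>\<^sub>M signals \<mu> V True"
    unfolding reindex_def by (intro measurable_Pair) auto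
  then show ?thesis
    using measurable_cong_sets[OF sets_world[OF \<mu>, of I True] sets_world[OF \<mu>, of V True]] by blast
qed

lemma distr_reindex:
  fixes e :: "'v \<Rightarrow> 'i"
  assumes \<mu>: "signal_laws \<mu>" and e: "e ` V \<subseteq> I" "inj_on e V"
  shows "distr (world \<mu> I) (world \<mu> V) (reindex e V) = world \<mu> V"
proof (rule measure_eqI)
  interpret I: prob_space "world \<mu> I" using \<mu> by (rule prob_space_world)
  interpret V: prob_space "world \<mu> V" using \<mu> by (rule prob_space_world)
  fix A assume "A \<in> sets (distr (world \<mu> I) (world \<mu> V) (reindex e V))"
  then have A [measurable]: "A \<in> sets (world \<mu> V)" by simp
  note mr [measurable] = measurable_reindex[OF \<mu> e(1)]
  have sec: "(\<integral>w. indicator A (reindex e V (s, w)) \<partial>signals \<mu> I s)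
      = (\<integral>w. indicator A (s, w) \<partial>signals \<mu> V s :: real)" for s
  proof -
    have d: "distr (signals \<mu> I s) (signals \<mu> V s) (\<lambda>w. \<lambda>v\<in>V. w (e v)) = signals \<mu> V s"
      using e by (intro distr_PiM_reindex[of I "\<lambda>_. \<mu> s"] signal_laws_prob_space \<mu>) auto
    note [measurable] = measurable_Pair_world[OF \<mu>, of s V]
    have m: "(\<lambda>w. \<lambda>v\<in>V. w (e v)) \<in> signals \<mu> I s \<rightarrow>\<^sub>M signals \<mu> V s"
      using e by (intro measurable_restrict) auto
    have "(\<integral>w. indicator A (s, w) \<partial>signals \<mu> V s :: real)
        = (\<integral>w. indicator A (s, w) \<partial>distr (signals \<mu> I s) (signals \<mu> V s) (\<lambda>w. \<lambda>v\<in>V. w (e v)))"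
      by (simp only: d)
    also have "\<dots> = (\<integral>w. indicator A (s, \<lambda>v\<in>V. w (e v)) \<partial>signals \<mu> I s)"
      by (rule integral_distr[OF m]) measurable
    finally show ?thesis by (simp add: reindex_def)
  qed
  have "measure (world \<mu> I) (reindex e V -` A \<inter> space (world \<mu> I))
      = (\<integral>\<omega>. indicator (reindex e V -` A \<inter> space (world \<mu> I)) \<omega> \<partial>world \<mu> I)" by simp
  also have "\<dots> = (\<integral>\<omega>. indicator A (reindex e V \<omega>) \<partial>world \<mu> I)"
    by (rule Bochner_Integration.integral_cong) (auto simp: indicator_def)
  also have "\<dots> = ((\<integral>w. indicator A (reindex e V (True, w)) \<partial>signals \<mu> I True)
      + (\<integral>w. indicator A (reindex e V (False, w)) \<partial>signals \<mu> I False)) / 2"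
    by (rule integral_world[OF \<mu>, where B = 1]) (auto simp: indicator_def)
  also have "\<dots> = ((\<integral>w. indicator A (True, w) \<partial>signals \<mu> V True)
      + (\<integral>w. indicator A (False, w) \<partial>signals \<mu> V False)) / 2" by (simp only: sec)
  also have "\<dots> = (\<integral>\<omega>. indicator A \<omega> \<partial>world \<mu> V)"
    by (rule integral_world[OF \<mu>, where B = 1, symmetric]) (auto simp: indicator_def)
  also have "\<dots> = measure (world \<mu> V) A" by simp
  finally show "emeasure (distr (world \<mu> I) (world \<mu> V) (reindex e V)) A = emeasure (world \<mu> V) A"
    by (simp add: emeasure_distr I.emeasure_eq_measure V.emeasure_eq_measure)
qed simp

section \<open>Conditional independence of disjoint groups of agents\<close>

text \<open>The state is left out of the generators: disjoint groups of agents are independent only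
  once it is fixed.\<close>

definition signals_of :: "(bool \<Rightarrow> 'o measure) \<Rightarrow> 'v set \<Rightarrow> 'v set \<Rightarrow> ('v, 'o) outcome measure" where
  "signals_of \<mu> V B = sigma (space (world \<mu> V))
     {(\<lambda>\<omega>. snd \<omega> v) -` A \<inter> space (world \<mu> V) | v A. v \<in> B \<and> A \<in> sets (\<mu> True)}"

lemma space_signals_of [simp]: "space (signals_of \<mu> V B) = space (world \<mu> V)"
  unfolding signals_of_def by (rule space_measure_of) auto

lemma sets_signals_of: "sets (signals_of \<mu> V B) = sigma_sets (space (world \<mu> V))
     {(\<lambda>\<omega>. snd \<omega> v) -` A \<inter> space (world \<mu> V) | v A. v \<in> B \<and> A \<in> sets (\<mu> True)}"
  unfolding signals_of_def by (rule sets_measure_of) auto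

lemma subalgebra_signals_of:
  assumes "signal_laws \<mu>" "B \<subseteq> V"
  shows "subalgebra (world \<mu> V) (signals_of \<mu> V B)"
  unfolding subalgebra_def sets_signals_of
  using assms by (auto intro!: sets.sigma_sets_subset measurable_sets[OF measurable_world_signal])

lemma sets_signals_of_mono: "B \<subseteq> C \<Longrightarrow> sets (signals_of \<mu> V B) \<subseteq> sets (signals_of \<mu> V C)"
  unfolding sets_signals_of by (rule sigma_sets_mono') auto

lemma vimage_signal_in_signals_of:
  "v \<in> B \<Longrightarrow> A \<in> sets (\<mu> True) \<Longrightarrow>
    (\<lambda>\<omega>. snd \<omega> v) -` A \<inter> space (world \<mu> V) \<in> sets (signals_of \<mu> V B)"
  unfolding sets_signals_of by (rule sigma_sets.Basic) auto

lemma indep_vars_signals: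
  assumes \<mu>: "signal_laws \<mu>" and "V \<noteq> {}"
  shows "prob_space.indep_vars (signals \<mu> V s) (\<lambda>_. \<mu> s) (\<lambda>v w. w v) V"
proof -
  interpret P: prob_space "signals \<mu> V s" using \<mu> by (rule prob_space_signals)
  have "distr (signals \<mu> V s) (signals \<mu> V s) (\<lambda>w. \<lambda>v\<in>V. w v) = distr (signals \<mu> V s) (signals \<mu> V s) (\<lambda>w. w)"
    by (rule distr_cong) (auto simp: space_PiM PiE_def extensional_restrict)
  also have "\<dots> = signals \<mu> V s" by (simp add: distr_id)
  also have "\<dots> = PiM V (\<lambda>v. distr (signals \<mu> V s) (\<mu> s) (\<lambda>w. w v))"
    by (rule PiM_cong) (auto simp: distr_PiM_component[of V "\<lambda>_. \<mu> s"] signal_laws_prob_space[OF \<mu>])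
  finally show ?thesis
    using assms(2) by (subst P.indep_vars_iff_distr_eq_PiM') auto
qed

text \<open>On the slice of a fixed state the signals have a product law, so disjoint sets of
  coordinates generate independent sigma-algebras. The embedding \<open>Pair s\<close> pulls events
  of \<open>signals_of\<close> back to events of the corresponding coordinates.\<close>

lemma integral_mult_disjoint_signals:
  fixes f g :: "('v, 'o) outcome \<Rightarrow> real"
  assumes \<mu>: "signal_laws \<mu>" and V: "B \<subseteq> V" "C \<subseteq> V" "V \<noteq> {}" and disj: "B \<inter> C = {}"
    and f: "f \<in> borel_measurable (signals_of \<mu> V B)" "\<And>\<omega>. \<omega> \<in> space (world \<mu> V) \<Longrightarrow> \<bar>f \<omega>\<bar> \<le> b"
    and g: "g \<in> borel_measurable (signals_of \<mu> V C)" "\<And>\<omega>. \<omega> \<in> space (world \<mu> V) \<Longrightarrow> \<bar>g \<omega>\<bar> \<le> c"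
  shows "(\<integral>w. f (s, w) * g (s, w) \<partial>signals \<mu> V s)
    = (\<integral>w. f (s, w) \<partial>signals \<mu> V s) * (\<integral>w. g (s, w) \<partial>signals \<mu> V s)"
proof -
  let ?P = "signals \<mu> V s"
  interpret P: prob_space ?P using \<mu> by (rule prob_space_signals)
  define E where "E v = {(\<lambda>w. w v) -` A \<inter> space ?P | A. A \<in> sets (\<mu> s)}" for v
  define K where "K = case_bool B C"
  have K: "K j \<subseteq> V" for j using V by (cases j) (auto simp: K_def)
  have iE: "P.indep_sets E V"
    using indep_vars_signals[OF \<mu> V(3), of s] unfolding P.indep_vars_def2 E_def by simp
  have "P.indep_sets (\<lambda>j. sigma_sets (space ?P) (\<Union>v\<in>K j. E v)) UNIV"
  proof (rule P.indep_sets_collect_sigma)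
    show "P.indep_sets E (\<Union>j. K j)"
      by (rule P.indep_sets_mono_index[OF _ iE]) (use K in auto)
    show "Int_stable (E v)" for v
    proof (rule Int_stableI)
      fix a b assume "a \<in> E v" "b \<in> E v"
      then obtain A A' where "a = (\<lambda>w. w v) -` A \<inter> space ?P" "A \<in> sets (\<mu> s)"
        "b = (\<lambda>w. w v) -` A' \<inter> space ?P" "A' \<in> sets (\<mu> s)" by (auto simp: E_def)
      then show "a \<inter> b \<in> E v" unfolding E_def by (intro CollectI exI[of _ "A \<inter> A'"]) auto
    qed
    show "disjoint_family_on K UNIV"
      using disj by (auto simp: disjoint_family_on_def K_def split: bool.splits)
  qed
  then have ind: "P.indep_set (sigma_sets (space ?P) (\<Union>v\<in>B. E v)) (sigma_sets (space ?P) (\<Union>v\<in>C. E v))"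
    unfolding P.indep_set_def K_def
    by (rule P.indep_sets_cong[THEN iffD1, rotated 2]) (auto split: bool.splits)
  have meas: "sigma_sets (space ?P) {(\<lambda>w. h (s, w)) -` A \<inter> space ?P | A. A \<in> sets borel}
      \<subseteq> sigma_sets (space ?P) (\<Union>v\<in>D. E v)"
    if h: "h \<in> borel_measurable (signals_of \<mu> V D)" and D: "D \<subseteq> V" for h :: "('v, 'o) outcome \<Rightarrow> real" and D
  proof -
    let ?S = "sigma (space ?P) (\<Union>v\<in>D. E v)"
    have spS: "space ?S = space ?P" by (rule space_measure_of) (auto simp: E_def)
    have setS: "sets ?S = sigma_sets (space ?P) (\<Union>v\<in>D. E v)" by (rule sets_measure_of) (auto simp: E_def)
    have "Pair s \<in> ?S \<rightarrow>\<^sub>M signals_of \<mu> V D"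
      unfolding signals_of_def
    proof (rule measurable_measure_of)
      show "Pair s \<in> space ?S \<rightarrow> space (world \<mu> V)" using spS space_world[OF \<mu>, of V s] by auto
    next
      fix y assume "y \<in> {(\<lambda>\<omega>. snd \<omega> v) -` A \<inter> space (world \<mu> V) | v A. v \<in> D \<and> A \<in> sets (\<mu> True)}"
      then obtain v A where y: "y = (\<lambda>\<omega>. snd \<omega> v) -` A \<inter> space (world \<mu> V)" "v \<in> D" "A \<in> sets (\<mu> s)"
        using signal_laws_sets[OF \<mu>] by blast
      have "Pair s -` y \<inter> space ?S = (\<lambda>w. w v) -` A \<inter> space ?P"
        unfolding y spS using space_world[OF \<mu>, of V s] by auto
      then show "Pair s -` y \<inter> space ?S \<in> sets ?S"
        unfolding setS using y by (intro sigma_sets.Basic) (auto simp: E_def)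
    qed auto
    then have "(\<lambda>w. h (s, w)) \<in> borel_measurable ?S" using h by (rule measurable_compose)
    then have "{(\<lambda>w. h (s, w)) -` A \<inter> space ?P | A. A \<in> sets borel} \<subseteq> sets ?S"
      using spS by (auto dest: measurable_sets)
    then have "sigma_sets (space ?S) {(\<lambda>w. h (s, w)) -` A \<inter> space ?P | A. A \<in> sets borel} \<subseteq> sets ?S"
      by (rule sets.sigma_sets_subset)
    then show ?thesis by (simp only: setS spS)
  qed
  have rv: "(\<lambda>w. h (s, w)) \<in> borel_measurable ?P" "integrable ?P (\<lambda>w. h (s, w))"
    if h: "h \<in> borel_measurable (signals_of \<mu> V D)" and D: "D \<subseteq> V"
      and b: "\<And>\<omega>. \<omega> \<in> space (world \<mu> V) \<Longrightarrow> \<bar>h \<omega>\<bar> \<le> k" for h :: "('v, 'o) outcome \<Rightarrow> real" and D k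
  proof -
    have "h \<in> borel_measurable (world \<mu> V)"
      using measurable_from_subalg[OF subalgebra_signals_of[OF \<mu> D] h] .
    then show m: "(\<lambda>w. h (s, w)) \<in> borel_measurable ?P"
      by (rule measurable_compose[OF measurable_Pair_world[OF \<mu>]])
    show "integrable ?P (\<lambda>w. h (s, w))"
      using m b space_world[OF \<mu>, of V s] by (intro P.integrable_const_bound[of _ k] AE_I2) auto
  qed
  have "P.indep_var borel (\<lambda>w. f (s, w)) borel (\<lambda>w. g (s, w))"
    unfolding P.indep_var_eq
  proof (intro conjI)
    show "P.indep_set (sigma_sets (space ?P) {(\<lambda>w. f (s, w)) -` A \<inter> space ?P | A. A \<in> sets borel})
       (sigma_sets (space ?P) {(\<lambda>w. g (s, w)) -` A \<inter> space ?P | A. A \<in> sets borel})"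
      using ind meas[OF f(1) V(1)] meas[OF g(1) V(2)] unfolding P.indep_set_def
      by (rule_tac P.indep_sets_mono_sets) (auto split: bool.splits)
  qed (use rv[OF f(1) V(1) f(2)] rv[OF g(1) V(2) g(2)] in auto)
  then show ?thesis
    using rv[OF f(1) V(1) f(2)] rv[OF g(1) V(2) g(2)] by (intro P.indep_var_lebesgue_integral) auto
qed

section \<open>Beliefs and actions on one network\<close>

text \<open>The state and the beliefs are rescaled from \<open>[0, 1]\<close> to \<open>[-1, 1]\<close>, so that the value of
  an estimator is its correlation with the state.\<close>

definition truth :: "('v, 'o) outcome \<Rightarrow> real" where
  "truth \<omega> = (if fst \<omega> then 1 else -1)"

definition adv :: "(bool \<Rightarrow> 'o measure) \<Rightarrow> 'v pair_pre_digraph \<Rightarrow> ('v, 'o) outcome measure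
    \<Rightarrow> ('v, 'o) outcome \<Rightarrow> real" where
  "adv \<mu> G F \<omega> = 2 * posterior \<mu> G F \<omega> - 1"

locale network_process =
  fixes \<mu> :: "bool \<Rightarrow> 'o measure" and G :: "'v pair_pre_digraph" and A :: "('v, 'o) actions"
  assumes laws: "signal_laws \<mu>" and net: "undirected_network G"
    and process: "learning_process \<mu> G A"
begin

abbreviation "M \<equiv> world \<mu> (pverts G)"
abbreviation "F \<equiv> info \<mu> G A"
abbreviation "F_lim \<equiv> limit_info \<mu> G A"

sublocale prob_space M by (rule prob_space_world[OF laws])

text \<open>The generators of \<open>info\<close> are kept by name because coupled networks are
  compared generator by generator.\<close>

definition info_gen :: "'v \<Rightarrow> nat \<Rightarrow> ('v, 'o) outcome set set" where
  "info_gen u t = {(\<lambda>\<omega>. snd \<omega> u) -` B \<inter> space M | B. B \<in> sets (\<mu> True)} \<union>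
     {{\<omega>\<in>space M. A v t' \<omega>} | v t'. v \<in> nbrs G u \<and> 1 \<le> t' \<and> t' < t}"

lemma info_gen_Pow: "info_gen u t \<subseteq> Pow (space M)"
  by (auto simp: info_gen_def)

lemma info_eq: "F u t = sigma (space M) (info_gen u t)"
  by (simp add: info_def info_gen_def Let_def)

lemma space_info [simp]: "space (F u t) = space M"
  unfolding info_eq by (rule space_measure_of[OF info_gen_Pow])

lemma sets_info: "sets (F u t) = sigma_sets (space M) (info_gen u t)"
  unfolding info_eq by (rule sets_measure_of[OF info_gen_Pow])

lemma nbrs_pverts: "v \<in> nbrs G u \<Longrightarrow> v \<in> pverts G"
  using undirected_network_arcs(2)[OF net] by (auto simp: nbrs_def)

lemma action_in_info:
  assumes "u \<in> pverts G" "1 \<le> t"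
  shows "{\<omega>\<in>space M. A u t \<omega>} \<in> sets (F u t)"
proof -
  have "A u t \<in> F u t \<rightarrow>\<^sub>M count_space UNIV" using process assms by (simp add: learning_process_def)
  from measurable_sets[OF this, of "{True}"] have "A u t -` {True} \<inter> space M \<in> sets (F u t)" by simp
  moreover have "A u t -` {True} \<inter> space M = {\<omega>\<in>space M. A u t \<omega>}" by auto
  ultimately show ?thesis by simp
qed

text \<open>Information travels one arc per period: a neighbour's action at time
  \<open>t' < t\<close> depends on its ball of radius \<open>t'\<close>, which lies within distance
  \<open>t' + 1 \<le> t\<close> of \<open>u\<close>.\<close>

lemma sets_info_signals_of:
  "u \<in> pverts G \<Longrightarrow> sets (F u t) \<subseteq> sets (signals_of \<mu> (pverts G) (ball_verts G t u))"
proof (induction t arbitrary: u rule: less_induct)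
  case (less t)
  let ?S = "signals_of \<mu> (pverts G) (ball_verts G t u)"
  have "info_gen u t \<subseteq> sets ?S"
  proof
    fix X assume "X \<in> info_gen u t"
    then consider B where "X = (\<lambda>\<omega>. snd \<omega> u) -` B \<inter> space M" "B \<in> sets (\<mu> True)"
      | v t' where "X = {\<omega>\<in>space M. A v t' \<omega>}" "v \<in> nbrs G u" "1 \<le> t'" "t' < t"
      by (auto simp: info_gen_def)
    then show "X \<in> sets ?S"
    proof cases
      case 1
      show ?thesis unfolding 1(1) by (rule vimage_signal_in_signals_of) (use 1(2) in auto)
    next
      case 2
      have v: "v \<in> pverts G" using 2 nbrs_pverts by blast
      have "ball_verts G t' v \<subseteq> ball_verts G (1 + t') u"
        using ball_verts_trans[OF nbrs_subset_ball_verts[OF 2(2)]] by blast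
      also have "\<dots> \<subseteq> ball_verts G t u" using 2(4) by (intro ball_verts_mono) simp
      finally have "sets (signals_of \<mu> (pverts G) (ball_verts G t' v)) \<subseteq> sets ?S"
        by (rule sets_signals_of_mono)
      then show ?thesis using less.IH[OF 2(4) v] action_in_info[OF v 2(3)] 2(1) by blast
    qed
  qed
  from sets.sigma_sets_subset[OF this] show ?case by (simp add: sets_info)
qed

lemma subalgebra_ball: "u \<in> pverts G \<Longrightarrow> subalgebra M (signals_of \<mu> (pverts G) (ball_verts G t u))"
  by (intro subalgebra_signals_of laws ball_verts_subset_pverts net)

lemma subalgebra_info: "u \<in> pverts G \<Longrightarrow> subalgebra M (F u t)"
  using sets_info_signals_of[of u t] subalgebra_ball[of u t] by (auto simp: subalgebra_def)

lemma measurable_info_signals_of: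
  assumes "u \<in> pverts G" "f \<in> borel_measurable (F u t)"
  shows "f \<in> borel_measurable (signals_of \<mu> (pverts G) (ball_verts G t u))"
  by (rule measurable_from_subalg[OF _ assms(2)])
    (use sets_info_signals_of[OF assms(1)] in \<open>simp add: subalgebra_def\<close>)

lemma sets_info_mono: "s \<le> t \<Longrightarrow> sets (F u s) \<subseteq> sets (F u t)"
  unfolding sets_info info_gen_def by (intro sigma_sets_mono' Un_mono order_refl) (auto intro: less_le_trans)

lemma limit_info_Pow: "(\<Union>t\<in>{1..}. sets (F u t)) \<subseteq> Pow (space M)"
proof (rule UN_least)
  show "sets (F u t) \<subseteq> Pow (space M)" for t using sets.sets_into_space[of _ "F u t"] by auto
qed

lemma space_limit_info [simp]: "space (F_lim u) = space M"
  unfolding limit_info_def by (rule space_measure_of[OF limit_info_Pow])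

text \<open>Periods start at 1; the shift by \<open>Suc\<close> gives the increasing sequence
  indexed from 0 to which the upward theorem applies.\<close>

lemma sets_limit_info: "sets (F_lim u) = sigma_sets (space M) (\<Union>t. sets (F u (Suc t)))"
proof -
  have "(\<Union>t\<in>{1..}. sets (F u t)) = (\<Union>t. sets (F u (Suc t)))"
  proof (intro equalityI UN_least)
    fix t :: nat assume "t \<in> {1..}"
    then obtain s where "t = Suc s" by (cases t) auto
    then show "sets (F u t) \<subseteq> (\<Union>t. sets (F u (Suc t)))" by blast
  next
    fix t :: nat
    show "sets (F u (Suc t)) \<subseteq> (\<Union>t\<in>{1..}. sets (F u t))"
      by (rule UN_upper[of "Suc t" "{1..}" "\<lambda>t. sets (F u t)"]) simp
  qed
  then show ?thesis
    unfolding limit_info_def sets_measure_of[OF limit_info_Pow] by (simp only:)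
qed

lemma sets_info_limit_info: "1 \<le> t \<Longrightarrow> sets (F u t) \<subseteq> sets (F_lim u)"
  unfolding sets_limit_info by (cases t) (auto intro: sigma_sets.Basic)

lemma subalgebra_limit_info:
  assumes "u \<in> pverts G" shows "subalgebra M (F_lim u)"
proof -
  have "(\<Union>t. sets (F u (Suc t))) \<subseteq> sets M"
    using subalgebra_info[OF assms] by (auto simp: subalgebra_def)
  from sets.sigma_sets_subset[OF this] show ?thesis by (simp add: subalgebra_def sets_limit_info)
qed

lemma measurable_info_limit_info:
  assumes "1 \<le> t" "f \<in> measurable (F u t) N"
  shows "f \<in> measurable (F_lim u) N"
  by (rule measurable_from_subalg[OF _ assms(2)])
    (use sets_info_limit_info[OF assms(1)] in \<open>simp add: subalgebra_def\<close>)

section \<open>Beliefs as best estimators of the state\<close>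

lemma integrable_bounded:
  fixes f :: "('v, 'o) outcome \<Rightarrow> real"
  shows "f \<in> borel_measurable M \<Longrightarrow> (AE \<omega> in M. \<bar>f \<omega>\<bar> \<le> B) \<Longrightarrow> integrable M f"
  by (rule integrable_const_bound[of _ B]) auto

lemma measurable_truth [measurable]: "truth \<in> borel_measurable M"
  unfolding truth_def using measurable_world_state[OF laws, of "pverts G"] by measurable

lemma abs_truth [simp]: "\<bar>truth \<omega>\<bar> = 1"
  by (simp add: truth_def)

lemma state_indicator:
  "integrable M (indicator {\<omega> \<in> space M. fst \<omega>} :: _ \<Rightarrow> real)"
  "\<omega> \<in> space M \<Longrightarrow> truth \<omega> = 2 * indicator {\<omega> \<in> space M. fst \<omega>} \<omega> - 1"
proof -
  have "{\<omega> \<in> space M. fst \<omega>} \<in> sets M"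
    using measurable_world_state[OF laws, of "pverts G"] by (simp add: pred_def)
  then show "integrable M (indicator {\<omega> \<in> space M. fst \<omega>} :: _ \<Rightarrow> real)"
    by (simp add: integrable_indicator_iff less_top[symmetric])
qed (auto simp: truth_def)

lemma adv_measurable: "adv \<mu> G H \<in> borel_measurable H"
  unfolding adv_def posterior_def by measurable

lemma adv_measurable_world: "subalgebra M H \<Longrightarrow> adv \<mu> G H \<in> borel_measurable M"
  by (rule measurable_from_subalg[OF _ adv_measurable])

lemma adv_bound:
  assumes "subalgebra M H"
  shows "AE \<omega> in M. \<bar>adv \<mu> G H \<omega>\<bar> \<le> 1"
proof -
  interpret H: sigma_finite_subalgebra M H using assms by (rule sigma_finite_subalgebraI)
  let ?f = "indicator {\<omega> \<in> space M. fst \<omega>} :: _ \<Rightarrow> real"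
  have "AE \<omega> in M. real_cond_exp M H ?f \<omega> \<ge> 0" "AE \<omega> in M. real_cond_exp M H ?f \<omega> \<le> 1"
    using state_indicator(1) by (intro H.real_cond_exp_ge_c H.real_cond_exp_le_c; auto)+
  then show ?thesis unfolding adv_def posterior_def by eventually_elim auto
qed

lemma adv_integrable: "subalgebra M H \<Longrightarrow> integrable M (adv \<mu> G H)"
  using adv_measurable_world adv_bound by (intro integrable_bounded) auto

lemma integrable_bounded_mult:
  fixes f g :: "('v, 'o) outcome \<Rightarrow> real"
  assumes f: "f \<in> borel_measurable M" "AE \<omega> in M. \<bar>f \<omega>\<bar> \<le> 1"
    and g: "g \<in> borel_measurable M" "AE \<omega> in M. \<bar>g \<omega>\<bar> \<le> B"
  shows "integrable M (\<lambda>\<omega>. f \<omega> * g \<omega>)"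
proof (rule integrable_bounded)
  show "AE \<omega> in M. \<bar>f \<omega> * g \<omega>\<bar> \<le> B"
    using f(2) g(2)
  proof eventually_elim
    fix \<omega> assume "\<bar>f \<omega>\<bar> \<le> 1" "\<bar>g \<omega>\<bar> \<le> B"
    then have "\<bar>f \<omega>\<bar> * \<bar>g \<omega>\<bar> \<le> 1 * B" by (intro mult_mono) auto
    then show "\<bar>f \<omega> * g \<omega>\<bar> \<le> B" by (simp add: abs_mult)
  qed
qed (use f g in measurable)

text \<open>The defining property of a conditional expectation, with \<open>adv\<close> in that role
  for \<open>truth\<close>. It lets the state be replaced by a belief in products with anything the
  agent knows.\<close>

lemma integral_truth_mult:
  assumes H: "subalgebra M H" and g: "g \<in> borel_measurable H" "AE \<omega> in M. \<bar>g \<omega>\<bar> \<le> B"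
  shows "expectation (\<lambda>\<omega>. truth \<omega> * g \<omega>) = expectation (\<lambda>\<omega>. adv \<mu> G H \<omega> * g \<omega>)"
proof -
  interpret H: sigma_finite_subalgebra M H using H by (rule sigma_finite_subalgebraI)
  let ?f = "indicator {\<omega> \<in> space M. fst \<omega>} :: _ \<Rightarrow> real"
  have gM [measurable]: "g \<in> borel_measurable M" using measurable_from_subalg[OF H g(1)] .
  have fM [measurable]: "?f \<in> borel_measurable M" using state_indicator(1) by auto
  have ig: "integrable M g" using g by (intro integrable_bounded) auto
  have "integrable M (\<lambda>\<omega>. ?f \<omega> * g \<omega>)"
    using g by (intro integrable_bounded_mult) auto
  then have igf: "integrable M (\<lambda>\<omega>. g \<omega> * ?f \<omega>)" by (simp add: mult.commute)
  note ce = H.real_cond_exp_intg[OF igf g(1) fM]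
  have "expectation (\<lambda>\<omega>. truth \<omega> * g \<omega>) = expectation (\<lambda>\<omega>. 2 * (g \<omega> * ?f \<omega>) - g \<omega>)"
    by (rule Bochner_Integration.integral_cong) (auto simp: state_indicator(2) algebra_simps)
  also have "\<dots> = 2 * expectation (\<lambda>\<omega>. g \<omega> * ?f \<omega>) - expectation g"
    using igf ig by simp
  also have "\<dots> = 2 * expectation (\<lambda>\<omega>. g \<omega> * real_cond_exp M H ?f \<omega>) - expectation g"
    by (simp only: ce(2))
  also have "\<dots> = expectation (\<lambda>\<omega>. 2 * (g \<omega> * real_cond_exp M H ?f \<omega>) - g \<omega>)"
    using ce(1) ig by simp
  also have "\<dots> = expectation (\<lambda>\<omega>. adv \<mu> G H \<omega> * g \<omega>)"
    by (rule Bochner_Integration.integral_cong) (auto simp: adv_def posterior_def algebra_simps)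
  finally show ?thesis .
qed

text \<open>Optimality in dual form: among estimators bounded by 1 and known to the agent, the best
  correlation with the state is E|adv|, attained by the sign of the belief. Bounds below arise by
  inserting cleverly chosen estimators \<open>g\<close>.\<close>

lemma integral_truth_mult_le:
  assumes H: "subalgebra M H" and g: "g \<in> borel_measurable H" "AE \<omega> in M. \<bar>g \<omega>\<bar> \<le> 1"
  shows "expectation (\<lambda>\<omega>. truth \<omega> * g \<omega>) \<le> expectation (\<lambda>\<omega>. \<bar>adv \<mu> G H \<omega>\<bar>)"
  unfolding integral_truth_mult[OF H g]
proof (rule integral_mono_AE)
  have gM: "g \<in> borel_measurable M" using measurable_from_subalg[OF H g(1)] .
  show "integrable M (\<lambda>\<omega>. adv \<mu> G H \<omega> * g \<omega>)"
    using adv_measurable_world[OF H] adv_bound[OF H] gM g(2) by (rule integrable_bounded_mult)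
  show "integrable M (\<lambda>\<omega>. \<bar>adv \<mu> G H \<omega>\<bar>)" using adv_integrable[OF H] by simp
  show "AE \<omega> in M. adv \<mu> G H \<omega> * g \<omega> \<le> \<bar>adv \<mu> G H \<omega>\<bar>"
    using g(2)
  proof eventually_elim
    fix \<omega> assume "\<bar>g \<omega>\<bar> \<le> 1"
    then have "\<bar>adv \<mu> G H \<omega>\<bar> * \<bar>g \<omega>\<bar> \<le> \<bar>adv \<mu> G H \<omega>\<bar> * 1" by (intro mult_left_mono) auto
    then show "adv \<mu> G H \<omega> * g \<omega> \<le> \<bar>adv \<mu> G H \<omega>\<bar>" by (simp add: abs_mult[symmetric])
  qed
qed

lemma integral_truth_sgn:
  assumes H: "subalgebra M H"
  shows "expectation (\<lambda>\<omega>. truth \<omega> * sgn (adv \<mu> G H \<omega>)) = expectation (\<lambda>\<omega>. \<bar>adv \<mu> G H \<omega>\<bar>)"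
proof -
  have "(\<lambda>\<omega>. sgn (adv \<mu> G H \<omega>)) \<in> borel_measurable H"
    using adv_measurable by measurable
  moreover have "AE \<omega> in M. \<bar>sgn (adv \<mu> G H \<omega>)\<bar> \<le> 1" by (simp add: sgn_if)
  ultimately have "expectation (\<lambda>\<omega>. truth \<omega> * sgn (adv \<mu> G H \<omega>))
      = expectation (\<lambda>\<omega>. adv \<mu> G H \<omega> * sgn (adv \<mu> G H \<omega>))"
    by (rule integral_truth_mult[OF H])
  also have "\<dots> = expectation (\<lambda>\<omega>. \<bar>adv \<mu> G H \<omega>\<bar>)"
    by (simp add: linordered_idom_class.abs_sgn)
  finally show ?thesis .
qed

lemma adv_levy:
  assumes u: "u \<in> pverts G"
  shows "(\<lambda>t. expectation (\<lambda>\<omega>. \<bar>adv \<mu> G (F u (Suc t)) \<omega> - adv \<mu> G (F_lim u) \<omega>\<bar>)) \<longlonglongrightarrow> 0"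
proof -
  let ?f = "indicator {\<omega> \<in> space M. fst \<omega>} :: _ \<Rightarrow> real"
  have "(\<lambda>t. expectation (\<lambda>\<omega>. \<bar>real_cond_exp M (F u (Suc t)) ?f \<omega> - real_cond_exp M (F_lim u) ?f \<omega>\<bar>)) \<longlonglongrightarrow> 0"
    by (rule levy_upward_mean[OF subalgebra_info[OF u] sets_info_mono _ sets_limit_info state_indicator(1)]) auto
  from tendsto_mult_left[OF this, of 2]
  have lim: "(\<lambda>t. 2 * expectation (\<lambda>\<omega>. \<bar>real_cond_exp M (F u (Suc t)) ?f \<omega> - real_cond_exp M (F_lim u) ?f \<omega>\<bar>)) \<longlonglongrightarrow> 0"
    by (simp only: mult_zero_right)
  have "\<bar>adv \<mu> G (F u (Suc t)) \<omega> - adv \<mu> G (F_lim u) \<omega>\<bar>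
      = 2 * \<bar>real_cond_exp M (F u (Suc t)) ?f \<omega> - real_cond_exp M (F_lim u) ?f \<omega>\<bar>" for t \<omega>
    unfolding adv_def posterior_def by argo
  then have "expectation (\<lambda>\<omega>. \<bar>adv \<mu> G (F u (Suc t)) \<omega> - adv \<mu> G (F_lim u) \<omega>\<bar>)
      = 2 * expectation (\<lambda>\<omega>. \<bar>real_cond_exp M (F u (Suc t)) ?f \<omega> - real_cond_exp M (F_lim u) ?f \<omega>\<bar>)" for t
    by (simp only: integral_mult_right_zero)
  with lim show ?thesis by (simp only:)
qed

lemma adv_abs_tendsto:
  assumes u: "u \<in> pverts G"
  shows "(\<lambda>t. expectation (\<lambda>\<omega>. \<bar>adv \<mu> G (F u (Suc t)) \<omega>\<bar>))
    \<longlonglongrightarrow> expectation (\<lambda>\<omega>. \<bar>adv \<mu> G (F_lim u) \<omega>\<bar>)"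
proof (rule LIM_zero_cancel, rule Lim_null_comparison[OF _ adv_levy[OF u]], intro always_eventually allI)
  fix t
  let ?x = "adv \<mu> G (F u (Suc t))" and ?y = "adv \<mu> G (F_lim u)"
  have i: "integrable M ?x" "integrable M ?y"
    using adv_integrable subalgebra_info[OF u] subalgebra_limit_info[OF u] by auto
  have "norm (expectation (\<lambda>\<omega>. \<bar>?x \<omega>\<bar>) - expectation (\<lambda>\<omega>. \<bar>?y \<omega>\<bar>))
      = \<bar>expectation (\<lambda>\<omega>. \<bar>?x \<omega>\<bar> - \<bar>?y \<omega>\<bar>)\<bar>" using i by simp
  also have "\<dots> \<le> expectation (\<lambda>\<omega>. \<bar>\<bar>?x \<omega>\<bar> - \<bar>?y \<omega>\<bar>\<bar>)" by (rule integral_abs_bound)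
  also have "\<dots> \<le> expectation (\<lambda>\<omega>. \<bar>?x \<omega> - ?y \<omega>\<bar>)" using i by (intro integral_mono) auto
  finally show "norm (expectation (\<lambda>\<omega>. \<bar>?x \<omega>\<bar>) - expectation (\<lambda>\<omega>. \<bar>?y \<omega>\<bar>))
      \<le> expectation (\<lambda>\<omega>. \<bar>?x \<omega> - ?y \<omega>\<bar>)" .
qed

text \<open>More information cannot hurt: the sign of an early belief is still an admissible
  estimator at the end.\<close>

lemma adv_info_le_limit_info:
  assumes u: "u \<in> pverts G" and t: "1 \<le> t"
  shows "expectation (\<lambda>\<omega>. \<bar>adv \<mu> G (F u t) \<omega>\<bar>) \<le> expectation (\<lambda>\<omega>. \<bar>adv \<mu> G (F_lim u) \<omega>\<bar>)"
proof -
  have "(\<lambda>\<omega>. sgn (adv \<mu> G (F u t) \<omega>)) \<in> borel_measurable (F_lim u)"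
    using measurable_info_limit_info[OF t adv_measurable] by measurable
  then have "expectation (\<lambda>\<omega>. truth \<omega> * sgn (adv \<mu> G (F u t) \<omega>)) \<le> expectation (\<lambda>\<omega>. \<bar>adv \<mu> G (F_lim u) \<omega>\<bar>)"
    by (rule integral_truth_mult_le[OF subalgebra_limit_info[OF u]]) (simp add: sgn_if)
  then show ?thesis by (simp add: integral_truth_sgn[OF subalgebra_info[OF u]])
qed

text \<open>At a tie \<open>adv\<close> vanishes, so either action contributes \<open>|adv|\<close>;
  off ties the action is the sign of \<open>adv\<close>. Hence the value does not depend on how ties
  are broken.\<close>

lemma prob_correct:
  assumes u: "u \<in> pverts G" and t: "1 \<le> t"
  shows "prob {\<omega> \<in> space M. A u t \<omega> = fst \<omega>} = (1 + expectation (\<lambda>\<omega>. \<bar>adv \<mu> G (F u t) \<omega>\<bar>)) / 2"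
proof -
  let ?c = "\<lambda>\<omega>. if A u t \<omega> then 1 else -1 :: real"
  have "A u t \<in> F u t \<rightarrow>\<^sub>M count_space UNIV" using process u t by (simp add: learning_process_def)
  then have c: "?c \<in> borel_measurable (F u t)" by measurable
  note cM = measurable_from_subalg[OF subalgebra_info[OF u] c]
  have set: "{\<omega> \<in> space M. A u t \<omega> = fst \<omega>} = {\<omega> \<in> space M. truth \<omega> * ?c \<omega> = 1}"
    by (auto simp: truth_def)
  have "{\<omega> \<in> space M. truth \<omega> * ?c \<omega> = 1} \<in> sets M" using cM by measurable
  then have "prob {\<omega> \<in> space M. A u t \<omega> = fst \<omega>}
      = expectation (indicator {\<omega> \<in> space M. A u t \<omega> = fst \<omega>})" using set by simp
  also have "\<dots> = expectation (\<lambda>\<omega>. (1 + truth \<omega> * ?c \<omega>) / 2)"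
    by (rule Bochner_Integration.integral_cong) (auto simp: truth_def indicator_def)
  also have "\<dots> = (1 + expectation (\<lambda>\<omega>. truth \<omega> * ?c \<omega>)) / 2"
  proof -
    have "integrable M (\<lambda>\<omega>. truth \<omega> * ?c \<omega>)"
      by (rule integrable_bounded_mult[OF _ _ cM, of _ 1]) auto
    then show ?thesis by (simp add: prob_space)
  qed
  also have "expectation (\<lambda>\<omega>. truth \<omega> * ?c \<omega>) = expectation (\<lambda>\<omega>. adv \<mu> G (F u t) \<omega> * ?c \<omega>)"
    by (rule integral_truth_mult[OF subalgebra_info[OF u] c, of 1]) auto
  also have "\<dots> = expectation (\<lambda>\<omega>. \<bar>adv \<mu> G (F u t) \<omega>\<bar>)"
  proof (rule Bochner_Integration.integral_cong[OF refl])
    fix \<omega> assume "\<omega> \<in> space M"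
    then have "belief \<mu> G A u t \<omega> < 1/2 \<longrightarrow> \<not> A u t \<omega>" "belief \<mu> G A u t \<omega> > 1/2 \<longrightarrow> A u t \<omega>"
      using process u t by (auto simp: learning_process_def)
    then show "adv \<mu> G (F u t) \<omega> * ?c \<omega> = \<bar>adv \<mu> G (F u t) \<omega>\<bar>"
      by (auto simp: adv_def abs_if)
  qed
  finally show ?thesis .
qed

lemma prob_correct_tendsto:
  assumes u: "u \<in> pverts G"
  shows "(\<lambda>t. prob {\<omega> \<in> space M. A u t \<omega> = fst \<omega>})
    \<longlonglongrightarrow> (1 + expectation (\<lambda>\<omega>. \<bar>adv \<mu> G (F_lim u) \<omega>\<bar>)) / 2"
proof -
  have "(\<lambda>t. (1 + expectation (\<lambda>\<omega>. \<bar>adv \<mu> G (F u (Suc t)) \<omega>\<bar>)) / 2)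
      \<longlonglongrightarrow> (1 + expectation (\<lambda>\<omega>. \<bar>adv \<mu> G (F_lim u) \<omega>\<bar>)) / 2"
    by (intro tendsto_intros adv_abs_tendsto u) simp
  then have "(\<lambda>t. prob {\<omega> \<in> space M. A u (Suc t) \<omega> = fst \<omega>})
      \<longlonglongrightarrow> (1 + expectation (\<lambda>\<omega>. \<bar>adv \<mu> G (F_lim u) \<omega>\<bar>)) / 2"
    by (simp add: prob_correct[OF u])
  then show ?thesis by (rule LIMSEQ_imp_Suc)
qed

text \<open>The optimal action set encodes exactly the sign of \<open>adv\<close>, with
  \<open>{False, True}\<close> standing for 0.\<close>

lemma agree_sgn:
  assumes "agents_agree \<mu> G A" "u \<in> pverts G" "v \<in> pverts G"
  shows "AE \<omega> in M. sgn (adv \<mu> G (F_lim u) \<omega>) = sgn (adv \<mu> G (F_lim v) \<omega>)"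
proof -
  obtain Z where "AE \<omega> in M. \<forall>u\<in>pverts G. optimal_actions \<mu> G A u \<omega> = Z \<omega>"
    using assms(1) by (auto simp: agents_agree_def)
  then show ?thesis
  proof eventually_elim
    fix \<omega> assume "\<forall>u\<in>pverts G. optimal_actions \<mu> G A u \<omega> = Z \<omega>"
    then have "optimal_actions \<mu> G A u \<omega> = optimal_actions \<mu> G A v \<omega>" using assms by simp
    then show "sgn (adv \<mu> G (F_lim u) \<omega>) = sgn (adv \<mu> G (F_lim v) \<omega>)"
      unfolding optimal_actions_def adv_def Let_def sgn_if by (auto split: if_splits)
  qed
qed

text \<open>E|adv| is the correlation of the state with the sign of \<open>adv\<close>, so agents
  with the same sign have the same value although their beliefs may differ.\<close>

lemma agree_adv_abs:
  assumes "agents_agree \<mu> G A" "u \<in> pverts G" "v \<in> pverts G"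
  shows "expectation (\<lambda>\<omega>. \<bar>adv \<mu> G (F_lim u) \<omega>\<bar>) = expectation (\<lambda>\<omega>. \<bar>adv \<mu> G (F_lim v) \<omega>\<bar>)"
proof -
  note sub = subalgebra_limit_info[OF assms(2)] subalgebra_limit_info[OF assms(3)]
  note [measurable] = adv_measurable_world[OF sub(1)] adv_measurable_world[OF sub(2)]
  have "expectation (\<lambda>\<omega>. truth \<omega> * sgn (adv \<mu> G (F_lim u) \<omega>))
      = expectation (\<lambda>\<omega>. truth \<omega> * sgn (adv \<mu> G (F_lim v) \<omega>))"
    using agree_sgn[OF assms] by (intro integral_cong_AE) auto
  then show ?thesis using integral_truth_sgn[OF sub(1)] integral_truth_sgn[OF sub(2)] by simp
qed

end

section \<open>Isomorphic balls carry the same beliefs\<close>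

lemma learning_model_process:
  assumes "signal_laws \<mu>" "learning_model \<mu> act" "undirected_network G"
  shows "network_process \<mu> G (act G)"
  by unfold_locales (use assms in \<open>auto simp: learning_model_def undirected_network_def\<close>)

text \<open>Away from 1/2 the belief alone decides. At 1/2 the tie-breaking rule does, and it asks
  belief, signal and observed actions to match at one pair of outcomes; this is why the networks are
  coupled pointwise and not merely in law.\<close>

lemma learning_model_action_eq:
  assumes model: "learning_model \<mu> act"
    and G: "undirected_network G" "undirected_network G'" "v \<in> pverts G" "v' \<in> pverts G'"
    and iso: "ball_iso t G v G' v' h" "1 \<le> t"
    and \<omega>: "\<omega> \<in> space (world \<mu> (pverts G))" "\<omega>' \<in> space (world \<mu> (pverts G'))"
    and belief: "belief \<mu> G (act G) v t \<omega> = belief \<mu> G' (act G') v' t \<omega>'"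
    and signal: "snd \<omega> v = snd \<omega>' v'"
    and actions: "\<forall>w\<in>nbrs G v. \<forall>t'. 1 \<le> t' \<and> t' < t \<longrightarrow> act G w t' \<omega> = act G' (h w) t' \<omega>'"
  shows "act G v t \<omega> = act G' v' t \<omega>'"
proof -
  have soc: "social_network G" "social_network G'" using G by (auto simp: undirected_network_def)
  then have p: "learning_process \<mu> G (act G)" "learning_process \<mu> G' (act G')"
    and tie: "same_tie_breaking \<mu> act" using model by (auto simp: learning_model_def)
  consider "belief \<mu> G (act G) v t \<omega> < 1/2" | "belief \<mu> G (act G) v t \<omega> > 1/2"
    | "belief \<mu> G (act G) v t \<omega> = 1/2" by linarith
  then show ?thesis
  proof cases
    case 3
    show ?thesis
      by (rule tie[unfolded same_tie_breaking_def, rule_format, where h = h])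
        (use 3 soc G iso \<omega> belief signal actions in auto)
  qed (use p G iso \<omega> belief in \<open>auto simp: learning_process_def\<close>)
qed

locale coupled_balls =
  fixes \<mu> :: "bool \<Rightarrow> 'o measure" and act :: "'v pair_pre_digraph \<Rightarrow> ('v, 'o) actions"
    and G G' :: "'v pair_pre_digraph" and u u' :: 'v and T :: nat and h :: "'v \<Rightarrow> 'v"
  assumes laws: "signal_laws \<mu>" and model: "learning_model \<mu> act"
    and net: "undirected_network G" "undirected_network G'"
    and root: "u \<in> pverts G" "u' \<in> pverts G'"
    and iso: "ball_iso T G u G' u' h"
begin

sublocale P: network_process \<mu> G "act G" by (rule learning_model_process[OF laws model net(1)])
sublocale P': network_process \<mu> G' "act G'" by (rule learning_model_process[OF laws model net(2)])

text \<open>Both processes are realised on one space, sharing the signals of corresponding agents of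
  the two balls and having independent signals otherwise.\<close>

abbreviation joint :: "('v + 'v, 'o) outcome measure" where
  "joint \<equiv> world \<mu> UNIV"

definition e' :: "'v \<Rightarrow> 'v + 'v" where
  "e' w = (if w \<in> ball_verts G' T u' then Inl (inv_into (ball_verts G T u) h w) else Inr w)"

definition \<theta> :: "('v + 'v, 'o) outcome \<Rightarrow> ('v, 'o) outcome" where
  "\<theta> = reindex Inl (pverts G)"

definition \<theta>' :: "('v + 'v, 'o) outcome \<Rightarrow> ('v, 'o) outcome" where
  "\<theta>' = reindex e' (pverts G')"

lemma bij: "bij_betw h (ball_verts G T u) (ball_verts G' T u')"
  using iso by (simp add: ball_iso_def)

lemma inj_e': "inj_on e' X"
  using inj_on_inv_into[of _ h "ball_verts G T u"] bij_betw_imp_surj_on[OF bij]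
  by (auto simp: inj_on_def e'_def split: if_splits)

lemma \<theta>_measurable [measurable]: "\<theta> \<in> joint \<rightarrow>\<^sub>M world \<mu> (pverts G)"
  and \<theta>'_measurable [measurable]: "\<theta>' \<in> joint \<rightarrow>\<^sub>M world \<mu> (pverts G')"
  unfolding \<theta>_def \<theta>'_def by (intro measurable_reindex laws; simp)+

lemma \<theta>_distr: "distr joint (world \<mu> (pverts G)) \<theta> = world \<mu> (pverts G)"
  and \<theta>'_distr: "distr joint (world \<mu> (pverts G')) \<theta>' = world \<mu> (pverts G')"
  unfolding \<theta>_def \<theta>'_def by (intro distr_reindex laws inj_e'; simp)+

lemma fst_\<theta> [simp]: "fst (\<theta> \<omega>) = fst \<omega>" "fst (\<theta>' \<omega>) = fst \<omega>"
  by (simp_all add: \<theta>_def \<theta>'_def)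

lemma in_ball_verts_T: "v \<in> ball_verts G r u \<Longrightarrow> r \<le> T \<Longrightarrow> v \<in> ball_verts G T u"
  using ball_verts_mono[of r T G u] by blast

lemma image_vertex:
  assumes "v \<in> ball_verts G T u"
  shows "v \<in> pverts G" "h v \<in> ball_verts G' T u'" "h v \<in> pverts G'"
  using assms bij_betw_apply[OF bij assms] ball_verts_subset_pverts[OF net(1) root(1)]
    ball_verts_subset_pverts[OF net(2) root(2)] by (auto dest: subsetD)

lemma signal_eq:
  assumes "v \<in> ball_verts G T u"
  shows "snd (\<theta> \<omega>) v = snd (\<theta>' \<omega>) (h v)"
  using image_vertex[OF assms] bij_betw_inv_into_left[OF bij assms]
  by (simp add: \<theta>_def \<theta>'_def e'_def)

sublocale J: prob_space joint by (rule prob_space_world[OF laws])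

lemma coupled_generators:
  assumes v: "v \<in> ball_verts G r u" "r + k \<le> T" "1 \<le> k"
    and IH: "\<And>w j. j < k \<Longrightarrow> 1 \<le> j \<Longrightarrow> w \<in> nbrs G v \<Longrightarrow>
      AE \<omega> in joint. act G w j (\<theta> \<omega>) = act G' (h w) j (\<theta>' \<omega>)"
  shows "X \<in> P.info_gen v k \<Longrightarrow> \<exists>Y\<in>P'.info_gen (h v) k. AE \<omega> in joint. \<theta> \<omega> \<in> X \<longleftrightarrow> \<theta>' \<omega> \<in> Y"
    and "Y \<in> P'.info_gen (h v) k \<Longrightarrow> \<exists>X\<in>P.info_gen v k. AE \<omega> in joint. \<theta> \<omega> \<in> X \<longleftrightarrow> \<theta>' \<omega> \<in> Y"
proof -
  have vT: "v \<in> ball_verts G T u" using in_ball_verts_T v by simp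
  have nbrs: "nbrs G' (h v) = h ` nbrs G v"
    by (rule ball_iso_nbrs[OF ball_iso_sub[OF iso v(1,2)] v(3)])
  have sp: "\<theta> \<omega> \<in> space P.M" "\<theta>' \<omega> \<in> space P'.M" if "\<omega> \<in> space joint" for \<omega>
    using that measurable_space[OF \<theta>_measurable] measurable_space[OF \<theta>'_measurable] by auto
  have sig: "AE \<omega> in joint. \<theta> \<omega> \<in> (\<lambda>\<omega>. snd \<omega> v) -` B \<inter> space P.M \<longleftrightarrow>
      \<theta>' \<omega> \<in> (\<lambda>\<omega>. snd \<omega> (h v)) -` B \<inter> space P'.M" for B
    using sp signal_eq[OF vT] by (intro AE_I2) auto
  have ac: "AE \<omega> in joint. \<theta> \<omega> \<in> {\<omega>\<in>space P.M. act G w j \<omega>} \<longleftrightarrow>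
      \<theta>' \<omega> \<in> {\<omega>\<in>space P'.M. act G' (h w) j \<omega>}" if "j < k" "1 \<le> j" "w \<in> nbrs G v" for w j
    using IH[OF that] AE_space by eventually_elim (use sp in auto)
  show "\<exists>Y\<in>P'.info_gen (h v) k. AE \<omega> in joint. \<theta> \<omega> \<in> X \<longleftrightarrow> \<theta>' \<omega> \<in> Y" if "X \<in> P.info_gen v k"
  proof -
    from that consider B where "X = (\<lambda>\<omega>. snd \<omega> v) -` B \<inter> space P.M" "B \<in> sets (\<mu> True)"
      | w j where "X = {\<omega>\<in>space P.M. act G w j \<omega>}" "w \<in> nbrs G v" "1 \<le> j" "j < k"
      unfolding P.info_gen_def by blast
    then show ?thesis
    proof cases
      case 1
      then have "(\<lambda>\<omega>. snd \<omega> (h v)) -` B \<inter> space P'.M \<in> P'.info_gen (h v) k"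
        unfolding P'.info_gen_def by blast
      then show ?thesis using sig[of B] 1 by blast
    next
      case 2
      then have "{\<omega>\<in>space P'.M. act G' (h w) j \<omega>} \<in> P'.info_gen (h v) k"
        unfolding P'.info_gen_def nbrs by blast
      then show ?thesis using ac[OF 2(4,3,2)] 2 by blast
    qed
  qed
  show "\<exists>X\<in>P.info_gen v k. AE \<omega> in joint. \<theta> \<omega> \<in> X \<longleftrightarrow> \<theta>' \<omega> \<in> Y" if "Y \<in> P'.info_gen (h v) k"
  proof -
    from that consider B where "Y = (\<lambda>\<omega>. snd \<omega> (h v)) -` B \<inter> space P'.M" "B \<in> sets (\<mu> True)"
      | w j where "Y = {\<omega>\<in>space P'.M. act G' (h w) j \<omega>}" "w \<in> nbrs G v" "1 \<le> j" "j < k"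
      unfolding P'.info_gen_def nbrs by blast
    then show ?thesis
    proof cases
      case 1
      then have "(\<lambda>\<omega>. snd \<omega> v) -` B \<inter> space P.M \<in> P.info_gen v k"
        unfolding P.info_gen_def by blast
      then show ?thesis using sig[of B] 1 by blast
    next
      case 2
      then have "{\<omega>\<in>space P.M. act G w j \<omega>} \<in> P.info_gen v k"
        unfolding P.info_gen_def by blast
      then show ?thesis using ac[OF 2(4,3,2)] 2 by blast
    qed
  qed
qed

text \<open>Pulled back to \<open>joint\<close>, both beliefs are conditional expectations of the
  same event, that the state is 1, given sigma-algebras whose generators agree almost
  surely.\<close>

lemma coupled_belief_step:
  assumes v: "v \<in> ball_verts G r u" "r + k \<le> T" "1 \<le> k"
    and IH: "\<And>w j. j < k \<Longrightarrow> 1 \<le> j \<Longrightarrow> w \<in> nbrs G v \<Longrightarrow>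
      AE \<omega> in joint. act G w j (\<theta> \<omega>) = act G' (h w) j (\<theta>' \<omega>)"
  shows "AE \<omega> in joint. belief \<mu> G (act G) v k (\<theta> \<omega>) = belief \<mu> G' (act G') (h v) k (\<theta>' \<omega>)"
proof -
  have vT: "v \<in> ball_verts G T u" using in_ball_verts_T v by simp
  note vV = image_vertex(1,3)[OF vT]
  let ?f = "indicator {\<omega> \<in> space joint. fst \<omega>} :: _ \<Rightarrow> real"
  let ?g = "indicator {\<omega> \<in> space P.M. fst \<omega>} :: _ \<Rightarrow> real"
  let ?g' = "indicator {\<omega> \<in> space P'.M. fst \<omega>} :: _ \<Rightarrow> real"
  have "{\<omega> \<in> space joint. fst \<omega>} \<in> sets joint"
    using measurable_world_state[OF laws, of UNIV] by (simp add: pred_def)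
  then have f: "integrable joint ?f" by (simp add: integrable_indicator_iff less_top[symmetric])
  have sp: "\<theta> \<in> space joint \<rightarrow> space P.M" "\<theta>' \<in> space joint \<rightarrow> space P'.M"
    using measurable_space[OF \<theta>_measurable] measurable_space[OF \<theta>'_measurable] by auto
  \<comment> \<open>Generators of the two information sigma-algebras as events of the common
    space.\<close>
  define E1 where "E1 = {\<theta> -` X \<inter> space joint | X. X \<in> P.info_gen v k}"
  define E2 where "E2 = {\<theta>' -` Y \<inter> space joint | Y. Y \<in> P'.info_gen (h v) k}"
  have V1: "vimage_algebra (space joint) \<theta> (P.F v k) = sigma (space joint) E1"
    unfolding P.info_eq E1_def by (rule vimage_algebra_sigma[OF P.info_gen_Pow sp(1)])
  have V2: "vimage_algebra (space joint) \<theta>' (P'.F (h v) k) = sigma (space joint) E2"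
    unfolding P'.info_eq E2_def by (rule vimage_algebra_sigma[OF P'.info_gen_Pow sp(2)])
  have gen: "P.info_gen v k \<subseteq> sets P.M" "P'.info_gen (h v) k \<subseteq> sets P'.M"
    using P.subalgebra_info[OF vV(1), of k] P'.subalgebra_info[OF vV(2), of k]
    unfolding subalgebra_def P.sets_info P'.sets_info by (auto intro: sigma_sets.Basic)
  have E: "E1 \<subseteq> sets joint" "E2 \<subseteq> sets joint"
    unfolding E1_def E2_def using gen measurable_sets[OF \<theta>_measurable] measurable_sets[OF \<theta>'_measurable] by auto
  have 12: "\<exists>Y\<in>E2. AE \<omega> in joint. \<omega> \<in> X \<longleftrightarrow> \<omega> \<in> Y" if X: "X \<in> E1" for X
  proof -
    obtain X0 where X0: "X = \<theta> -` X0 \<inter> space joint" "X0 \<in> P.info_gen v k" using X by (auto simp: E1_def)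
    obtain Y0 where Y0: "Y0 \<in> P'.info_gen (h v) k" "AE \<omega> in joint. \<theta> \<omega> \<in> X0 \<longleftrightarrow> \<theta>' \<omega> \<in> Y0"
      using coupled_generators(1)[OF v IH X0(2)] by auto
    show ?thesis
    proof (rule bexI)
      show "AE \<omega> in joint. \<omega> \<in> X \<longleftrightarrow> \<omega> \<in> \<theta>' -` Y0 \<inter> space joint"
        using Y0(2) unfolding X0 by eventually_elim auto
    qed (use Y0 in \<open>auto simp: E2_def\<close>)
  qed
  have 21: "\<exists>X\<in>E1. AE \<omega> in joint. \<omega> \<in> Y \<longleftrightarrow> \<omega> \<in> X" if Y: "Y \<in> E2" for Y
  proof -
    obtain Y0 where Y0: "Y = \<theta>' -` Y0 \<inter> space joint" "Y0 \<in> P'.info_gen (h v) k" using Y by (auto simp: E2_def)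
    obtain X0 where X0: "X0 \<in> P.info_gen v k" "AE \<omega> in joint. \<theta> \<omega> \<in> X0 \<longleftrightarrow> \<theta>' \<omega> \<in> Y0"
      using coupled_generators(2)[OF v IH Y0(2)] by auto
    show ?thesis
    proof (rule bexI)
      show "AE \<omega> in joint. \<omega> \<in> Y \<longleftrightarrow> \<omega> \<in> \<theta> -` X0 \<inter> space joint"
        using X0(2) unfolding Y0 by eventually_elim auto
    qed (use X0 in \<open>auto simp: E1_def\<close>)
  qed
  have sub: "subalgebra joint (sigma (space joint) E)" if "E \<subseteq> sets joint" for E
    using that sets.sets_into_space[of _ joint] sets.sigma_sets_subset[OF that]
    by (auto simp: subalgebra_def sets_measure_of_conv space_measure_of_conv)
  interpret S1: sigma_finite_subalgebra joint "sigma (space joint) E1" by (rule J.sigma_finite_subalgebraI[OF sub[OF E(1)]])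
  interpret S2: sigma_finite_subalgebra joint "sigma (space joint) E2" by (rule J.sigma_finite_subalgebraI[OF sub[OF E(2)]])
  have g: "AE \<omega> in joint. ?g (\<theta> \<omega>) = ?f \<omega>" "AE \<omega> in joint. ?g' (\<theta>' \<omega>) = ?f \<omega>"
    using sp by (auto intro!: AE_I2 simp: indicator_def)
  have gm [measurable]: "?g \<in> borel_measurable P.M" "?g' \<in> borel_measurable P'.M" "?f \<in> borel_measurable joint"
    using P.state_indicator(1) P'.state_indicator(1) f by auto
  have c1: "AE \<omega> in joint. real_cond_exp joint (sigma (space joint) E1) (\<lambda>\<omega>. ?g (\<theta> \<omega>)) \<omega>
      = belief \<mu> G (act G) v k (\<theta> \<omega>)"
    unfolding posterior_def
    using J.real_cond_exp_comp[OF \<theta>_measurable \<theta>_distr P.subalgebra_info[OF vV(1)] P.state_indicator(1), of k]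
    by (simp only: V1)
  have c2: "AE \<omega> in joint. real_cond_exp joint (sigma (space joint) E2) (\<lambda>\<omega>. ?g' (\<theta>' \<omega>)) \<omega>
      = belief \<mu> G' (act G') (h v) k (\<theta>' \<omega>)"
    unfolding posterior_def
    using J.real_cond_exp_comp[OF \<theta>'_measurable \<theta>'_distr P'.subalgebra_info[OF vV(2)] P'.state_indicator(1), of k]
    by (simp only: V2)
  have d1: "AE \<omega> in joint. real_cond_exp joint (sigma (space joint) E1) (\<lambda>\<omega>. ?g (\<theta> \<omega>)) \<omega>
      = real_cond_exp joint (sigma (space joint) E1) ?f \<omega>"
    by (rule S1.real_cond_exp_cong[OF g(1)]) measurable
  have d2: "AE \<omega> in joint. real_cond_exp joint (sigma (space joint) E2) (\<lambda>\<omega>. ?g' (\<theta>' \<omega>)) \<omega>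
      = real_cond_exp joint (sigma (space joint) E2) ?f \<omega>"
    by (rule S2.real_cond_exp_cong[OF g(2)]) measurable
  have "AE \<omega> in joint. real_cond_exp joint (sigma (space joint) E1) ?f \<omega>
      = real_cond_exp joint (sigma (space joint) E2) ?f \<omega>"
    by (rule J.real_cond_exp_sigma_cong_AE[OF E 12 21 f])
  with c1 c2 d1 d2 show ?thesis by eventually_elim simp
qed

text \<open>The induction is on time: the observed actions of a neighbour lie one step further from
  the root but at least one period earlier, so the budget \<open>r + k \<le> T\<close> is kept.
  Equal earlier actions give equal beliefs, and these with the shared signal give equal actions,
  ties included.\<close>

lemma coupled_actions:
  "v \<in> ball_verts G r u \<Longrightarrow> r + k \<le> T \<Longrightarrow> 1 \<le> k \<Longrightarrow>
    AE \<omega> in joint. act G v k (\<theta> \<omega>) = act G' (h v) k (\<theta>' \<omega>)"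
proof (induction k arbitrary: v r rule: less_induct)
  case (less k)
  have vT: "v \<in> ball_verts G T u" using in_ball_verts_T less.prems by simp
  note vV = image_vertex(1,3)[OF vT]
  have IH: "AE \<omega> in joint. act G w j (\<theta> \<omega>) = act G' (h w) j (\<theta>' \<omega>)"
    if "j < k" "1 \<le> j" "w \<in> nbrs G v" for w j
  proof (rule less.IH[OF that(1)])
    show "w \<in> ball_verts G (Suc r) u" using less.prems(1) that(3) by (auto simp: ball_verts_Suc)
  qed (use that less.prems in auto)
  \<comment> \<open>The rule needs all observed actions to agree at the same outcome; countability
    makes the union of the exceptional null sets null.\<close>
  have "countable (nbrs G v)"
    using P.nbrs_pverts undirected_network_countable[OF net(1)] by (meson countable_subset subsetI)
  then have ball: "AE \<omega> in joint. \<forall>w\<in>nbrs G v. \<forall>j\<in>{1..<k}. act G w j (\<theta> \<omega>) = act G' (h w) j (\<theta>' \<omega>)"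
    using IH by (subst AE_ball_countable) (auto simp: AE_ball_countable)
  have "AE \<omega> in joint. belief \<mu> G (act G) v k (\<theta> \<omega>) = belief \<mu> G' (act G') (h v) k (\<theta>' \<omega>)"
    by (rule coupled_belief_step[OF less.prems]) (rule IH)
  then show ?case
    using ball AE_space
  proof eventually_elim
    fix \<omega> assume b: "belief \<mu> G (act G) v k (\<theta> \<omega>) = belief \<mu> G' (act G') (h v) k (\<theta>' \<omega>)"
      and a: "\<forall>w\<in>nbrs G v. \<forall>j\<in>{1..<k}. act G w j (\<theta> \<omega>) = act G' (h w) j (\<theta>' \<omega>)"
      and \<omega>: "\<omega> \<in> space joint"
    show "act G v k (\<theta> \<omega>) = act G' (h v) k (\<theta>' \<omega>)"
    proof (rule learning_model_action_eq[OF model net vV ball_iso_sub[OF iso less.prems(1,2)] less.prems(3) _ _ b])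
      show "\<theta> \<omega> \<in> space P.M" "\<theta>' \<omega> \<in> space P'.M"
        using \<omega> measurable_space[OF \<theta>_measurable] measurable_space[OF \<theta>'_measurable] by auto
    qed (use signal_eq[OF vT] a in auto)
  qed
qed

lemma coupled_adv:
  assumes v: "v \<in> ball_verts G r u" "r + k \<le> T" "1 \<le> k"
  shows "AE \<omega> in joint. adv \<mu> G (P.F v k) (\<theta> \<omega>) = adv \<mu> G' (P'.F (h v) k) (\<theta>' \<omega>)"
proof -
  have "AE \<omega> in joint. act G w j (\<theta> \<omega>) = act G' (h w) j (\<theta>' \<omega>)"
    if "j < k" "1 \<le> j" "w \<in> nbrs G v" for w j
  proof (rule coupled_actions)
    show "w \<in> ball_verts G (Suc r) u" using v(1) that(3) by (auto simp: ball_verts_Suc)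
  qed (use that v in auto)
  then have "AE \<omega> in joint. belief \<mu> G (act G) v k (\<theta> \<omega>) = belief \<mu> G' (act G') (h v) k (\<theta>' \<omega>)"
    by (rule coupled_belief_step[OF v])
  then show ?thesis by eventually_elim (simp add: adv_def)
qed

text \<open>Both projections of the common space preserve the law, so almost sure equality there
  becomes equality in law of the two beliefs.\<close>

lemma coupled_expectation:
  assumes v: "v \<in> ball_verts G r u" "r + k \<le> T" "1 \<le> k"
    and \<phi> [measurable]: "\<phi> \<in> borel_measurable borel"
  shows "P.expectation (\<lambda>\<omega>. \<phi> (adv \<mu> G (P.F v k) \<omega>) :: real)
    = P'.expectation (\<lambda>\<omega>. \<phi> (adv \<mu> G' (P'.F (h v) k) \<omega>))"
proof -
  have vT: "v \<in> ball_verts G T u" using in_ball_verts_T v by simp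
  note [measurable] = P.adv_measurable_world[OF P.subalgebra_info[OF image_vertex(1)[OF vT]]]
    P'.adv_measurable_world[OF P'.subalgebra_info[OF image_vertex(3)[OF vT]]]
  have "P.expectation (\<lambda>\<omega>. \<phi> (adv \<mu> G (P.F v k) \<omega>))
      = (\<integral>\<omega>. \<phi> (adv \<mu> G (P.F v k) \<omega>) \<partial>distr joint P.M \<theta>)" by (simp only: \<theta>_distr)
  also have "\<dots> = (\<integral>\<omega>. \<phi> (adv \<mu> G (P.F v k) (\<theta> \<omega>)) \<partial>joint)" by (rule integral_distr) measurable
  also have "\<dots> = (\<integral>\<omega>. \<phi> (adv \<mu> G' (P'.F (h v) k) (\<theta>' \<omega>)) \<partial>joint)"
  proof (rule integral_cong_AE)
    show "AE \<omega> in joint. \<phi> (adv \<mu> G (P.F v k) (\<theta> \<omega>)) = \<phi> (adv \<mu> G' (P'.F (h v) k) (\<theta>' \<omega>))"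
      using coupled_adv[OF v(1-3)] by eventually_elim simp
  qed measurable
  also have "\<dots> = (\<integral>\<omega>. \<phi> (adv \<mu> G' (P'.F (h v) k) \<omega>) \<partial>distr joint P'.M \<theta>')"
    by (rule integral_distr[symmetric]) measurable
  also have "\<dots> = P'.expectation (\<lambda>\<omega>. \<phi> (adv \<mu> G' (P'.F (h v) k) \<omega>))" by (simp only: \<theta>'_distr)
  finally show ?thesis .
qed

end

section \<open>Distant agents\<close>

context network_process
begin

text \<open>Conditioning on the state is written as integration over the signal law of that state, a
  genuine product space where independence and Bessel's inequality apply.\<close>

definition cond_exp_state :: "bool \<Rightarrow> (('v, 'o) outcome \<Rightarrow> real) \<Rightarrow> real" where
  "cond_exp_state s f = (\<integral>w. f (s, w) \<partial>signals \<mu> (pverts G) s)"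

lemma expectation_cond_exp_state:
  assumes "f \<in> borel_measurable M" "\<And>\<omega>. \<bar>f \<omega>\<bar> \<le> B"
  shows "expectation f = (cond_exp_state True f + cond_exp_state False f) / 2"
  unfolding cond_exp_state_def by (rule integral_world[OF laws assms(1)]) (rule assms(2))

lemma expectation_truth_cond_exp_state:
  assumes f: "f \<in> borel_measurable M" "\<And>\<omega>. \<bar>f \<omega>\<bar> \<le> B"
  shows "expectation (\<lambda>\<omega>. truth \<omega> * f \<omega>) = (cond_exp_state True f - cond_exp_state False f) / 2"
proof -
  have "expectation (\<lambda>\<omega>. truth \<omega> * f \<omega>)
      = (cond_exp_state True (\<lambda>\<omega>. truth \<omega> * f \<omega>) + cond_exp_state False (\<lambda>\<omega>. truth \<omega> * f \<omega>)) / 2"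
    by (rule expectation_cond_exp_state[where B = B]) (use f in \<open>auto simp: abs_mult\<close>)
  then show ?thesis by (simp add: cond_exp_state_def truth_def)
qed

lemma cond_exp_state_abs_le:
  assumes f: "f \<in> borel_measurable M" "\<And>\<omega>. \<bar>f \<omega>\<bar> \<le> 1"
  shows "\<bar>cond_exp_state s f\<bar> \<le> 1"
proof -
  interpret S: prob_space "signals \<mu> (pverts G) s" using laws by (rule prob_space_signals)
  have "(\<lambda>w. f (s, w)) \<in> borel_measurable (signals \<mu> (pverts G) s)"
    by (rule measurable_compose[OF measurable_Pair_world[OF laws] f(1)])
  then have "integrable (signals \<mu> (pverts G) s) (\<lambda>w. f (s, w))"
    using f(2) by (intro S.integrable_const_bound[of _ 1]) auto
  then have "(\<integral>w. \<bar>f (s, w)\<bar> \<partial>signals \<mu> (pverts G) s) \<le> 1"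
    using f(2) by (intro S.integral_le_const) auto
  then show ?thesis unfolding cond_exp_state_def
    by (rule order.trans[OF integral_abs_bound])
qed

lemma cond_exp_state_decorrelate:
  assumes a: "a \<in> borel_measurable M" "\<And>\<omega>. \<bar>a \<omega>\<bar> \<le> 1"
    and B: "\<And>n. B n \<subseteq> pverts G" "\<And>i j. i < j \<Longrightarrow> B i \<inter> B j = {}"
    and h: "\<And>n. h n \<in> borel_measurable (signals_of \<mu> (pverts G) (B n))" "\<And>n \<omega>. \<bar>h n \<omega>\<bar> \<le> 1"
  shows "(\<lambda>n. cond_exp_state s (\<lambda>\<omega>. a \<omega> * h n \<omega>) - cond_exp_state s a * cond_exp_state s (h n)) \<longlonglongrightarrow> 0"
  unfolding cond_exp_state_def
proof -
  interpret S: prob_space "signals \<mu> (pverts G) s" using laws by (rule prob_space_signals)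
  have hM: "h n \<in> borel_measurable M" for n
    using measurable_from_subalg[OF subalgebra_signals_of[OF laws B(1)] h(1)] .
  show "(\<lambda>n. S.expectation (\<lambda>w. a (s, w) * h n (s, w))
      - S.expectation (\<lambda>w. a (s, w)) * S.expectation (\<lambda>w. h n (s, w))) \<longlonglongrightarrow> 0"
  proof (rule S.covariance_uncorrelated_tendsto_0)
    show "(\<lambda>w. a (s, w)) \<in> borel_measurable (signals \<mu> (pverts G) s)"
      by (rule measurable_compose[OF measurable_Pair_world[OF laws] a(1)])
    show "(\<lambda>w. h n (s, w)) \<in> borel_measurable (signals \<mu> (pverts G) s)" for n
      by (rule measurable_compose[OF measurable_Pair_world[OF laws] hM])
    show "S.expectation (\<lambda>w. h i (s, w) * h j (s, w))
        = S.expectation (\<lambda>w. h i (s, w)) * S.expectation (\<lambda>w. h j (s, w))" if "i \<noteq> j" for i j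
    proof (rule integral_mult_disjoint_signals[OF laws B(1) B(1) undirected_network_nonempty[OF net] _ h(1) h(2) h(1) h(2)])
      show "B i \<inter> B j = {}" using that B(2)[of i j] B(2)[of j i] by (cases i j rule: linorder_cases) auto
    qed
  qed (use a h in auto)
qed

text \<open>A bounded variable \<open>a\<close> looks to distant agents as if it depended on the state only.\<close>

lemma truth_decorrelate:
  assumes a: "a \<in> borel_measurable M" "\<And>\<omega>. \<bar>a \<omega>\<bar> \<le> 1"
    and B: "\<And>n. B n \<subseteq> pverts G" "\<And>i j. i < j \<Longrightarrow> B i \<inter> B j = {}"
    and h: "\<And>n. h n \<in> borel_measurable (signals_of \<mu> (pverts G) (B n))" "\<And>n \<omega>. \<bar>h n \<omega>\<bar> \<le> 1"
  shows "(\<lambda>n. expectation (\<lambda>\<omega>. truth \<omega> * (a \<omega> * h n \<omega>)) -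
     ((cond_exp_state True a + cond_exp_state False a) / 2 * expectation (\<lambda>\<omega>. truth \<omega> * h n \<omega>)
      + expectation (\<lambda>\<omega>. truth \<omega> * a \<omega>) * expectation (h n))) \<longlonglongrightarrow> 0"
proof -
  have hM: "h n \<in> borel_measurable M" for n
    using measurable_from_subalg[OF subalgebra_signals_of[OF laws B(1)] h(1)] .
  have ah: "\<bar>a \<omega> * h n \<omega>\<bar> \<le> 1" for n \<omega>
    using mult_mono[OF a(2)[of \<omega>] h(2)[of n \<omega>]] by (simp add: abs_mult)
  have ahM: "(\<lambda>\<omega>. a \<omega> * h n \<omega>) \<in> borel_measurable M" for n using a(1) hM by measurable
  let ?d = "\<lambda>s n. cond_exp_state s (\<lambda>\<omega>. a \<omega> * h n \<omega>) - cond_exp_state s a * cond_exp_state s (h n)"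
  have d: "?d s \<longlonglongrightarrow> 0" for s by (rule cond_exp_state_decorrelate[OF a B h])
  have "(\<lambda>n. (?d True n - ?d False n) / 2) \<longlonglongrightarrow> (0 - 0) / 2"
    by (intro tendsto_divide tendsto_diff d tendsto_const) simp
  then have lim: "(\<lambda>n. (?d True n - ?d False n) / 2) \<longlonglongrightarrow> 0" by simp
  have eq: "expectation (\<lambda>\<omega>. truth \<omega> * (a \<omega> * h n \<omega>)) -
     ((cond_exp_state True a + cond_exp_state False a) / 2 * expectation (\<lambda>\<omega>. truth \<omega> * h n \<omega>)
      + expectation (\<lambda>\<omega>. truth \<omega> * a \<omega>) * expectation (h n)) = (?d True n - ?d False n) / 2" for n
    unfolding expectation_truth_cond_exp_state[OF ahM ah] expectation_truth_cond_exp_state[OF hM h(2)]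
      expectation_truth_cond_exp_state[OF a] expectation_cond_exp_state[OF hM h(2)]
    by (simp add: field_simps)
  show ?thesis unfolding eq by (rule lim)
qed

text \<open>A distant agent can replace its own estimate by the common action whenever its finite-time
  belief is not informative enough; optimality of the common action bounds the gain.\<close>

lemma distant_belief_bound:
  assumes agree: "agents_agree \<mu> G A" and u: "u \<in> pverts G"
    and v: "\<And>n. v n \<in> pverts G" and T: "1 \<le> T"
    and disj: "\<And>i j. i < j \<Longrightarrow> ball_verts G T (v i) \<inter> ball_verts G T (v j) = {}"
  defines "a \<equiv> \<lambda>\<omega>. sgn (adv \<mu> G (F_lim u) \<omega>)"
  defines "\<kappa> \<equiv> (cond_exp_state True a + cond_exp_state False a) / 2"
    and "m \<equiv> expectation (\<lambda>\<omega>. \<bar>adv \<mu> G (F_lim u) \<omega>\<bar>)"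
  shows "\<exists>\<delta>. \<delta> \<longlonglongrightarrow> 0 \<and> (\<forall>n. expectation (\<lambda>\<omega>. max \<bar>adv \<mu> G (F (v n) T) \<omega>\<bar>
      (\<kappa> * adv \<mu> G (F (v n) T) \<omega> + m)) + \<delta> n \<le> m)"
proof -
  have aM [measurable]: "a \<in> borel_measurable M"
    unfolding a_def using adv_measurable_world[OF subalgebra_limit_info[OF u]] by measurable
  have a1: "\<bar>a \<omega>\<bar> \<le> 1" for \<omega> by (simp add: a_def sgn_if)
  have m: "m = expectation (\<lambda>\<omega>. truth \<omega> * a \<omega>)"
    unfolding m_def a_def by (simp add: integral_truth_sgn[OF subalgebra_limit_info[OF u]])
  define x where "x n = adv \<mu> G (F (v n) T)" for n
  \<comment> \<open>\<open>h1\<close> is the agent's own sign where it is worth at least as much as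
    following \<open>a\<close>, and \<open>h2\<close> marks the remaining event. Both are known at
    time \<open>T\<close>, so \<open>h2\<close> depends only on signals in the ball of radius
    \<open>T\<close> and decorrelates from \<open>a\<close>.\<close>
  define h1 h2 where "h1 n \<omega> = (if \<bar>x n \<omega>\<bar> \<ge> \<kappa> * x n \<omega> + m then sgn (x n \<omega>) else 0)"
    and "h2 n \<omega> = (if \<bar>x n \<omega>\<bar> \<ge> \<kappa> * x n \<omega> + m then 0 else 1 :: real)" for n \<omega>
  have xF: "x n \<in> borel_measurable (F (v n) T)" for n unfolding x_def by (rule adv_measurable)
  have hF: "h1 n \<in> borel_measurable (F (v n) T)" "h2 n \<in> borel_measurable (F (v n) T)" for n
    unfolding h1_def h2_def using xF by measurable
  have M: "f \<in> borel_measurable (F (v n) T) \<Longrightarrow> f \<in> borel_measurable M" for f :: "_ \<Rightarrow> real" and n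
    by (rule measurable_from_subalg[OF subalgebra_info[OF v]])
  note [measurable] = M[OF xF] M[OF hF(1)] M[OF hF(2)]
  have b: "\<bar>h1 n \<omega>\<bar> \<le> 1" "\<bar>h2 n \<omega>\<bar> \<le> 1" for n \<omega> by (auto simp: h1_def h2_def sgn_if)
  define \<delta> where "\<delta> n = expectation (\<lambda>\<omega>. truth \<omega> * (a \<omega> * h2 n \<omega>)) -
     (\<kappa> * expectation (\<lambda>\<omega>. truth \<omega> * h2 n \<omega>) + m * expectation (h2 n))" for n
  have "\<delta> \<longlonglongrightarrow> 0"
    unfolding \<delta>_def \<kappa>_def m
    by (rule truth_decorrelate[OF aM a1 _ disj])
      (use b(2) measurable_info_signals_of[OF v hF(2)] ball_verts_subset_pverts[OF net v] in auto)
  moreover have "expectation (\<lambda>\<omega>. max \<bar>x n \<omega>\<bar> (\<kappa> * x n \<omega> + m)) + \<delta> n \<le> m" for n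
  proof -
    have xb: "AE \<omega> in M. \<bar>x n \<omega>\<bar> \<le> 1" unfolding x_def by (rule adv_bound[OF subalgebra_info[OF v]])
    let ?y = "adv \<mu> G (F_lim (v n))"
    \<comment> \<open>An estimator that agent \<open>v n\<close> can form in the limit: by
      agreement, its own limiting sign is almost surely \<open>a\<close>. Its value is therefore at
      most \<open>m\<close>.\<close>
    let ?c = "\<lambda>\<omega>. h1 n \<omega> + sgn (?y \<omega>) * h2 n \<omega>"
    have yM [measurable]: "?y \<in> borel_measurable M" by (rule adv_measurable_world[OF subalgebra_limit_info[OF v]])
    have "?c \<in> borel_measurable (F_lim (v n))"
      using measurable_info_limit_info[OF T hF(1)[of n]] measurable_info_limit_info[OF T hF(2)[of n]]
        adv_measurable[of "F_lim (v n)"] by measurable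
    moreover have "AE \<omega> in M. \<bar>?c \<omega>\<bar> \<le> 1" by (intro AE_I2) (auto simp: h1_def h2_def sgn_if)
    ultimately have "expectation (\<lambda>\<omega>. truth \<omega> * ?c \<omega>) \<le> expectation (\<lambda>\<omega>. \<bar>?y \<omega>\<bar>)"
      by (rule integral_truth_mult_le[OF subalgebra_limit_info[OF v]])
    also have "\<dots> = m" unfolding m_def by (rule agree_adv_abs[OF agree v u])
    finally have "expectation (\<lambda>\<omega>. truth \<omega> * ?c \<omega>) \<le> m" .
    moreover have "expectation (\<lambda>\<omega>. truth \<omega> * ?c \<omega>)
        = expectation (\<lambda>\<omega>. truth \<omega> * h1 n \<omega> + truth \<omega> * (a \<omega> * h2 n \<omega>))"
    proof (rule integral_cong_AE)
      show "AE \<omega> in M. truth \<omega> * ?c \<omega> = truth \<omega> * h1 n \<omega> + truth \<omega> * (a \<omega> * h2 n \<omega>)"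
        using agree_sgn[OF agree v u, of n] by eventually_elim (simp add: a_def algebra_simps)
    qed measurable
    moreover have hb: "AE \<omega> in M. \<bar>h1 n \<omega>\<bar> \<le> 1" "AE \<omega> in M. \<bar>h2 n \<omega>\<bar> \<le> 1"
      and tb: "AE \<omega> in M. \<bar>truth \<omega>\<bar> \<le> 1"
      by (rule AE_I2; simp add: b)+
    then have i: "integrable M (\<lambda>\<omega>. truth \<omega> * h1 n \<omega>)" "integrable M (\<lambda>\<omega>. truth \<omega> * h2 n \<omega>)"
        "integrable M (\<lambda>\<omega>. x n \<omega> * h1 n \<omega>)" "integrable M (\<lambda>\<omega>. x n \<omega> * h2 n \<omega>)" "integrable M (h2 n)"
      using hb xb by (auto intro: integrable_bounded_mult[OF _ tb] integrable_bounded_mult[OF _ xb] integrable_bounded)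
    moreover have "integrable M (\<lambda>\<omega>. truth \<omega> * (a \<omega> * h2 n \<omega>))"
    proof (rule integrable_bounded_mult[where B = 1])
      show "AE \<omega> in M. \<bar>a \<omega> * h2 n \<omega>\<bar> \<le> 1"
        using mult_mono[OF a1 b(2)] by (intro AE_I2) (simp add: abs_mult)
    qed auto
    ultimately have le: "expectation (\<lambda>\<omega>. truth \<omega> * h1 n \<omega>)
        + expectation (\<lambda>\<omega>. truth \<omega> * (a \<omega> * h2 n \<omega>)) \<le> m" by simp
    have "expectation (\<lambda>\<omega>. truth \<omega> * h1 n \<omega>) = expectation (\<lambda>\<omega>. x n \<omega> * h1 n \<omega>)"
      unfolding x_def by (rule integral_truth_mult[OF subalgebra_info[OF v] hF(1), of _ 1]) (simp add: b)
    moreover have "expectation (\<lambda>\<omega>. truth \<omega> * h2 n \<omega>) = expectation (\<lambda>\<omega>. x n \<omega> * h2 n \<omega>)"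
      unfolding x_def by (rule integral_truth_mult[OF subalgebra_info[OF v] hF(2), of _ 1]) (simp add: b)
    ultimately have "expectation (\<lambda>\<omega>. x n \<omega> * h1 n \<omega>) + (\<kappa> * expectation (\<lambda>\<omega>. x n \<omega> * h2 n \<omega>)
        + m * expectation (h2 n)) + \<delta> n \<le> m"
      using le unfolding \<delta>_def by simp
    \<comment> \<open>The own sign contributes \<open>|x|\<close> and the common action, up to
      \<open>\<delta> n\<close>, \<kappa> x + m; the split into \<open>h1\<close> and
      \<open>h2\<close> picks the larger one pointwise.\<close>
    moreover have "expectation (\<lambda>\<omega>. max \<bar>x n \<omega>\<bar> (\<kappa> * x n \<omega> + m))
        = expectation (\<lambda>\<omega>. x n \<omega> * h1 n \<omega> + (\<kappa> * (x n \<omega> * h2 n \<omega>) + m * h2 n \<omega>))"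
      by (rule Bochner_Integration.integral_cong)
        (auto simp: h1_def h2_def max_def linordered_idom_class.abs_sgn)
    ultimately show ?thesis using i by simp
  qed
  ultimately show ?thesis unfolding x_def by blast
qed

text \<open>The prior is uniform, so \<open>truth\<close> has mean 0.\<close>

lemma expectation_adv:
  assumes "subalgebra M H"
  shows "expectation (adv \<mu> G H) = 0"
proof -
  have "expectation (\<lambda>\<omega>. truth \<omega> * 1) = expectation (\<lambda>\<omega>. adv \<mu> G H \<omega> * 1)"
    by (rule integral_truth_mult[OF assms, of _ 1]) auto
  moreover have "expectation (\<lambda>\<omega>. truth \<omega> * 1) = (cond_exp_state True (\<lambda>_. 1) - cond_exp_state False (\<lambda>_. 1)) / 2"
    by (rule expectation_truth_cond_exp_state[of _ 1]) auto
  moreover have "cond_exp_state s (\<lambda>_. 1) = 1" for s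
    unfolding cond_exp_state_def using prob_space.prob_space[OF prob_space_signals[OF laws]] by simp
  ultimately show ?thesis by simp
qed

text \<open>For |\<kappa>| \<le> 1 the function inside the expectation is 1-Lipschitz, so the bound
  survives convergence of the beliefs in mean.\<close>

lemma belief_bound_limit:
  assumes u: "u \<in> pverts G" and \<kappa>: "\<bar>\<kappa>\<bar> \<le> 1"
    and le: "\<And>t. 1 \<le> t \<Longrightarrow> expectation (\<lambda>\<omega>. max \<bar>adv \<mu> G (F u t) \<omega>\<bar> (\<kappa> * adv \<mu> G (F u t) \<omega> + m)) \<le> c"
  shows "expectation (\<lambda>\<omega>. max \<bar>adv \<mu> G (F_lim u) \<omega>\<bar> (\<kappa> * adv \<mu> G (F_lim u) \<omega> + m)) \<le> c"
proof -
  let ?y = "adv \<mu> G (F_lim u)"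
  let ?\<psi> = "\<lambda>x. max \<bar>x\<bar> (\<kappa> * x + m)"
  have lip: "?\<psi> y \<le> ?\<psi> x + \<bar>x - y\<bar>" for x y :: real
  proof -
    have "\<bar>\<kappa> * (y - x)\<bar> \<le> 1 * \<bar>y - x\<bar>" unfolding abs_mult by (intro mult_right_mono \<kappa>) auto
    then have "\<kappa> * y + m \<le> \<kappa> * x + m + \<bar>x - y\<bar>" by (simp add: right_diff_distrib abs_minus_commute)
    moreover have "\<bar>y\<bar> \<le> \<bar>x\<bar> + \<bar>x - y\<bar>" by simp
    ultimately show ?thesis by (simp add: max_def)
  qed
  have "expectation (\<lambda>\<omega>. ?\<psi> (?y \<omega>)) \<le> c + expectation (\<lambda>\<omega>. \<bar>adv \<mu> G (F u (Suc t)) \<omega> - ?y \<omega>\<bar>)" for t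
  proof -
    let ?x = "adv \<mu> G (F u (Suc t))"
    have i [simp]: "integrable M ?x" "integrable M ?y"
      using adv_integrable subalgebra_info[OF u] subalgebra_limit_info[OF u] by auto
    have "expectation (\<lambda>\<omega>. ?\<psi> (?y \<omega>)) \<le> expectation (\<lambda>\<omega>. ?\<psi> (?x \<omega>) + \<bar>?x \<omega> - ?y \<omega>\<bar>)"
      by (rule integral_mono[OF _ _ lip]) auto
    also have "\<dots> = expectation (\<lambda>\<omega>. ?\<psi> (?x \<omega>)) + expectation (\<lambda>\<omega>. \<bar>?x \<omega> - ?y \<omega>\<bar>)" by simp
    finally show ?thesis using le[of "Suc t"] by simp
  qed
  moreover have "(\<lambda>t. c + expectation (\<lambda>\<omega>. \<bar>adv \<mu> G (F u (Suc t)) \<omega> - ?y \<omega>\<bar>)) \<longlonglongrightarrow> c + 0"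
    by (intro tendsto_add tendsto_const adv_levy u)
  ultimately show ?thesis using LIMSEQ_le_const[of _ "c + 0"] by auto
qed

text \<open>The two arguments of the maximum both have mean \<open>m\<close>, for \<kappa> x + m
  because beliefs have mean 0. A maximum with mean at most \<open>m\<close> forces them to coincide
  almost surely, and for |\<kappa>| < 1 the equation |x| = \<kappa> x + m has at most one solution
  of each sign.\<close>

lemma sign_determines_belief:
  assumes agree: "agents_agree \<mu> G A"
    and \<kappa>: "\<kappa> + m \<le> 1" "- 1 \<le> \<kappa> - m"
    and abs: "\<And>u. u \<in> pverts G \<Longrightarrow> expectation (\<lambda>\<omega>. \<bar>adv \<mu> G (F_lim u) \<omega>\<bar>) = m"
    and le: "\<And>u. u \<in> pverts G \<Longrightarrow>
      expectation (\<lambda>\<omega>. max \<bar>adv \<mu> G (F_lim u) \<omega>\<bar> (\<kappa> * adv \<mu> G (F_lim u) \<omega> + m)) \<le> m"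
    and uv: "u \<in> pverts G" "v \<in> pverts G"
  shows "AE \<omega> in M. adv \<mu> G (F_lim u) \<omega> = adv \<mu> G (F_lim v) \<omega>"
proof -
  have eq: "AE \<omega> in M. \<bar>adv \<mu> G (F_lim u) \<omega>\<bar> = \<kappa> * adv \<mu> G (F_lim u) \<omega> + m" if u: "u \<in> pverts G" for u
  proof -
    let ?y = "adv \<mu> G (F_lim u)"
    let ?\<psi> = "\<lambda>\<omega>. max \<bar>?y \<omega>\<bar> (\<kappa> * ?y \<omega> + m)"
    have i [simp]: "integrable M ?y" using adv_integrable subalgebra_limit_info[OF u] by auto
    have "expectation (\<lambda>\<omega>. \<kappa> * ?y \<omega> + m) = m"
      using expectation_adv[OF subalgebra_limit_info[OF u]] by (simp add: prob_space)
    then have "expectation (\<lambda>\<omega>. ?\<psi> \<omega> - (\<kappa> * ?y \<omega> + m)) \<le> 0" using le[OF u] by simp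
    moreover have "expectation (\<lambda>\<omega>. ?\<psi> \<omega> - (\<kappa> * ?y \<omega> + m)) \<ge> 0" by (rule integral_nonneg_AE) auto
    ultimately have "AE \<omega> in M. ?\<psi> \<omega> - (\<kappa> * ?y \<omega> + m) = 0"
      by (subst integral_nonneg_eq_0_iff_AE[symmetric]) auto
    moreover have "expectation (\<lambda>\<omega>. ?\<psi> \<omega> - \<bar>?y \<omega>\<bar>) \<le> 0" using le[OF u] abs[OF u] by simp
    moreover have "expectation (\<lambda>\<omega>. ?\<psi> \<omega> - \<bar>?y \<omega>\<bar>) \<ge> 0" by (rule integral_nonneg_AE) auto
    ultimately have "AE \<omega> in M. ?\<psi> \<omega> - (\<kappa> * ?y \<omega> + m) = 0" "AE \<omega> in M. ?\<psi> \<omega> - \<bar>?y \<omega>\<bar> = 0"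
      by (simp, subst integral_nonneg_eq_0_iff_AE[symmetric]) auto
    then show ?thesis by eventually_elim simp
  qed
  have m0: "m \<ge> 0" using abs[OF uv(1)] by (metis abs_ge_zero integral_nonneg_AE AE_I2)
  show ?thesis
  proof (cases "m = 0")
    \<comment> \<open>If \<open>m = 0\<close>, then \<kappa> may be 1 or -1 and the equation no
      longer determines x on one side; but here all beliefs vanish. For \<open>m > 0\<close> the
      bounds on \<kappa> become strict.\<close>
    case True
    have "AE \<omega> in M. adv \<mu> G (F_lim u) \<omega> = 0" if u: "u \<in> pverts G" for u
    proof -
      have "integrable M (adv \<mu> G (F_lim u))" using adv_integrable subalgebra_limit_info[OF u] by auto
      then have "AE \<omega> in M. \<bar>adv \<mu> G (F_lim u) \<omega>\<bar> = 0"
        using abs[OF u] True by (subst integral_nonneg_eq_0_iff_AE[symmetric]) auto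
      then show ?thesis by simp
    qed
    from this[OF uv(1)] this[OF uv(2)] show ?thesis by eventually_elim simp
  next
    case False
    then have \<kappa>': "\<kappa> < 1" "-1 < \<kappa>" using m0 \<kappa> by auto
    show ?thesis
      using agree_sgn[OF agree uv] eq[OF uv(1)] eq[OF uv(2)]
    proof eventually_elim
      fix \<omega>
      let ?x = "adv \<mu> G (F_lim u) \<omega>" and ?y = "adv \<mu> G (F_lim v) \<omega>"
      assume s: "sgn ?x = sgn ?y" and e: "\<bar>?x\<bar> = \<kappa> * ?x + m" "\<bar>?y\<bar> = \<kappa> * ?y + m"
      consider "?x > 0" "?y > 0" | "?x < 0" "?y < 0" | "?x = 0" "?y = 0"
        using s by (auto simp: sgn_if split: if_splits)
      then show "?x = ?y"
      proof cases
        case 1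
        then have "(1 - \<kappa>) * (?x - ?y) = 0" using e by (simp add: algebra_simps)
        then show ?thesis using \<kappa>' by simp
      next
        case 2
        then have "(1 + \<kappa>) * (?x - ?y) = 0" using e by (simp add: algebra_simps)
        then show ?thesis using \<kappa>' by simp
      qed simp
    qed
  qed
qed

lemma cond_exp_state_signal:
  assumes u: "u \<in> pverts G" and B: "B \<in> sets (\<mu> True)"
  shows "cond_exp_state s (\<lambda>\<omega>. indicator B (snd \<omega> u)) = measure (\<mu> s) B"
proof -
  have Bs: "B \<in> sets (\<mu> s)" using B signal_laws_sets[OF laws] by blast
  have "cond_exp_state s (\<lambda>\<omega>. indicator B (snd \<omega> u)) = (\<integral>w. indicator B (w u) \<partial>signals \<mu> (pverts G) s)"
    by (simp add: cond_exp_state_def)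
  also have "\<dots> = (\<integral>y. indicator B y \<partial>distr (signals \<mu> (pverts G) s) (\<mu> s) (\<lambda>w. w u))"
    using u Bs by (intro integral_distr[symmetric]) auto
  also have "distr (signals \<mu> (pverts G) s) (\<mu> s) (\<lambda>w. w u) = \<mu> s"
    using distr_PiM_component[of "pverts G" "\<lambda>_. \<mu> s" u] u signal_laws_prob_space[OF laws] by auto
  finally show ?thesis using Bs by simp
qed

text \<open>Each agent's belief accounts for its own signal. If all beliefs coincide, then the common
  belief is almost uncorrelated, given the state, with the signals of distant agents, and so it can
  account for their signals only if it is the state itself.\<close>

lemma common_belief_is_correct:
  assumes inf: "infinite (pverts G)" and u: "u \<in> pverts G"
    and eq: "\<And>v. v \<in> pverts G \<Longrightarrow> AE \<omega> in M. adv \<mu> G (F_lim v) \<omega> = adv \<mu> G (F_lim u) \<omega>"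
  shows "1 \<le> expectation (\<lambda>\<omega>. \<bar>adv \<mu> G (F_lim u) \<omega>\<bar>)"
proof -
  note subu = subalgebra_limit_info[OF u]
  \<comment> \<open>A signal event that tells the two laws apart.\<close>
  have "\<exists>B\<in>sets (\<mu> True). measure (\<mu> True) B \<noteq> measure (\<mu> False) B"
  proof (rule ccontr)
    assume *: "\<not> ?thesis"
    interpret T: prob_space "\<mu> True" by (rule signal_laws_prob_space[OF laws])
    interpret F: prob_space "\<mu> False" by (rule signal_laws_prob_space[OF laws])
    have "\<mu> True = \<mu> False"
      by (rule measure_eqI) (use * signal_laws_sets[OF laws] in \<open>auto simp: T.emeasure_eq_measure F.emeasure_eq_measure\<close>)
    then show False using laws by (simp add: signal_laws_def)
  qed
  then obtain B where B: "B \<in> sets (\<mu> True)" "measure (\<mu> True) B \<noteq> measure (\<mu> False) B" by blast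
  obtain v :: "nat \<Rightarrow> 'v" where v: "inj v" "range v \<subseteq> pverts G"
    using infinite_countable_subset[OF inf] by blast
  then have vV: "v n \<in> pverts G" for n by auto
  define g where "g n \<omega> = (indicator B (snd \<omega> (v n)) :: real)" for n and \<omega> :: "('v, 'o) outcome"
  have gb: "\<bar>g n \<omega>\<bar> \<le> 1" for n \<omega> by (simp add: g_def indicator_def)
  have gs: "g n \<in> borel_measurable H"
    if "space H = space M" "(\<lambda>\<omega>. snd \<omega> (v n)) -` B \<inter> space M \<in> sets H" for n H
    using borel_measurable_indicator[OF that(2)]
    by (rule measurable_cong[THEN iffD1, rotated]) (use that(1) in \<open>auto simp: g_def indicator_def\<close>)
  have gF: "g n \<in> borel_measurable (F (v n) 1)" for n
    by (rule gs) (use B(1) in \<open>auto simp: sets_info info_gen_def intro!: sigma_sets.Basic\<close>)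
  have gS: "g n \<in> borel_measurable (signals_of \<mu> (pverts G) {v n})" for n
    by (rule gs) (use B(1) in \<open>auto intro: vimage_signal_in_signals_of\<close>)
  have gM [measurable]: "g n \<in> borel_measurable M" for n
    by (rule measurable_from_subalg[OF subalgebra_info[OF vV] gF])
  \<comment> \<open>Beliefs are bounded by 1 only almost surely; clipping makes the bound hold
    everywhere, as decorrelation requires, and keeps measurability in
    \<open>F_lim u\<close>.\<close>
  define y where "y \<omega> = max (-1) (min 1 (adv \<mu> G (F_lim u) \<omega>))" for \<omega>
  have yF: "y \<in> borel_measurable (F_lim u)" unfolding y_def using adv_measurable by measurable
  have yM [measurable]: "y \<in> borel_measurable M" by (rule measurable_from_subalg[OF subu yF])
  have yb: "\<bar>y \<omega>\<bar> \<le> 1" for \<omega> by (auto simp: y_def)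
  have yeq: "AE \<omega> in M. y \<omega> = adv \<mu> G (F_lim u) \<omega>"
    using adv_bound[OF subu] by eventually_elim (auto simp: y_def)
  \<comment> \<open>Mean 0 of the belief means that its conditional means in the two states are
    opposite, leaving one unknown.\<close>
  have "expectation y = expectation (adv \<mu> G (F_lim u))"
    using yeq adv_measurable_world[OF subu] by (intro integral_cong_AE) auto
  then have y0: "cond_exp_state False y = - cond_exp_state True y"
    using expectation_adv[OF subu] expectation_cond_exp_state[OF yM yb] by simp
  let ?p = "\<lambda>s. measure (\<mu> s) B"
  have Eg: "cond_exp_state s (g n) = ?p s" for s n
    unfolding g_def by (rule cond_exp_state_signal[OF vV B(1)])
  \<comment> \<open>Agent \<open>v n\<close> knows its own signal, so against \<open>g n\<close> the
    state may be replaced by its belief, which is the common one.\<close>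
  have half: "(?p True - ?p False) / 2
      = (cond_exp_state True (\<lambda>\<omega>. y \<omega> * g n \<omega>) + cond_exp_state False (\<lambda>\<omega>. y \<omega> * g n \<omega>)) / 2" for n
  proof -
    have "(?p True - ?p False) / 2 = expectation (\<lambda>\<omega>. truth \<omega> * g n \<omega>)"
      unfolding expectation_truth_cond_exp_state[OF gM gb] Eg ..
    also have "\<dots> = expectation (\<lambda>\<omega>. adv \<mu> G (F_lim (v n)) \<omega> * g n \<omega>)"
      by (rule integral_truth_mult[OF subalgebra_limit_info[OF vV], of _ _ 1])
        (use measurable_info_limit_info[OF _ gF] gb in auto)
    also have "\<dots> = expectation (\<lambda>\<omega>. y \<omega> * g n \<omega>)"
    proof (rule integral_cong_AE)
      show "AE \<omega> in M. adv \<mu> G (F_lim (v n)) \<omega> * g n \<omega> = y \<omega> * g n \<omega>"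
        using eq[OF vV[of n]] yeq by eventually_elim simp
    qed (use adv_measurable_world[OF subalgebra_limit_info[OF vV]] in measurable)
    also have "\<dots> = (cond_exp_state True (\<lambda>\<omega>. y \<omega> * g n \<omega>) + cond_exp_state False (\<lambda>\<omega>. y \<omega> * g n \<omega>)) / 2"
      by (rule expectation_cond_exp_state[of _ 1]) (use mult_mono[OF yb gb] in \<open>auto simp: abs_mult\<close>)
    finally show ?thesis .
  qed
  have cancel: "x / 2 = z / 2 \<Longrightarrow> z = x" for x z :: real by simp
  have eqn: "cond_exp_state True (\<lambda>\<omega>. y \<omega> * g n \<omega>) + cond_exp_state False (\<lambda>\<omega>. y \<omega> * g n \<omega>)
      = ?p True - ?p False" for n by (rule cancel[OF half])
  have lim: "(\<lambda>n. cond_exp_state s (\<lambda>\<omega>. y \<omega> * g n \<omega>) - cond_exp_state s y * cond_exp_state s (g n)) \<longlonglongrightarrow> 0" for s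
    by (rule cond_exp_state_decorrelate[OF yM yb _ _ gS gb]) (use v in \<open>auto simp: inj_eq\<close>)
  have "(\<lambda>n. (cond_exp_state True (\<lambda>\<omega>. y \<omega> * g n \<omega>) - cond_exp_state True y * cond_exp_state True (g n))
      + (cond_exp_state False (\<lambda>\<omega>. y \<omega> * g n \<omega>) - cond_exp_state False y * cond_exp_state False (g n))) \<longlonglongrightarrow> 0 + 0"
    by (intro tendsto_add lim)
  \<comment> \<open>With c the mean of \<open>y\<close> in state 1 and -c in state 0, decorrelation
    turns the exact identity into p1 - p0 = c (p1 - p0); as \<open>B\<close> separates the laws, c =
    1.\<close>
  moreover have "(cond_exp_state True (\<lambda>\<omega>. y \<omega> * g n \<omega>) - cond_exp_state True y * cond_exp_state True (g n))
      + (cond_exp_state False (\<lambda>\<omega>. y \<omega> * g n \<omega>) - cond_exp_state False y * cond_exp_state False (g n))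
      = (1 - cond_exp_state True y) * (?p True - ?p False)" for n
    using eqn[of n] unfolding Eg y0 by (simp add: algebra_simps)
  ultimately have "(\<lambda>n :: nat. (1 - cond_exp_state True y) * (?p True - ?p False)) \<longlonglongrightarrow> 0" by simp
  then have "(1 - cond_exp_state True y) * (?p True - ?p False) = 0" by (simp add: LIMSEQ_const_iff)
  then have "cond_exp_state True y = 1" using B(2) by simp
  then have "expectation (\<lambda>\<omega>. truth \<omega> * y \<omega>) = 1"
    unfolding expectation_truth_cond_exp_state[OF yM yb] y0 by simp
  moreover have "expectation (\<lambda>\<omega>. truth \<omega> * y \<omega>) \<le> expectation (\<lambda>\<omega>. \<bar>adv \<mu> G (F_lim u) \<omega>\<bar>)"
    by (rule integral_truth_mult_le[OF subu yF]) (simp add: yb)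
  ultimately show ?thesis by simp
qed

end

section \<open>The minimiser\<close>

text \<open>Twice the limiting probability of acting correctly, minus 1. The root remains an
  argument because local limits are taken of rooted networks.\<close>

definition limit_value :: "(bool \<Rightarrow> 'o measure) \<Rightarrow> ('v pair_pre_digraph \<Rightarrow> ('v, 'o) actions)
    \<Rightarrow> 'v pair_pre_digraph \<Rightarrow> 'v \<Rightarrow> real" where
  "limit_value \<mu> act G u =
     (\<integral>\<omega>. \<bar>adv \<mu> G (limit_info \<mu> G (act G) u) \<omega>\<bar> \<partial>world \<mu> (pverts G))"

context
  fixes \<mu> :: "bool \<Rightarrow> 'o measure" and act :: "'v pair_pre_digraph \<Rightarrow> ('v, 'o) actions"
  assumes laws: "signal_laws \<mu>" and model: "learning_model \<mu> act"
begin

lemma limit_value_bounds: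
  assumes "undirected_network G" "u \<in> pverts G"
  shows "0 \<le> limit_value \<mu> act G u" "limit_value \<mu> act G u \<le> 1"
proof -
  interpret network_process \<mu> G "act G" by (rule learning_model_process[OF laws model assms(1)])
  note sub = subalgebra_limit_info[OF assms(2)]
  show "0 \<le> limit_value \<mu> act G u" unfolding limit_value_def by (rule integral_nonneg_AE) auto
  have "AE \<omega> in M. \<bar>adv \<mu> G (F_lim u) \<omega>\<bar> \<le> 1" by (rule adv_bound[OF sub])
  then show "limit_value \<mu> act G u \<le> 1" unfolding limit_value_def
    using adv_integrable[OF sub] by (intro integral_le_const) auto
qed

lemma coupled_balls:
  assumes "bounded_network d G" "bounded_network d G'" "u \<in> pverts G" "u' \<in> pverts G'"
    and "ball_iso T G u G' u' h"
  shows "coupled_balls \<mu> act G G' u u' T h"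
  by unfold_locales (use assms laws model in \<open>auto dest: bounded_network_undirected\<close>)

text \<open>At a fixed time the value at \<open>x\<close> equals that at \<open>u n\<close> for
  large \<open>n\<close>, which is at most the limiting value there; time goes to infinity
  afterwards. Converging upper bounds \<open>c n\<close> take the place of a lower limit so that
  minimising sequences fit directly.\<close>

lemma limit_value_local_limit:
  assumes G: "\<And>n. bounded_network d (G n)" "\<And>n. u n \<in> pverts (G n)"
    and H: "bounded_network d H" "x \<in> pverts H"
    and iso: "\<And>T. eventually (\<lambda>n. \<exists>h. ball_iso T H x (G n) (u n) h) sequentially"
    and le: "\<And>n. limit_value \<mu> act (G n) (u n) \<le> c n" and c: "c \<longlonglongrightarrow> l"
  shows "limit_value \<mu> act H x \<le> l"
proof -
  interpret H: network_process \<mu> H "act H"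
    by (rule learning_model_process[OF laws model bounded_network_undirected[OF H(1)]])
  have "H.expectation (\<lambda>\<omega>. \<bar>adv \<mu> H (H.F x (Suc t)) \<omega>\<bar>) \<le> l" for t
  proof (rule tendsto_lowerbound[OF c])
    show "\<forall>\<^sub>F n in sequentially. H.expectation (\<lambda>\<omega>. \<bar>adv \<mu> H (H.F x (Suc t)) \<omega>\<bar>) \<le> c n"
      using iso[of "Suc t"]
    proof eventually_elim
      fix n assume "\<exists>h. ball_iso (Suc t) H x (G n) (u n) h"
      then obtain h where "ball_iso (Suc t) H x (G n) (u n) h" ..
      then interpret C: coupled_balls \<mu> act H "G n" x "u n" "Suc t" h
        by (rule coupled_balls[OF H(1) G(1) H(2) G(2)])
      have "H.expectation (\<lambda>\<omega>. \<bar>adv \<mu> H (H.F x (Suc t)) \<omega>\<bar>)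
          = C.P'.expectation (\<lambda>\<omega>. \<bar>adv \<mu> (G n) (C.P'.F (h x) (Suc t)) \<omega>\<bar>)"
        by (rule C.coupled_expectation[of x 0 "Suc t" abs]) auto
      also have "h x = u n" using C.iso by (rule ball_iso_root)
      also have "C.P'.expectation (\<lambda>\<omega>. \<bar>adv \<mu> (G n) (C.P'.F (u n) (Suc t)) \<omega>\<bar>)
          \<le> C.P'.expectation (\<lambda>\<omega>. \<bar>adv \<mu> (G n) (C.P'.F_lim (u n)) \<omega>\<bar>)"
        by (rule C.P'.adv_info_le_limit_info[OF G(2)]) simp
      also have "\<dots> \<le> c n" using le[of n] by (simp add: limit_value_def)
      finally show "H.expectation (\<lambda>\<omega>. \<bar>adv \<mu> H (H.F x (Suc t)) \<omega>\<bar>) \<le> c n" .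
    qed
  qed simp
  then show ?thesis
    unfolding limit_value_def by (intro LIMSEQ_le_const2[OF H.adv_abs_tendsto[OF H(2)]]) auto
qed

text \<open>The direct method: a minimising sequence has a local limit in the same class, and
  semicontinuity makes it a minimiser.\<close>

lemma limit_value_minimum:
  fixes G :: "'v pair_pre_digraph"
  assumes G: "bounded_network d G" "u \<in> pverts G"
  obtains H x where "bounded_network d H" "x \<in> pverts H"
    "\<And>G' u'. bounded_network d G' \<Longrightarrow> u' \<in> pverts G' \<Longrightarrow> limit_value \<mu> act H x \<le> limit_value \<mu> act G' u'"
proof -
  define V where "V = {limit_value \<mu> act G' u' | G' u'. bounded_network d G' \<and> u' \<in> pverts G'}"
  have V: "V \<noteq> {}" "bdd_below V"
  proof -
    show "V \<noteq> {}" using G unfolding V_def by blast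
    show "bdd_below V"
    proof (rule bdd_belowI)
      fix y assume "y \<in> V"
      then obtain G' u' where "y = limit_value \<mu> act G' u'" "bounded_network d G'" "u' \<in> pverts G'"
        unfolding V_def by blast
      then show "0 \<le> y" using limit_value_bounds(1)[OF bounded_network_undirected] by simp
    qed
  qed
  have "\<exists>G' u'. bounded_network d G' \<and> u' \<in> pverts G' \<and> limit_value \<mu> act G' u' \<le> Inf V + inverse (real (Suc n))" for n
  proof -
    have "Inf V < Inf V + inverse (real (Suc n))" by simp
    then obtain a where "a \<in> V" "a < Inf V + inverse (real (Suc n))" using cInf_lessD[OF V(1)] by blast
    then obtain G' u' where "a = limit_value \<mu> act G' u'" "bounded_network d G'" "u' \<in> pverts G'"
      unfolding V_def by blast
    then show ?thesis using \<open>a < _\<close> by (intro exI[of _ G'] exI[of _ u']) simp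
  qed
  then obtain Gs us where Gs: "\<And>n. bounded_network d (Gs n)" "\<And>n. us n \<in> pverts (Gs n)"
    and le: "\<And>n. limit_value \<mu> act (Gs n) (us n) \<le> Inf V + inverse (real (Suc n))" by metis
  obtain H x \<sigma> where H: "bounded_network d H" "x \<in> pverts H" and \<sigma>: "strict_mono (\<sigma> :: nat \<Rightarrow> nat)"
    and iso: "\<And>T. eventually (\<lambda>n. \<exists>h. ball_iso T H x (Gs (\<sigma> n)) (us (\<sigma> n)) h) sequentially"
    using bounded_network_local_limit[of d Gs us, OF Gs] by blast
  have lim: "(\<lambda>n. Inf V + inverse (real (Suc n))) \<longlonglongrightarrow> Inf V + 0"
    by (intro tendsto_add tendsto_const LIMSEQ_inverse_real_of_nat)
  have "limit_value \<mu> act H x \<le> Inf V + 0"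
    by (rule limit_value_local_limit[OF Gs H iso le]) (use LIMSEQ_subseq_LIMSEQ[OF lim \<sigma>] in \<open>simp add: o_def\<close>)
  moreover have "Inf V \<le> limit_value \<mu> act G' u'" if G': "bounded_network d G'" "u' \<in> pverts G'" for G' u'
  proof (rule cInf_lower[OF _ V(2)])
    show "limit_value \<mu> act G' u' \<in> V" using G' unfolding V_def by blast
  qed
  ultimately have "limit_value \<mu> act H x \<le> limit_value \<mu> act G' u'"
    if "bounded_network d G'" "u' \<in> pverts G'" for G' u'
    using that by (metis add_0_right order_trans)
  then show ?thesis by (rule that[OF H])
qed

lemma limit_value_minimum_eq_1:
  assumes agree: "\<And>H. undirected_network H \<Longrightarrow> agents_agree \<mu> H (act H)"
    and H: "bounded_network d H" "x \<in> pverts H"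
    and min: "\<And>G' u'. bounded_network d G' \<Longrightarrow> u' \<in> pverts G' \<Longrightarrow> limit_value \<mu> act H x \<le> limit_value \<mu> act G' u'"
  shows "limit_value \<mu> act H x = 1"
proof -
  have unH: "undirected_network H" using H(1) by (rule bounded_network_undirected)
  interpret H: network_process \<mu> H "act H" by (rule learning_model_process[OF laws model unH])
  define m where "m = limit_value \<mu> act H x"
  define a where "a = (\<lambda>\<omega>. sgn (adv \<mu> H (H.F_lim x) \<omega>))"
  define \<kappa> where "\<kappa> = (H.cond_exp_state True a + H.cond_exp_state False a) / 2"
  have aM: "a \<in> borel_measurable H.M"
    unfolding a_def using H.adv_measurable_world[OF H.subalgebra_limit_info[OF H(2)]] by measurable
  have a1: "\<bar>a \<omega>\<bar> \<le> 1" for \<omega> by (simp add: a_def sgn_if)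
  have "m = H.expectation (\<lambda>\<omega>. truth \<omega> * a \<omega>)"
    unfolding m_def limit_value_def a_def H.integral_truth_sgn[OF H.subalgebra_limit_info[OF H(2)]] ..
  also have "\<dots> = (H.cond_exp_state True a - H.cond_exp_state False a) / 2"
    by (rule H.expectation_truth_cond_exp_state[OF aM a1])
  finally have m: "m = (H.cond_exp_state True a - H.cond_exp_state False a) / 2" .
  \<comment> \<open>Since \<open>a\<close> is bounded by 1, so are its conditional means \<kappa> +
    m and \<kappa> - m; this is the source of both constraints on \<kappa>.\<close>
  have "\<kappa> + m = H.cond_exp_state True a" "\<kappa> - m = H.cond_exp_state False a"
    unfolding \<kappa>_def m by (simp_all add: field_simps)
  then have \<kappa>: "\<kappa> + m \<le> 1" "- 1 \<le> \<kappa> - m"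
    using H.cond_exp_state_abs_le[OF aM a1, of True] H.cond_exp_state_abs_le[OF aM a1, of False]
    by (auto simp: abs_le_iff)
  have m0: "m \<ge> 0" unfolding m_def by (rule limit_value_bounds(1)[OF unH H(2)])
  have \<kappa>1: "\<bar>\<kappa>\<bar> \<le> 1" using \<kappa> m0 by linarith
  obtain v where v: "\<And>n. v n \<in> pverts H"
    and far: "\<And>i j. i < j \<Longrightarrow> ball_verts H j (v i) \<inter> ball_verts H j (v j) = {}"
    using bounded_network_far_apart[OF H(1)] by blast
  obtain H' x' \<sigma> where H': "bounded_network d H'" "x' \<in> pverts H'" and \<sigma>: "strict_mono (\<sigma> :: nat \<Rightarrow> nat)"
    and iso: "\<And>T. eventually (\<lambda>n. \<exists>h. ball_iso T H' x' H (v (\<sigma> n)) h) sequentially"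
    using bounded_network_local_limit[of d "\<lambda>_. H" v, OF H(1) v] by blast
  have unH': "undirected_network H'" using H'(1) by (rule bounded_network_undirected)
  interpret H': network_process \<mu> H' "act H'" by (rule learning_model_process[OF laws model unH'])
  define \<psi> where "\<psi> t = max \<bar>t\<bar> (\<kappa> * t + m)" for t :: real
  have \<psi>M [measurable]: "\<psi> \<in> borel_measurable borel" unfolding \<psi>_def by measurable
  have finite_time: "H'.expectation (\<lambda>\<omega>. \<psi> (adv \<mu> H' (H'.F z T) \<omega>)) \<le> m"
    if z: "z \<in> pverts H'" and T: "1 \<le> T" for z T
  proof -
    obtain r where r: "z \<in> ball_verts H' r x'" by (rule ball_verts_exhaust[OF unH' H'(2) z])
    \<comment> \<open>Large enough that the ball of radius \<open>T\<close> around \<open>z\<close>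
      lies within the ball around the root that is copied into \<open>H\<close>.\<close>
    define R where "R = r + T"
    define h where "h n = (SOME h. ball_iso R H' x' H (v (\<sigma> n)) h)" for n
    define good where "good n \<longleftrightarrow> ball_iso R H' x' H (v (\<sigma> n)) (h n)" for n
    have "\<forall>\<^sub>F n in sequentially. good n"
      using iso[of R] unfolding good_def h_def by eventually_elim (erule someI_ex)
    then obtain N0 where N0: "\<And>n. n \<ge> N0 \<Longrightarrow> good n" by (auto simp: eventually_sequentially)
    \<comment> \<open>Beyond \<open>N0\<close> the isomorphisms exist. Beyond \<open>R\<close> the
      radius of separation, at least the index, exceeds or equals \<open>R\<close>, so the copies of
      the whole ball are disjoint.\<close>
    define N where "N = max N0 R"
    define w where "w n = h (n + N) z" for n
    have good: "good (n + N)" for n using N0[of "n + N"] by (simp add: N_def)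
    have C: "coupled_balls \<mu> act H' H x' (v (\<sigma> (n + N))) R (h (n + N))" for n
      by (rule coupled_balls[OF H'(1) H(1) H'(2) v]) (use good in \<open>simp add: good_def\<close>)
    have ball: "ball_verts H T (w n) \<subseteq> ball_verts H R (v (\<sigma> (n + N)))" for n
    proof -
      interpret C: coupled_balls \<mu> act H' H x' "v (\<sigma> (n + N))" R "h (n + N)" by (rule C)
      have "ball_iso r H' x' H (v (\<sigma> (n + N))) (h (n + N))"
        using ball_iso_sub[OF C.iso ball_verts_refl, of 0 r] ball_iso_root[OF C.iso] by (simp add: R_def)
      then have "w n \<in> ball_verts H r (v (\<sigma> (n + N)))"
        unfolding w_def ball_iso_def using r by (auto dest: bij_betw_apply)
      then show ?thesis unfolding R_def using ball_verts_trans by fast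
    qed
    have wV: "w n \<in> pverts H" for n
      using ball[of n] ball_verts_refl[of "w n" H T] ball_verts_subset_pverts[OF unH v] by blast
    have disj: "ball_verts H T (w i) \<inter> ball_verts H T (w j) = {}" if "i < j" for i j
    proof -
      let ?i = "\<sigma> (i + N)" and ?j = "\<sigma> (j + N)"
      have ij: "?i < ?j" using \<sigma> that by (simp add: strict_mono_def)
      have "R \<le> j + N" by (simp add: N_def)
      also have "\<dots> \<le> ?j" by (rule seq_suble[OF \<sigma>])
      finally have "ball_verts H R (v ?i) \<subseteq> ball_verts H ?j (v ?i)" "ball_verts H R (v ?j) \<subseteq> ball_verts H ?j (v ?j)"
        by (simp_all add: ball_verts_mono)
      then show ?thesis using far[OF ij] ball[of i] ball[of j] by blast
    qed
    have "\<exists>\<delta>. \<delta> \<longlonglongrightarrow> 0 \<and> (\<forall>n. H.expectation (\<lambda>\<omega>. \<psi> (adv \<mu> H (H.F (w n) T) \<omega>)) + \<delta> n \<le> m)"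
      unfolding \<psi>_def m_def limit_value_def \<kappa>_def a_def
      by (rule H.distant_belief_bound[OF agree[OF unH] H(2) wV T]) (rule disj)
    then obtain \<delta> where \<delta>: "\<delta> \<longlonglongrightarrow> 0"
      and le: "\<And>n. H.expectation (\<lambda>\<omega>. \<psi> (adv \<mu> H (H.F (w n) T) \<omega>)) + \<delta> n \<le> m" by blast
    \<comment> \<open>The expectation in \<open>H'\<close> is the same for every copy
      \<open>w n\<close>, so it can be held fixed while \<open>\<delta> n\<close> tends to
      0.\<close>
    have eq: "H'.expectation (\<lambda>\<omega>. \<psi> (adv \<mu> H' (H'.F z T) \<omega>)) = H.expectation (\<lambda>\<omega>. \<psi> (adv \<mu> H (H.F (w n) T) \<omega>))" for n
    proof -
      interpret C: coupled_balls \<mu> act H' H x' "v (\<sigma> (n + N))" R "h (n + N)" by (rule C)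
      show ?thesis unfolding w_def by (rule C.coupled_expectation[OF r _ T \<psi>M]) (simp add: R_def)
    qed
    have "(\<lambda>n. H'.expectation (\<lambda>\<omega>. \<psi> (adv \<mu> H' (H'.F z T) \<omega>)) + \<delta> n)
        \<longlonglongrightarrow> H'.expectation (\<lambda>\<omega>. \<psi> (adv \<mu> H' (H'.F z T) \<omega>)) + 0"
      by (intro tendsto_add tendsto_const \<delta>)
    then have "H'.expectation (\<lambda>\<omega>. \<psi> (adv \<mu> H' (H'.F z T) \<omega>)) + 0 \<le> m"
      by (rule LIMSEQ_le_const2) (use le eq in auto)
    then show ?thesis by simp
  qed
  have le: "H'.expectation (\<lambda>\<omega>. \<psi> (adv \<mu> H' (H'.F_lim z) \<omega>)) \<le> m" if z: "z \<in> pverts H'" for z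
    unfolding \<psi>_def by (rule H'.belief_bound_limit[OF z \<kappa>1]) (use finite_time[OF z] in \<open>simp add: \<psi>_def\<close>)
  have abs: "H'.expectation (\<lambda>\<omega>. \<bar>adv \<mu> H' (H'.F_lim z) \<omega>\<bar>) = m" if z: "z \<in> pverts H'" for z
  proof (rule antisym)
    have "integrable H'.M (adv \<mu> H' (H'.F_lim z))" by (rule H'.adv_integrable[OF H'.subalgebra_limit_info[OF z]])
    then have "H'.expectation (\<lambda>\<omega>. \<bar>adv \<mu> H' (H'.F_lim z) \<omega>\<bar>) \<le> H'.expectation (\<lambda>\<omega>. \<psi> (adv \<mu> H' (H'.F_lim z) \<omega>))"
      unfolding \<psi>_def by (intro integral_mono) auto
    then show "H'.expectation (\<lambda>\<omega>. \<bar>adv \<mu> H' (H'.F_lim z) \<omega>\<bar>) \<le> m" using le[OF z] by simp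
    \<comment> \<open>Minimality of \<open>H\<close>, with \<open>H'\<close> as competitor.\<close>
    show "m \<le> H'.expectation (\<lambda>\<omega>. \<bar>adv \<mu> H' (H'.F_lim z) \<omega>\<bar>)"
      using min[OF H'(1) z] by (simp add: m_def limit_value_def)
  qed
  have "1 \<le> H'.expectation (\<lambda>\<omega>. \<bar>adv \<mu> H' (H'.F_lim x') \<omega>\<bar>)"
  proof (rule H'.common_belief_is_correct[OF _ H'(2)])
    show "infinite (pverts H')" using H'(1) by (simp add: bounded_network_def)
    show "AE \<omega> in H'.M. adv \<mu> H' (H'.F_lim z) \<omega> = adv \<mu> H' (H'.F_lim x') \<omega>" if "z \<in> pverts H'" for z
      by (rule H'.sign_determines_belief[OF agree[OF unH'] \<kappa> abs le[unfolded \<psi>_def] that H'(2)])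
  qed
  then have "1 \<le> m" using abs[OF H'(2)] by simp
  then show ?thesis using limit_value_bounds(2)[OF unH H(2)] by (simp add: m_def)
qed

end

theorem theorem3p41:
  fixes \<mu> :: "bool \<Rightarrow> 'o measure"
    and act :: "'v pair_pre_digraph \<Rightarrow> ('v, 'o) actions"
    and G :: "'v pair_pre_digraph"
  assumes "signal_laws \<mu>"
    and "learning_model \<mu> act"
    and "\<And>H. undirected_network H \<Longrightarrow> agents_agree \<mu> H (act H)"
    and "undirected_network G"
    and "infinite (pverts G)"
    and "bounded_degrees G"
  shows "has_learning_prob \<mu> G (act G) 1"
  unfolding has_learning_prob_def
proof
  fix u assume u: "u \<in> pverts G"
  obtain d where G: "bounded_network d G"
    using assms(4-6) by (auto simp: bounded_degrees_def bounded_network_def)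
  interpret network_process \<mu> G "act G" by (rule learning_model_process[OF assms(1,2,4)])
  obtain H x where H: "bounded_network d H" "x \<in> pverts H"
    and min: "\<And>G' u'. bounded_network d G' \<Longrightarrow> u' \<in> pverts G' \<Longrightarrow> limit_value \<mu> act H x \<le> limit_value \<mu> act G' u'"
    using limit_value_minimum[OF assms(1,2) G u] by blast
  have "limit_value \<mu> act H x = 1"
    by (rule limit_value_minimum_eq_1[OF assms(1,2,3) H min])
  \<comment> \<open>Values never exceed 1, so a minimum of 1 forces the value 1 throughout the
    class.\<close>
  then have "limit_value \<mu> act G u = 1"
    using min[OF G u] limit_value_bounds(2)[OF assms(1,2,4) u] by simp
  then show "(\<lambda>t. prob {\<omega> \<in> space M. act G u t \<omega> = fst \<omega>}) \<longlonglongrightarrow> 1"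
    using prob_correct_tendsto[OF u] by (simp add: limit_value_def)
qed

end
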